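(* Let $A=\Bbbk Q/I$ be a finite-dimensional triangular monomial algebra. Then the cup product on the Hochschild cohomology $\mathrm{HH}^*(A)=\bigoplus_{i\ge0}\mathrm{Ext}^i_{A\otimes_\Bbbk A^{\mathrm{op}}}(A,A)$ vanishes in positive degrees: for all $m,n\ge 1$, $x\in\mathrm{HH}^m(A)$ and $y\in\mathrm{HH}^n(A)$, one has $x\smile y=0$.
   Context: Let $\Bbbk$ be a field and $Q$ a finite quiver. $A=\Bbbk Q/I$ is a monomial algebra if $I$ is an ideal generated by paths (of length at least $2$); it is triangular if $Q$ has no oriented cycles. The cup product on Hochschild cohomology is the standard (Gerstenhaber) cup product, which makes $\mathrm{HH}^*(A)$ a graded-commutative algebra. *)

theory Defs
  imports Main
begin

text \<open>A finite quiver is given by a finite vertex set V, a finite arrow set E and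
source/target maps s t.  A path is a pair (v, xs): its starting vertex v and its list of
arrows xs, composed left to right (t of each arrow = s of the next).  The trivial path at v
is (v, []).\<close>

type_synonym ('v,'e) qpath = "'v \<times> 'e list"

definition is_quiver :: "'v set \<Rightarrow> 'e set \<Rightarrow> ('e \<Rightarrow> 'v) \<Rightarrow> ('e \<Rightarrow> 'v) \<Rightarrow> bool" where
  "is_quiver V E s t \<longleftrightarrow> finite V \<and> finite E \<and> (\<forall>a\<in>E. s a \<in> V \<and> t a \<in> V)"

definition is_path :: "'v set \<Rightarrow> 'e set \<Rightarrow> ('e \<Rightarrow> 'v) \<Rightarrow> ('e \<Rightarrow> 'v) \<Rightarrow> ('v,'e) qpath \<Rightarrow> bool" where
  "is_path V E s t p \<longleftrightarrow> fst p \<in> V \<and> set (snd p) \<subseteq> E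
     \<and> (snd p \<noteq> [] \<longrightarrow> s (hd (snd p)) = fst p)
     \<and> (\<forall>i. Suc i < length (snd p) \<longrightarrow> t (snd p ! i) = s (snd p ! Suc i))"

definition path_end :: "('e \<Rightarrow> 'v) \<Rightarrow> ('v,'e) qpath \<Rightarrow> 'v" where
  "path_end t p = (if snd p = [] then fst p else t (last (snd p)))"

definition triangular :: "'v set \<Rightarrow> 'e set \<Rightarrow> ('e \<Rightarrow> 'v) \<Rightarrow> ('e \<Rightarrow> 'v) \<Rightarrow> bool" where
  "triangular V E s t \<longleftrightarrow> (\<forall>p. is_path V E s t p \<and> snd p \<noteq> [] \<longrightarrow> path_end t p \<noteq> fst p)"

definition monomial_relations ::
  "'v set \<Rightarrow> 'e set \<Rightarrow> ('e \<Rightarrow> 'v) \<Rightarrow> ('e \<Rightarrow> 'v) \<Rightarrow> ('v,'e) qpath set \<Rightarrow> bool" where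
  "monomial_relations V E s t R \<longleftrightarrow> (\<forall>r\<in>R. is_path V E s t r \<and> length (snd r) \<ge> 2)"

text \<open>The paths not lying in I = (R): those containing no element of R as a subpath.
Their residue classes form the standard k-basis of A = kQ/I.\<close>
definition nz_paths ::
  "'v set \<Rightarrow> 'e set \<Rightarrow> ('e \<Rightarrow> 'v) \<Rightarrow> ('e \<Rightarrow> 'v) \<Rightarrow> ('v,'e) qpath set \<Rightarrow> ('v,'e) qpath set" where
  "nz_paths V E s t R = {p. is_path V E s t p \<and>
       \<not> (\<exists>r\<in>R. \<exists>xs ys. snd p = xs @ snd r @ ys)}"

text \<open>Elements of A: k-valued coefficient functions supported on the basis B.\<close>
definition in_alg :: "('v,'e) qpath set \<Rightarrow> (('v,'e) qpath \<Rightarrow> 'k::field) \<Rightarrow> bool" where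
  "in_alg B x \<longleftrightarrow> (\<forall>p. p \<notin> B \<longrightarrow> x p = 0)"

definition alg_mult :: "('e \<Rightarrow> 'v) \<Rightarrow> ('v,'e) qpath set \<Rightarrow>
    (('v,'e) qpath \<Rightarrow> 'k::field) \<Rightarrow> (('v,'e) qpath \<Rightarrow> 'k) \<Rightarrow> (('v,'e) qpath \<Rightarrow> 'k)" where
  "alg_mult t B x y = (\<lambda>r. if r \<in> B then
      (\<Sum>pq\<in>{pq \<in> B \<times> B. path_end t (fst pq) = fst (snd pq)
                        \<and> (fst (fst pq), snd (fst pq) @ snd (snd pq)) = r}.
         x (fst pq) * y (snd pq))
      else 0)"

definition hoch_cochain :: "('v,'e) qpath set \<Rightarrow> nat \<Rightarrow>
    ((('v,'e) qpath \<Rightarrow> 'k::field) list \<Rightarrow> (('v,'e) qpath \<Rightarrow> 'k)) \<Rightarrow> bool" where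
  "hoch_cochain B n f \<longleftrightarrow>
     (\<forall>as. length as = n \<and> (\<forall>a\<in>set as. in_alg B a) \<longrightarrow> in_alg B (f as)) \<and>
     (\<forall>as i x y c. length as = n \<and> (\<forall>a\<in>set as. in_alg B a) \<and> i < n \<and> in_alg B x \<and> in_alg B y \<longrightarrow>
        f (as[i := (\<lambda>p. x p + y p)]) = (\<lambda>p. f (as[i := x]) p + f (as[i := y]) p) \<and>
        f (as[i := (\<lambda>p. c * x p)]) = (\<lambda>p. c * f (as[i := x]) p))"

definition hoch_d :: "('e \<Rightarrow> 'v) \<Rightarrow> ('v,'e) qpath set \<Rightarrow> nat \<Rightarrow>
    ((('v,'e) qpath \<Rightarrow> 'k::field) list \<Rightarrow> (('v,'e) qpath \<Rightarrow> 'k)) \<Rightarrow>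
    (('v,'e) qpath \<Rightarrow> 'k) list \<Rightarrow> (('v,'e) qpath \<Rightarrow> 'k)" where
  "hoch_d t B n f as = (\<lambda>r.
      alg_mult t B (as ! 0) (f (tl as)) r
    + (\<Sum>i<n. (-1) ^ (i + 1) *
          f (take i as @ [alg_mult t B (as ! i) (as ! Suc i)] @ drop (i + 2) as) r)
    + (-1) ^ (n + 1) * alg_mult t B (f (take n as)) (as ! n) r)"

definition hoch_cocycle :: "('e \<Rightarrow> 'v) \<Rightarrow> ('v,'e) qpath set \<Rightarrow> nat \<Rightarrow>
    ((('v,'e) qpath \<Rightarrow> 'k::field) list \<Rightarrow> (('v,'e) qpath \<Rightarrow> 'k)) \<Rightarrow> bool" where
  "hoch_cocycle t B n f \<longleftrightarrow> hoch_cochain B n f \<and>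
     (\<forall>as. length as = Suc n \<and> (\<forall>a\<in>set as. in_alg B a) \<longrightarrow> hoch_d t B n f as = (\<lambda>_. 0))"

definition hoch_coboundary :: "('e \<Rightarrow> 'v) \<Rightarrow> ('v,'e) qpath set \<Rightarrow> nat \<Rightarrow>
    ((('v,'e) qpath \<Rightarrow> 'k::field) list \<Rightarrow> (('v,'e) qpath \<Rightarrow> 'k)) \<Rightarrow> bool" where
  "hoch_coboundary t B n f \<longleftrightarrow> (\<exists>h. hoch_cochain B (n - 1) h \<and>
     (\<forall>as. length as = n \<and> (\<forall>a\<in>set as. in_alg B a) \<longrightarrow> hoch_d t B (n - 1) h as = f as))"

definition hoch_cup :: "('e \<Rightarrow> 'v) \<Rightarrow> ('v,'e) qpath set \<Rightarrow> nat \<Rightarrow>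
    ((('v,'e) qpath \<Rightarrow> 'k::field) list \<Rightarrow> (('v,'e) qpath \<Rightarrow> 'k)) \<Rightarrow>
    ((('v,'e) qpath \<Rightarrow> 'k) list \<Rightarrow> (('v,'e) qpath \<Rightarrow> 'k)) \<Rightarrow>
    (('v,'e) qpath \<Rightarrow> 'k) list \<Rightarrow> (('v,'e) qpath \<Rightarrow> 'k)" where
  "hoch_cup t B m f g as = alg_mult t B (f (take m as)) (g (drop m as))"

end

theory Submission
  imports Defs "HOL-Library.FuncSet"
begin

text \<open>By Gerstenhaber, f \<smile> g and g \<smile> f agree up to sign and up to a coboundary, so it suffices to
write every cocycle of positive degree, modulo coboundaries, as a sum of cocycles f for which one of
the two products vanishes identically.  The pieces used are cocycles supported on composable tuples
of paths that run through a given arrow a: if f runs through a and g through b, then f \<smile> g \<noteq> 0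
requires a path on which a precedes b, and g \<smile> f \<noteq> 0 one on which b precedes a; without oriented
cycles at most one of these exists.

To obtain the pieces, first restrict to composable tuples and parallel values, by a prism homotopy.
The values parallel to but different from the product path w of the tuple are sorted by the first
arrow at which w differs from them; the differential preserves this arrow.  What is left is a
cocycle with values in the multiples of w.  As a function of the points at which w is cut, it is
rewritten as a telescoping sum over the arrows a of the last segment, and each summand is again a
cocycle.\<close>

section \<open>Multilinear cochains on a based algebra\<close>

text \<open>The pieces must be cocycles one by one because the commutation formula
  \<open>dif_brace\<close> is stated for two cocycles; hence the care for splittings that the
  differential respects. The arrow attached to a piece is read off the arguments and not off the
  value: values are parallel to the product path of their arguments, so whenever two values compose,
  the two argument paths compose as well, and the joint path (which may lie in I) shows the order of
  the arrows.

  A value that is a multiple of w itself has no first difference, so it needs another invariant.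
  Write such a value as phi times w, and the tuple as w with cut points c_0 <= ... <= c_n. Dropping
  the first argument, merging two neighbours and dropping the last argument each delete one cut
  point, so phi obeys the simplicial cocycle identity. The last cut point is moved from c_(n-1) to
  the end of w one arrow at a time; the increment of phi at the arrow a is the piece for a. Cochains
  are not normalised, so the degenerate value at c_n = c_(n-1) remains; it is a coboundary.

  The circle product and the prism homotopy rest on one and the same sign computation,
  \<open>sum_insertion_merge\<close>.\<close>

lemma minus_one_power_cong: "even (a + b) \<Longrightarrow> (-1::'a::ring_1) ^ a = (-1) ^ b"
  by (cases "even a") (auto simp: minus_one_power_iff)

definition bas :: "'p \<Rightarrow> 'p \<Rightarrow> 'k::field" where
  "bas p = (\<lambda>q. if q = p then 1 else 0)"

text \<open>One equation encodes linearity together with the fact that only the coefficients on B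
  count. It is required for all functions, so no argument has to be guarded by membership in the
  algebra.\<close>

definition lin :: "'p set \<Rightarrow> (('p \<Rightarrow> 'k::field) \<Rightarrow> 'p \<Rightarrow> 'k) \<Rightarrow> bool" where
  "lin B u \<longleftrightarrow> (\<forall>a r. u a r = (\<Sum>p\<in>B. a p * u (bas p) r))"

lemma lin_expand: "lin B u \<Longrightarrow> u a r = (\<Sum>p\<in>B. a p * u (bas p) r)"
  unfolding lin_def by blast

lemma linI: "(\<And>a r. u a r = (\<Sum>p\<in>B. a p * u (bas p) r)) \<Longrightarrow> lin B u"
  unfolding lin_def by blast

lemma lin_eqI:
  assumes "lin B u" "lin B v" "\<And>p. p \<in> B \<Longrightarrow> u (bas p) r = v (bas p) r"
  shows "u a r = v a r"
  using assms by (simp add: lin_expand[OF assms(1), of a] lin_expand[OF assms(2), of a])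

lemma lin_add:
  assumes "lin B u"
  shows "u (\<lambda>p. a p + b p) r = u a r + u b r"
  unfolding lin_expand[OF assms, of "\<lambda>p. a p + b p"] lin_expand[OF assms, of a] lin_expand[OF assms, of b]
  by (simp add: sum.distrib distrib_right)

lemma lin_scale:
  assumes "lin B u"
  shows "u (\<lambda>p. c * a p) r = c * u a r"
  unfolding lin_expand[OF assms, of "\<lambda>p. c * a p"] lin_expand[OF assms, of a]
  by (simp add: sum_distrib_left mult.assoc)

lemma lin_sum:
  assumes "lin B u"
  shows "u (\<lambda>p. \<Sum>i\<in>I. c i * y i p) r = (\<Sum>i\<in>I. c i * u (y i) r)"
proof -
  have "u (\<lambda>p. \<Sum>i\<in>I. c i * y i p) r = (\<Sum>p\<in>B. \<Sum>i\<in>I. c i * y i p * u (bas p) r)"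
    by (subst lin_expand[OF assms]) (simp add: sum_distrib_right)
  also have "\<dots> = (\<Sum>i\<in>I. \<Sum>p\<in>B. c i * y i p * u (bas p) r)" by (rule sum.swap)
  also have "\<dots> = (\<Sum>i\<in>I. c i * u (y i) r)"
    by (rule sum.cong[OF refl]) (simp add: lin_expand[OF assms, of "y _"] sum_distrib_left mult.assoc)
  finally show ?thesis .
qed

lemma lin_zero: "lin B u \<Longrightarrow> u (\<lambda>p. 0) r = 0"
  using lin_scale[of B u 0 "\<lambda>p. 0" r] by simp

lemma lin_cong_on:
  assumes "lin B u" "\<And>p. p \<in> B \<Longrightarrow> a p = b p"
  shows "u a = u b"
proof
  fix r show "u a r = u b r"
    unfolding lin_expand[OF assms(1), of a] lin_expand[OF assms(1), of b] using assms(2) by simp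
qed

lemma lin_comp:
  assumes u: "lin B u" and v: "lin B v"
  shows "lin B (\<lambda>a. u (v a))"
proof (rule linI)
  fix a r
  have "u (v a) r = u (\<lambda>q. \<Sum>p\<in>B. a p * v (bas p) q) r"
    by (simp add: lin_expand[OF v, of a, abs_def])
  also have "\<dots> = (\<Sum>p\<in>B. a p * u (v (bas p)) r)" by (rule lin_sum[OF u])
  finally show "u (v a) r = (\<Sum>p\<in>B. a p * u (v (bas p)) r)" .
qed

lemma lin_plus:
  assumes "lin B u" "lin B v" shows "lin B (\<lambda>a r. u a r + v a r)"
proof (rule linI)
  fix a r show "u a r + v a r = (\<Sum>p\<in>B. a p * (u (bas p) r + v (bas p) r))"
    unfolding lin_expand[OF assms(1), of a] lin_expand[OF assms(2), of a]
    by (simp add: sum.distrib distrib_left)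
qed

lemma lin_scaled:
  assumes "lin B u" shows "lin B (\<lambda>a r. c * u a r)"
proof (rule linI)
  fix a r show "c * u a r = (\<Sum>p\<in>B. a p * (c * u (bas p) r))"
    by (subst lin_expand[OF assms]) (simp add: sum_distrib_left mult.left_commute)
qed

lemma lin_sums:
  assumes "\<And>i. i \<in> I \<Longrightarrow> lin B (u i)" shows "lin B (\<lambda>a r. \<Sum>i\<in>I. u i a r)"
proof (rule linI)
  fix a r
  have "(\<Sum>i\<in>I. u i a r) = (\<Sum>i\<in>I. \<Sum>p\<in>B. a p * u i (bas p) r)"
    by (rule sum.cong[OF refl]) (use lin_expand[OF assms] in blast)
  also have "\<dots> = (\<Sum>p\<in>B. \<Sum>i\<in>I. a p * u i (bas p) r)" by (rule sum.swap)
  finally show "(\<Sum>i\<in>I. u i a r) = (\<Sum>p\<in>B. a p * (\<Sum>i\<in>I. u i (bas p) r))"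
    by (simp add: sum_distrib_left)
qed

definition sh :: "nat \<Rightarrow> (nat \<Rightarrow> 'a) \<Rightarrow> nat \<Rightarrow> 'a" where
  "sh k x = (\<lambda>j. x (j + k))"

text \<open>The operation c is a parameter because both products of algebra elements
  (\<open>mul\<close>) and concatenations of basis paths (\<open>cmp\<close>) get merged.\<close>

definition merge_at :: "('a \<Rightarrow> 'a \<Rightarrow> 'a) \<Rightarrow> nat \<Rightarrow> (nat \<Rightarrow> 'a) \<Rightarrow> nat \<Rightarrow> 'a" where
  "merge_at c i x = (\<lambda>j. if j < i then x j else if j = i then c (x i) (x (Suc i)) else x (Suc j))"

text \<open>Cochains take sequences of arguments, of which only an initial segment is relevant.\<close>

definition coch :: "'p set \<Rightarrow> nat \<Rightarrow> ((nat \<Rightarrow> 'p \<Rightarrow> 'k::field) \<Rightarrow> 'p \<Rightarrow> 'k) \<Rightarrow> bool" where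
  "coch B n f \<longleftrightarrow> (\<forall>x y. (\<forall>j<n. x j = y j) \<longrightarrow> f x = f y) \<and>
     (\<forall>i<n. \<forall>x. lin B (\<lambda>a. f (x(i := a)))) \<and> (\<forall>x r. r \<notin> B \<longrightarrow> f x r = 0)"

lemma cochI:
  assumes "\<And>x y. (\<And>j. j < n \<Longrightarrow> x j = y j) \<Longrightarrow> f x = f y"
    and "\<And>i x. i < n \<Longrightarrow> lin B (\<lambda>a. f (x(i := a)))"
    and "\<And>x r. r \<notin> B \<Longrightarrow> f x r = 0"
  shows "coch B n f"
  unfolding coch_def using assms by blast

lemma coch_cong: "coch B n f \<Longrightarrow> (\<And>j. j < n \<Longrightarrow> x j = y j) \<Longrightarrow> f x = f y"
  unfolding coch_def by blast

lemma coch_lin: "coch B n f \<Longrightarrow> i < n \<Longrightarrow> lin B (\<lambda>a. f (x(i := a)))"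
  unfolding coch_def by blast

lemma coch_out: "coch B n f \<Longrightarrow> r \<notin> B \<Longrightarrow> f x r = 0"
  unfolding coch_def by blast

lemma coch_slot:
  assumes "coch B n f" "i < n" "lin B u"
  shows "lin B (\<lambda>a. f (x(i := u a)))"
  by (rule lin_comp[OF coch_lin[OF assms(1,2)] assms(3)])

lemma coch_zero_arg:
  assumes "coch B n f" "i < n" "x i = (\<lambda>p. 0)"
  shows "f x r = 0"
  using lin_zero[OF coch_lin[OF assms(1,2), of x], of r] assms(3) by (metis fun_upd_triv)

lemma coch_plus:
  assumes f: "coch B n f" and g: "coch B n g"
  shows "coch B n (\<lambda>x r. f x r + g x r)"
proof (rule cochI)
  fix x y :: "nat \<Rightarrow> 'a \<Rightarrow> 'b" assume "\<And>j. j < n \<Longrightarrow> x j = y j"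
  then have "f x = f y" "g x = g y" using coch_cong[OF f] coch_cong[OF g] by blast+
  then show "(\<lambda>r. f x r + g x r) = (\<lambda>r. f y r + g y r)" by simp
next
  fix i x assume "i < n"
  then show "lin B (\<lambda>a r. f (x(i := a)) r + g (x(i := a)) r)"
    by (intro lin_plus coch_lin[OF f] coch_lin[OF g])
qed (simp add: coch_out[OF f] coch_out[OF g])

lemma coch_scaled:
  assumes f: "coch B n f" shows "coch B n (\<lambda>x r. c * f x r)"
proof (rule cochI)
  fix x y :: "nat \<Rightarrow> 'a \<Rightarrow> 'b" assume "\<And>j. j < n \<Longrightarrow> x j = y j"
  then have "f x = f y" using coch_cong[OF f] by blast
  then show "(\<lambda>r. c * f x r) = (\<lambda>r. c * f y r)" by simp
next
  fix i x assume "i < n"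
  then show "lin B (\<lambda>a r. c * f (x(i := a)) r)" by (intro lin_scaled coch_lin[OF f])
qed (simp add: coch_out[OF f])

lemma coch_sums:
  fixes f :: "'i \<Rightarrow> (nat \<Rightarrow> 'p \<Rightarrow> 'k::field) \<Rightarrow> 'p \<Rightarrow> 'k"
  assumes "\<And>i. i \<in> I \<Longrightarrow> coch B n (f i)" shows "coch B n (\<lambda>x r. \<Sum>i\<in>I. f i x r)"
proof (rule cochI)
  fix x y :: "nat \<Rightarrow> 'p \<Rightarrow> 'k" assume "\<And>j. j < n \<Longrightarrow> x j = y j"
  then have "f i x = f i y" if "i \<in> I" for i using coch_cong[OF assms[OF that]] by blast
  then show "(\<lambda>r. \<Sum>i\<in>I. f i x r) = (\<lambda>r. \<Sum>i\<in>I. f i y r)" by simp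
next
  fix i x assume "i < n"
  then show "lin B (\<lambda>a r. \<Sum>j\<in>I. f j (x(i := a)) r)"
    by (intro lin_sums coch_lin[OF assms])
next
  fix x r assume "r \<notin> B"
  then show "(\<Sum>i\<in>I. f i x r) = 0" by (simp add: coch_out[OF assms])
qed

lemma coch_eqI:
  assumes f: "coch B n f" and g: "coch B n g" and ne: "B \<noteq> {}"
    and eq: "\<And>P r. (\<And>j. P j \<in> B) \<Longrightarrow> r \<in> B \<Longrightarrow> f (\<lambda>j. bas (P j)) r = g (\<lambda>j. bas (P j)) r"
  shows "f x r = g x r"
proof -
  \<comment> \<open>The induction is on the number k of leading arguments that are still arbitrary;
    from position k on they are basis vectors.\<close>
  have main: "(\<And>j. k \<le> j \<Longrightarrow> j < n \<Longrightarrow> \<exists>p\<in>B. x j = bas p) \<Longrightarrow> k \<le> n \<Longrightarrow> f x r = g x r" for k x r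
  proof (induction k arbitrary: x r)
    case 0
    show ?case
    proof (cases "r \<in> B")
      case True
      \<comment> \<open>The sequence P must take values in B at the irrelevant positions from n on
        as well, which is where \<open>ne\<close> enters.\<close>
      have "\<exists>p\<in>B. j < n \<longrightarrow> x j = bas p" for j
        by (cases "j < n") (use 0(1)[of j] ne in auto)
      then obtain P where P: "\<And>j. P j \<in> B" "\<And>j. j < n \<Longrightarrow> x j = bas (P j)" by metis
      have "f x = f (\<lambda>j. bas (P j))" by (rule coch_cong[OF f P(2)])
      moreover have "g x = g (\<lambda>j. bas (P j))" by (rule coch_cong[OF g P(2)])
      ultimately show ?thesis using eq P(1) True by simp
    qed (simp add: coch_out[OF f] coch_out[OF g])
  next
    case (Suc k)
    have "f (x(k := x k)) r = g (x(k := x k)) r"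
    proof (rule lin_eqI[OF coch_lin[OF f] coch_lin[OF g]])
      fix p assume p: "p \<in> B"
      show "f (x(k := bas p)) r = g (x(k := bas p)) r"
      proof (rule Suc.IH)
        fix j assume j: "k \<le> j" "j < n"
        show "\<exists>q\<in>B. (x(k := bas p)) j = bas q"
        proof (cases "j = k")
          case False
          then show ?thesis using Suc.prems(1)[of j] j by simp
        qed (use p in auto)
      qed (use Suc.prems(2) in simp)
    qed (use Suc.prems(2) in simp_all)
    then show ?case by simp
  qed
  show ?thesis by (rule main[of n]) auto
qed

definition mlext :: "'p set \<Rightarrow> nat \<Rightarrow> ((nat \<Rightarrow> 'p) \<Rightarrow> 'p \<Rightarrow> 'k) \<Rightarrow> (nat \<Rightarrow> 'p \<Rightarrow> 'k::field) \<Rightarrow> 'p \<Rightarrow> 'k" where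
  "mlext B n \<kappa> x r = (if r \<in> B then
     (\<Sum>P\<in>PiE {..<n} (\<lambda>_. B). (\<Prod>j<n. x j (P j)) * \<kappa> P r) else 0)"

lemma coch_mlext:
  assumes fin: "finite B"
  shows "coch B n (mlext B n \<kappa>)"
proof (rule cochI)
  fix x y :: "nat \<Rightarrow> 'a \<Rightarrow> 'b" assume "\<And>j. j < n \<Longrightarrow> x j = y j"
  then show "mlext B n \<kappa> x = mlext B n \<kappa> y" by (intro ext) (simp add: mlext_def)
next
  fix i x assume i: "i < n"
  show "lin B (\<lambda>a. mlext B n \<kappa> (x(i := a)))"
  proof (rule linI)
    fix a :: "'a \<Rightarrow> 'b" and r
    define w where "w P = (\<Prod>j\<in>{..<n}-{i}. x j (P j))" for P
    have prod: "(\<Prod>j<n. (x(i := b)) j (P j)) = b (P i) * w P" for b P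
      unfolding w_def using i by (subst prod.remove[of _ i]) (auto intro!: prod.cong)
    show "mlext B n \<kappa> (x(i := a)) r = (\<Sum>p\<in>B. a p * mlext B n \<kappa> (x(i := bas p)) r)"
    proof (cases "r \<in> B")
      case True
      have "(\<Sum>p\<in>B. a p * mlext B n \<kappa> (x(i := bas p)) r)
          = (\<Sum>p\<in>B. \<Sum>P\<in>PiE {..<n} (\<lambda>_. B). a p * (bas p (P i) * w P * \<kappa> P r))"
        using True by (simp add: mlext_def prod sum_distrib_left del: fun_upd_apply)
      also have "\<dots> = (\<Sum>P\<in>PiE {..<n} (\<lambda>_. B). \<Sum>p\<in>B. a p * (bas p (P i) * w P * \<kappa> P r))"
        by (rule sum.swap)
      also have "\<dots> = (\<Sum>P\<in>PiE {..<n} (\<lambda>_. B). a (P i) * w P * \<kappa> P r)"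
      proof (rule sum.cong[OF refl])
        fix P assume "P \<in> PiE {..<n} (\<lambda>_. B)"
        then have "P i \<in> B" using i by (auto simp: PiE_def)
        then have "(\<Sum>p\<in>B. if P i = p then a p * w P * \<kappa> P r else 0) = a (P i) * w P * \<kappa> P r"
          using fin by simp
        moreover have "(\<Sum>p\<in>B. a p * (bas p (P i) * w P * \<kappa> P r))
          = (\<Sum>p\<in>B. if P i = p then a p * w P * \<kappa> P r else 0)"
          by (rule sum.cong) (auto simp: bas_def)
        ultimately show "(\<Sum>p\<in>B. a p * (bas p (P i) * w P * \<kappa> P r)) = a (P i) * w P * \<kappa> P r" by simp
      qed
      also have "\<dots> = mlext B n \<kappa> (x(i := a)) r" using True by (simp add: mlext_def prod del: fun_upd_apply)
      finally show ?thesis by simp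
    qed (simp add: mlext_def)
  qed
qed (simp add: mlext_def)

text \<open>Only one tuple in the sum has a nonzero product of coefficients. That tuple is
  extensional, hence \<open>undefined\<close> from n on, so \<kappa> has to ignore these positions
  before P can take its place.\<close>

lemma mlext_bas:
  fixes \<kappa> :: "(nat \<Rightarrow> 'p) \<Rightarrow> 'p \<Rightarrow> 'k::field"
  assumes fin: "finite B" and P: "\<And>j. P j \<in> B" and r: "r \<in> B"
    and \<kappa>: "\<And>P Q r. (\<And>j. j < n \<Longrightarrow> P j = Q j) \<Longrightarrow> \<kappa> P r = \<kappa> Q r"
  shows "mlext B n \<kappa> (\<lambda>j. bas (P j)) r = \<kappa> P r"
proof -
  define R where "R = restrict P {..<n}"
  have R: "R \<in> PiE {..<n} (\<lambda>_. B)" using P by (simp add: R_def)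
  have *: "(\<Prod>j<n. bas (P j) (Q j) :: 'k) = (if Q = R then 1 else 0)"
    if "Q \<in> PiE {..<n} (\<lambda>_. B)" for Q
  proof (cases "Q = R")
    case False
    have "Q = restrict Q {..<n}" using that by (simp add: PiE_restrict)
    with False obtain j where "j < n" "Q j \<noteq> P j" unfolding R_def
      by (metis lessThan_iff restrict_ext)
    then have "(\<Prod>j<n. bas (P j) (Q j) :: 'k) = 0"
      by (intro prod_zero) (auto simp: bas_def)
    then show ?thesis using False by simp
  qed (simp add: bas_def R_def)
  have "mlext B n \<kappa> (\<lambda>j. bas (P j)) r
      = (\<Sum>Q\<in>PiE {..<n} (\<lambda>_. B). if Q = R then \<kappa> Q r else 0)"
    unfolding mlext_def if_P[OF r] by (rule sum.cong[OF refl]) (simp add: *)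
  also have "\<dots> = \<kappa> R r"
    using R by (simp add: fin finite_PiE sum.delta)
  also have "\<dots> = \<kappa> P r" by (rule \<kappa>) (simp add: R_def)
  finally show ?thesis .
qed

section \<open>The Hochschild complex of a based algebra and its cup product\<close>

locale based_algebra =
  fixes B :: "'p set" and mul :: "('p \<Rightarrow> 'k::field) \<Rightarrow> ('p \<Rightarrow> 'k) \<Rightarrow> 'p \<Rightarrow> 'k"
  assumes mul_left: "lin B (\<lambda>a. mul a y)"
    and mul_right: "lin B (mul x)"
    and mul_out: "r \<notin> B \<Longrightarrow> mul x y r = 0"
    and mul_assoc: "mul (mul x y) z = mul x (mul y z)"
begin

definition dif :: "nat \<Rightarrow> ((nat \<Rightarrow> 'p \<Rightarrow> 'k) \<Rightarrow> 'p \<Rightarrow> 'k) \<Rightarrow> (nat \<Rightarrow> 'p \<Rightarrow> 'k) \<Rightarrow> 'p \<Rightarrow> 'k" where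
  "dif n f x r = mul (x 0) (f (sh 1 x)) r
     + (\<Sum>i<n. (-1) ^ (i + 1) * f (merge_at mul i x) r)
     + (-1) ^ (n + 1) * mul (f x) (x n) r"

definition cup :: "nat \<Rightarrow> ((nat \<Rightarrow> 'p \<Rightarrow> 'k) \<Rightarrow> 'p \<Rightarrow> 'k) \<Rightarrow> ((nat \<Rightarrow> 'p \<Rightarrow> 'k) \<Rightarrow> 'p \<Rightarrow> 'k)
    \<Rightarrow> (nat \<Rightarrow> 'p \<Rightarrow> 'k) \<Rightarrow> 'p \<Rightarrow> 'k" where
  "cup m f g x = mul (f x) (g (sh m x))"

lemma coch_mul_right:
  "coch B n f \<Longrightarrow> i < n \<Longrightarrow> lin B (\<lambda>a. mul y (f (x(i := a))))"
  using lin_comp[OF mul_right coch_lin] by blast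

lemma coch_mul_left:
  "coch B n f \<Longrightarrow> i < n \<Longrightarrow> lin B (\<lambda>a. mul (f (x(i := a))) y)"
  using lin_comp[OF mul_left coch_lin] by blast

lemma coch_dif:
  assumes f: "coch B n f"
  shows "coch B (Suc n) (dif n f)"
proof (rule cochI)
  fix x y :: "nat \<Rightarrow> 'p \<Rightarrow> 'k" assume eq: "\<And>j. j < Suc n \<Longrightarrow> x j = y j"
  have "f x = f y" by (rule coch_cong[OF f]) (simp add: eq)
  moreover have "f (sh 1 x) = f (sh 1 y)" by (rule coch_cong[OF f]) (simp add: sh_def eq)
  moreover have "f (merge_at mul i x) = f (merge_at mul i y)" if "i < n" for i
    using that by (intro coch_cong[OF f]) (simp add: merge_at_def eq)
  moreover have "x 0 = y 0" "x n = y n" by (simp_all add: eq)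
  ultimately show "dif n f x = dif n f y" by (intro ext) (simp add: dif_def)
next
  fix i x assume i: "i < Suc n"
  have 1: "lin B (\<lambda>a. mul ((x(i := a)) 0) (f (sh 1 (x(i := a)))))"
  proof (cases i)
    case 0
    have "sh 1 (x(i := a)) = sh 1 x" for a using 0 by (simp add: sh_def fun_eq_iff)
    then show ?thesis using mul_left 0 by simp
  next
    case (Suc i')
    have "sh 1 (x(i := a)) = (sh 1 x)(i' := a)" for a using Suc by (auto simp: sh_def fun_eq_iff)
    then show ?thesis using coch_mul_right[OF f, of i'] Suc i by simp
  qed
  have 2: "lin B (\<lambda>a. f (merge_at mul j (x(i := a))))" if j: "j < n" for j
  proof -
    consider "i < j" | "i = j" | "i = Suc j" | "i > Suc j" by linarith
    then show ?thesis
    proof cases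
      case 1
      then have "merge_at mul j (x(i := a)) = (merge_at mul j x)(i := a)" for a
        by (auto simp: merge_at_def fun_eq_iff)
      then show ?thesis using coch_lin[OF f, of i] 1 j by simp
    next
      case 2
      then have "merge_at mul j (x(i := a)) = (merge_at mul j x)(j := mul a (x (Suc j)))" for a
        by (auto simp: merge_at_def fun_eq_iff)
      then show ?thesis using coch_slot[OF f j mul_left] by simp
    next
      case 3
      then have "merge_at mul j (x(i := a)) = (merge_at mul j x)(j := mul (x j) a)" for a
        by (auto simp: merge_at_def fun_eq_iff)
      then show ?thesis using coch_slot[OF f j mul_right] by simp
    next
      case 4
      then have "merge_at mul j (x(i := a)) = (merge_at mul j x)(i - 1 := a)" for a
        by (auto simp: merge_at_def fun_eq_iff)
      then show ?thesis using coch_lin[OF f, of "i - 1"] 4 i by simp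
    qed
  qed
  have 3: "lin B (\<lambda>a. mul (f (x(i := a))) ((x(i := a)) n))"
  proof (cases "i = n")
    case True
    have "f (x(i := a)) = f x" for a by (rule coch_cong[OF f]) (simp add: True)
    then show ?thesis using mul_right True by simp
  next
    case False
    then show ?thesis using coch_mul_left[OF f, of i] i by simp
  qed
  show "lin B (\<lambda>a. dif n f (x(i := a)))"
    unfolding dif_def by (intro lin_plus[OF lin_plus[OF 1 lin_sums] lin_scaled[OF 3]] lin_scaled 2) simp
next
  fix x r assume "r \<notin> B"
  then show "dif n f x r = 0" by (simp add: dif_def mul_out coch_out[OF f])
qed

lemma coch_cup:
  assumes f: "coch B m f" and g: "coch B n g"
  shows "coch B (m + n) (cup m f g)"
proof (rule cochI)
  fix x y :: "nat \<Rightarrow> 'p \<Rightarrow> 'k" assume eq: "\<And>j. j < m + n \<Longrightarrow> x j = y j"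
  have "f x = f y" by (rule coch_cong[OF f]) (simp add: eq)
  moreover have "g (sh m x) = g (sh m y)" by (rule coch_cong[OF g]) (simp add: sh_def eq)
  ultimately show "cup m f g x = cup m f g y" by (simp add: cup_def)
next
  fix i x assume i: "i < m + n"
  show "lin B (\<lambda>a. cup m f g (x(i := a)))"
  proof (cases "i < m")
    case True
    then have "sh m (x(i := a)) = sh m x" for a by (simp add: sh_def fun_eq_iff)
    then show ?thesis unfolding cup_def using coch_mul_left[OF f True] by simp
  next
    case False
    then have "sh m (x(i := a)) = (sh m x)(i - m := a)" for a by (auto simp: sh_def fun_eq_iff)
    moreover have "f (x(i := a)) = f x" for a by (rule coch_cong[OF f]) (use False in simp)
    ultimately show ?thesis unfolding cup_def using coch_mul_right[OF g, of "i - m"] False i by simp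
  qed
qed (simp add: cup_def mul_out)

lemma mul_diff_expand:
  "mul (\<lambda>p. a p + (\<Sum>i\<in>I. c i * b i p) + d * e p) y r
     = mul a y r + (\<Sum>i\<in>I. c i * mul (b i) y r) + d * mul e y r"
  by (simp add: lin_add[OF mul_left, where b = "\<lambda>p. d * e p"]
    lin_add[OF mul_left, where b = "\<lambda>p. \<Sum>i\<in>I. c i * b i p"] lin_sum[OF mul_left] lin_scale[OF mul_left])

lemma mul_diff_expand_right:
  "mul y (\<lambda>p. a p + (\<Sum>i\<in>I. c i * b i p) + d * e p) r
     = mul y a r + (\<Sum>i\<in>I. c i * mul y (b i) r) + d * mul y e r"
  by (simp add: lin_add[OF mul_right, where b = "\<lambda>p. d * e p"]
    lin_add[OF mul_right, where b = "\<lambda>p. \<Sum>i\<in>I. c i * b i p"] lin_sum[OF mul_right] lin_scale[OF mul_right])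

text \<open>The Leibniz rule. The product of f, the argument \<open>x m\<close> and g occurs both as
  the last term of \<open>dif m f\<close> and as the first term of \<open>dif n g\<close>; the signs
  (-1)^(m+1) and (-1)^m make it cancel, and associativity identifies the two occurrences.\<close>

lemma dif_cup:
  assumes f: "coch B m f" and g: "coch B n g"
  shows "dif (m + n) (cup m f g) x r
    = cup (Suc m) (dif m f) g x r + (-1) ^ m * cup m f (dif n g) x r"
proof -
  have lo: "cup m f g (merge_at mul i x) = mul (f (merge_at mul i x)) (g (sh (Suc m) x))" if "i < m" for i
  proof -
    have "sh m (merge_at mul i x) = sh (Suc m) x"
      using that by (auto simp: sh_def merge_at_def fun_eq_iff)
    then show ?thesis by (simp add: cup_def)
  qed
  have hi: "cup m f g (merge_at mul (m + i) x) = mul (f x) (g (merge_at mul i (sh m x)))" for i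
  proof -
    have "sh m (merge_at mul (m + i) x) = merge_at mul i (sh m x)"
      by (auto simp: sh_def merge_at_def fun_eq_iff add.commute)
    moreover have "f (merge_at mul (m + i) x) = f x"
      by (rule coch_cong[OF f]) (simp add: merge_at_def)
    ultimately show ?thesis by (simp add: cup_def)
  qed
  have split: "(\<Sum>i<m + n. F i) = (\<Sum>i<m. F i) + (\<Sum>i<n. F (m + i))" for F :: "nat \<Rightarrow> 'k"
    by (induction n) auto
  have ss: "sh m (sh 1 x) = sh (Suc m) x" "sh 1 (sh m x) = sh (Suc m) x" "sh m x 0 = x m" "sh m x n = x (m + n)"
    by (auto simp: sh_def fun_eq_iff add.commute)
  have "dif (m + n) (cup m f g) x r = mul (mul (x 0) (f (sh 1 x))) (g (sh (Suc m) x)) r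
     + ((\<Sum>i<m. (-1) ^ (i + 1) * mul (f (merge_at mul i x)) (g (sh (Suc m) x)) r)
      + (\<Sum>i<n. (-1) ^ (m + i + 1) * mul (f x) (g (merge_at mul i (sh m x))) r))
     + (-1) ^ (m + n + 1) * mul (f x) (mul (g (sh m x)) (x (m + n))) r"
    unfolding dif_def split using lo hi by (simp add: cup_def mul_assoc ss[unfolded One_nat_def] add.assoc)
  moreover have "cup (Suc m) (dif m f) g x r = mul (mul (x 0) (f (sh 1 x))) (g (sh (Suc m) x)) r
      + (\<Sum>i<m. (-1) ^ (i + 1) * mul (f (merge_at mul i x)) (g (sh (Suc m) x)) r)
      + (-1) ^ (m + 1) * mul (f x) (mul (x m) (g (sh (Suc m) x))) r"
    unfolding cup_def dif_def[abs_def] mul_diff_expand by (simp add: mul_assoc)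
  moreover have "cup m f (dif n g) x r = mul (f x) (mul (x m) (g (sh (Suc m) x))) r
      + (\<Sum>i<n. (-1) ^ (i + 1) * mul (f x) (g (merge_at mul i (sh m x))) r)
      + (-1) ^ (n + 1) * mul (f x) (mul (g (sh m x)) (x (m + n))) r"
    unfolding cup_def dif_def[abs_def] mul_diff_expand_right by (simp add: ss[unfolded One_nat_def])
  moreover have "(\<Sum>i<n. (-1) ^ (m + i + 1) * mul (f x) (g (merge_at mul i (sh m x))) r)
      = (-1) ^ m * (\<Sum>i<n. (-1) ^ (i + 1) * mul (f x) (g (merge_at mul i (sh m x))) r)"
    by (simp add: sum_distrib_left power_add mult.assoc)
  ultimately show ?thesis
    by (simp only:) (simp add: algebra_simps power_add)
qed

end

text \<open>X i j stands for an insertion of a cochain of degree n at position i after merging the arguments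
  j and j + 1.  The case n = 0 is the insertion of a trivial path.\<close>

lemma sum_insertion_merge:
  fixes X :: "nat \<Rightarrow> nat \<Rightarrow> 'a::comm_ring_1"
  shows "(\<Sum>i\<le>m. (-1) ^ ((i + 1) * (n + 1)) * (\<Sum>j<m. (-1) ^ (j + 1) *
      (if j + 1 < i then X (i - 1) j else if j + 1 = i then L i else if j = i then R i else X i (j + n - 1))))
    = (\<Sum>i<m. (-1) ^ (i * (n + 1)) * ((\<Sum>j<i. (-1) ^ (j + 1) * X i j)
                                     + (\<Sum>j\<in>{i + n..<m + n - 1}. (-1) ^ (j + 1) * X i j)))
      + (\<Sum>i<m. (-1) ^ (i * (n + 1) + i + 1) * L (Suc i))
      + (\<Sum>i<m. (-1) ^ ((i + 1) * (n + 1) + i + 1) * R i)" (is "?lhs = _")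
proof -
  let ?c = "\<lambda>i. (-1) ^ ((i + 1) * (n + 1)) :: 'a"
  have "?lhs = (\<Sum>i\<le>m. ?c i * (\<Sum>j<m. (if j + 1 < i then (-1) ^ (j + 1) * X (i - 1) j else 0)))
     + (\<Sum>i\<le>m. ?c i * (\<Sum>j<m. (if j + 1 = i then (-1) ^ (j + 1) * L i else 0)))
     + (\<Sum>i\<le>m. ?c i * (\<Sum>j<m. (if j = i then (-1) ^ (j + 1) * R i else 0)))
     + (\<Sum>i\<le>m. ?c i * (\<Sum>j<m. (if i < j then (-1) ^ (j + 1) * X i (j + n - 1) else 0)))"
    unfolding sum.distrib[symmetric] distrib_left[symmetric]
    by (intro sum.cong arg_cong2[where f = "(*)"] refl) auto
  moreover have "(\<Sum>i\<le>m. ?c i * (\<Sum>j<m. (if j + 1 < i then (-1) ^ (j + 1) * X (i - 1) j else 0)))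
     = (\<Sum>i<m. (-1) ^ (i * (n + 1)) * (\<Sum>j<i. (-1) ^ (j + 1) * X i j))"
  proof -
    \<comment> \<open>The summand i = 0 is empty, so i may be shifted by one; the sign exponent then
      exceeds i (n + 1) by the even number 2 (n + 1).\<close>
    have "(\<Sum>i\<le>m. ?c i * (\<Sum>j<m. (if j + 1 < i then (-1) ^ (j + 1) * X (i - 1) j else 0)))
       = (\<Sum>i<m. ?c (Suc i) * (\<Sum>j<m. (if j < i then (-1) ^ (j + 1) * X i j else 0)))"
      by (subst sum.atMost_shift) (simp cong: if_cong)
    also have "\<dots> = (\<Sum>i<m. (-1) ^ (i * (n + 1)) * (\<Sum>j<i. (-1) ^ (j + 1) * X i j))"
    proof (rule sum.cong[OF refl])
      fix i assume "i \<in> {..<m}"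
      then have "(\<Sum>j<m. (if j < i then (-1) ^ (j + 1) * X i j else 0)) = (\<Sum>j<i. (-1) ^ (j + 1) * X i j)"
        by (intro sum.mono_neutral_cong_right) auto
      moreover have "?c (Suc i) = (-1) ^ (i * (n + 1))" by (rule minus_one_power_cong) auto
      ultimately show "?c (Suc i) * (\<Sum>j<m. (if j < i then (-1) ^ (j + 1) * X i j else 0))
        = (-1) ^ (i * (n + 1)) * (\<Sum>j<i. (-1) ^ (j + 1) * X i j)" by (simp only:)
    qed
    finally show ?thesis .
  qed
  moreover have "(\<Sum>i\<le>m. ?c i * (\<Sum>j<m. (if j + 1 = i then (-1) ^ (j + 1) * L i else 0)))
     = (\<Sum>i<m. (-1) ^ (i * (n + 1) + i + 1) * L (Suc i))"
  proof -
    have "(\<Sum>i\<le>m. ?c i * (\<Sum>j<m. (if j + 1 = i then (-1) ^ (j + 1) * L i else 0)))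
       = (\<Sum>i<m. ?c (Suc i) * (\<Sum>j<m. (if j = i then (-1) ^ (j + 1) * L (Suc i) else 0)))"
      by (subst sum.atMost_shift) simp
    also have "\<dots> = (\<Sum>i<m. (-1) ^ (i * (n + 1) + i + 1) * L (Suc i))"
    proof (rule sum.cong[OF refl])
      fix i assume "i \<in> {..<m}"
      then have "(\<Sum>j<m. (if j = i then (-1) ^ (j + 1) * L (Suc i) else 0)) = (-1) ^ (i + 1) * L (Suc i)"
        by simp
      moreover have "?c (Suc i) * (-1) ^ (i + 1) = (-1) ^ (i * (n + 1) + i + 1)"
        unfolding power_add[symmetric] by (rule minus_one_power_cong) auto
      ultimately show "?c (Suc i) * (\<Sum>j<m. (if j = i then (-1) ^ (j + 1) * L (Suc i) else 0))
        = (-1) ^ (i * (n + 1) + i + 1) * L (Suc i)" by (simp only: mult.assoc[symmetric])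
    qed
    finally show ?thesis .
  qed
  moreover have "(\<Sum>i\<le>m. ?c i * (\<Sum>j<m. (if j = i then (-1) ^ (j + 1) * R i else 0)))
     = (\<Sum>i<m. (-1) ^ ((i + 1) * (n + 1) + i + 1) * R i)"
  proof -
    have "(\<Sum>i\<le>m. ?c i * (\<Sum>j<m. (if j = i then (-1) ^ (j + 1) * R i else 0)))
      = (\<Sum>i<m. ?c i * (\<Sum>j<m. (if j = i then (-1) ^ (j + 1) * R i else 0)))"
      unfolding lessThan_Suc_atMost[symmetric] by simp
    also have "\<dots> = (\<Sum>i<m. (-1) ^ ((i + 1) * (n + 1) + i + 1) * R i)"
      by (rule sum.cong[OF refl]) (simp add: power_add mult.assoc)
    finally show ?thesis .
  qed
  moreover have "(\<Sum>i\<le>m. ?c i * (\<Sum>j<m. (if i < j then (-1) ^ (j + 1) * X i (j + n - 1) else 0)))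
     = (\<Sum>i<m. (-1) ^ (i * (n + 1)) * (\<Sum>j\<in>{i + n..<m + n - 1}. (-1) ^ (j + 1) * X i j))"
  proof -
    have "(\<Sum>i\<le>m. ?c i * (\<Sum>j<m. (if i < j then (-1) ^ (j + 1) * X i (j + n - 1) else 0)))
      = (\<Sum>i<m. ?c i * (\<Sum>j<m. (if i < j then (-1) ^ (j + 1) * X i (j + n - 1) else 0)))"
      unfolding lessThan_Suc_atMost[symmetric] by simp
    also have "\<dots> = (\<Sum>i<m. (-1) ^ (i * (n + 1)) * (\<Sum>j\<in>{i + n..<m + n - 1}. (-1) ^ (j + 1) * X i j))"
    proof (rule sum.cong[OF refl])
      fix i assume i: "i \<in> {..<m}"
      have "?c i * (\<Sum>j<m. (if i < j then (-1) ^ (j + 1) * X i (j + n - 1) else 0))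
        = ?c i * (\<Sum>j\<in>{i<..<m}. (-1) ^ (j + 1) * X i (j + n - 1))"
        by (intro arg_cong2[where f = "(*)"] refl sum.mono_neutral_cong_right) auto
      \<comment> \<open>Here i < j gives j >= 1, so \<open>j + n - 1\<close> is not truncated even
        for n = 0, and the two sign exponents differ by 2.\<close>
      also have "\<dots> = (\<Sum>j\<in>{i<..<m}. (-1) ^ (i * (n + 1)) * ((-1) ^ (j + n - 1 + 1) * X i (j + n - 1)))"
        unfolding sum_distrib_left mult.assoc[symmetric] power_add[symmetric]
        by (intro sum.cong arg_cong2[where f = "(*)"] refl minus_one_power_cong) auto
      also have "\<dots> = (\<Sum>j\<in>{i + n..<m + n - 1}. (-1) ^ (i * (n + 1)) * ((-1) ^ (j + 1) * X i j))"
        by (rule sum.reindex_bij_witness[where i = "\<lambda>j. j + 1 - n" and j = "\<lambda>j. j + n - 1"]) auto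
      finally show "?c i * (\<Sum>j<m. (if i < j then (-1) ^ (j + 1) * X i (j + n - 1) else 0))
        = (-1) ^ (i * (n + 1)) * (\<Sum>j\<in>{i + n..<m + n - 1}. (-1) ^ (j + 1) * X i j)"
        by (simp add: sum_distrib_left)
    qed
    finally show ?thesis .
  qed
  ultimately show ?thesis by (simp add: distrib_left sum.distrib)
qed

section \<open>Gerstenhaber's circle product and graded commutativity\<close>

context based_algebra
begin

definition ins :: "((nat \<Rightarrow> 'p \<Rightarrow> 'k) \<Rightarrow> 'p \<Rightarrow> 'k) \<Rightarrow> nat \<Rightarrow> nat \<Rightarrow> (nat \<Rightarrow> 'p \<Rightarrow> 'k) \<Rightarrow> nat \<Rightarrow> 'p \<Rightarrow> 'k" where
  "ins g n i x = (\<lambda>j. if j < i then x j else if j = i then g (sh i x) else x (j + n - 1))"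

text \<open>The circle product of f and g, a cochain of degree m + n - 1. Its usual sign exponent i
  (n - 1) is replaced by i (n + 1), which has the same parity and avoids truncated
  subtraction.\<close>

definition brace :: "((nat \<Rightarrow> 'p \<Rightarrow> 'k) \<Rightarrow> 'p \<Rightarrow> 'k) \<Rightarrow> nat \<Rightarrow> ((nat \<Rightarrow> 'p \<Rightarrow> 'k) \<Rightarrow> 'p \<Rightarrow> 'k) \<Rightarrow> nat
    \<Rightarrow> (nat \<Rightarrow> 'p \<Rightarrow> 'k) \<Rightarrow> 'p \<Rightarrow> 'k" where
  "brace f m g n x r = (\<Sum>i<m. (-1) ^ (i * (n + 1)) * f (ins g n i x) r)"

lemma coch_brace:
  assumes f: "coch B m f" and g: "coch B n g" and n: "n \<ge> 1"
  shows "coch B (m + n - 1) (brace f m g n)"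
proof -
  have "coch B (m + n - 1) (\<lambda>x. f (ins g n i x))" if i: "i < m" for i
  proof (rule cochI)
    fix x y :: "nat \<Rightarrow> 'p \<Rightarrow> 'k" assume eq: "\<And>j. j < m + n - 1 \<Longrightarrow> x j = y j"
    have "g (sh i x) = g (sh i y)"
      by (rule coch_cong[OF g]) (use i in \<open>simp add: sh_def eq\<close>)
    then show "f (ins g n i x) = f (ins g n i y)"
      by (intro coch_cong[OF f]) (use i n in \<open>simp add: ins_def eq\<close>)
  next
    fix l x assume l: "l < m + n - 1"
    consider "l < i" | "i \<le> l" "l < i + n" | "i + n \<le> l" by linarith
    then show "lin B (\<lambda>a. f (ins g n i (x(l := a))))"
    proof cases
      case 1
      then have e: "sh i (x(l := a)) = sh i x" for a by (auto simp: sh_def fun_eq_iff)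
      have "ins g n i (x(l := a)) = (ins g n i x)(l := a)" for a
        unfolding ins_def e using 1 n by (intro ext) auto
      then show ?thesis using coch_lin[OF f, of l] 1 i by simp
    next
      case 2
      then have e: "sh i (x(l := a)) = (sh i x)(l - i := a)" for a by (auto simp: sh_def fun_eq_iff)
      have "ins g n i (x(l := a)) = (ins g n i x)(i := g ((sh i x)(l - i := a)))" for a
        unfolding ins_def e using 2 n by (intro ext) auto
      then show ?thesis using coch_slot[OF f i coch_lin[OF g, of "l - i"]] 2 by simp
    next
      case 3
      have e: "g (sh i (x(l := a))) = g (sh i x)" for a
        by (rule coch_cong[OF g]) (use 3 in \<open>auto simp: sh_def\<close>)
      have "ins g n i (x(l := a)) = (ins g n i x)(l + 1 - n := a)" for a
        unfolding ins_def e using 3 n by (intro ext) auto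
      then show ?thesis using coch_lin[OF f, of "l + 1 - n"] 3 l by simp
    qed
  qed (simp add: coch_out[OF f])
  then show ?thesis unfolding brace_def[abs_def]
    by (intro coch_sums coch_scaled) simp
qed

text \<open>Add up, with signs, the differential of f evaluated at the tuples with g inserted at each
  position.  The terms multiplying g by a neighbouring argument cancel against the differential
  of g inserted into f, except at the two ends, where they are the two cup products.\<close>

lemma dif_brace:
  assumes f: "coch B m f" and g: "coch B n g" and n: "n \<ge> 1" and m: "m \<ge> 1"
    and df: "\<And>x r. dif m f x r = 0" and dg: "\<And>x r. dif n g x r = 0"
  shows "dif (m + n - 1) (brace f m g n) x r
    = (-1) ^ n * (cup n g f x r - (-1) ^ (m * n) * cup m f g x r)"
proof -
  define c where "c i = ((-1) ^ ((i + 1) * (n + 1)) :: 'k)" for i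
  define d where "d i = ((-1) ^ (i * (n + 1)) :: 'k)" for i
  have cd: "c (Suc i) = d i" for i unfolding c_def d_def by (rule minus_one_power_cong) auto
  define X where "X i j = f (ins g n i (merge_at mul j x)) r" for i j
  define slot where "slot i y = (\<lambda>j. if j < i then x j else if j = i then y else x (j + n))" for i y
  define L where "L i = f (slot (i - 1) (mul (x (i - 1)) (g (sh i x)))) r" for i
  define R where "R i = f (slot i (mul (g (sh i x)) (x (i + n)))) r" for i
  have mid: "f (merge_at mul j (ins g n i x)) r =
      (if j + 1 < i then X (i - 1) j else if j + 1 = i then L i else if j = i then R i else X i (j + n - 1))"
    if ij: "i \<le> m" "j < m" for i j
  proof -
    consider "j + 1 < i" | "j + 1 = i" | "j = i" | "i < j" by linarith
    then show ?thesis
    proof cases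
      case 1
      then have e: "sh (i - 1) (merge_at mul j x) = sh i x" by (auto simp: sh_def merge_at_def fun_eq_iff)
      have "merge_at mul j (ins g n i x) = ins g n (i - 1) (merge_at mul j x)"
        unfolding ins_def e using 1 n by (intro ext) (auto simp: merge_at_def)
      then show ?thesis using 1 by (simp add: X_def)
    next
      case 2
      then have "merge_at mul j (ins g n i x) = slot (i - 1) (mul (x (i - 1)) (g (sh i x)))"
        unfolding ins_def slot_def using n by (intro ext) (auto simp: merge_at_def)
      then show ?thesis using 2 by (simp add: L_def)
    next
      case 3
      then have "merge_at mul j (ins g n i x) = slot i (mul (g (sh i x)) (x (i + n)))"
        unfolding ins_def slot_def using n by (intro ext) (auto simp: merge_at_def)
      then show ?thesis using 3 by (simp add: R_def)
    next
      case 4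
      have e: "g (sh i (merge_at mul (j + n - 1) x)) = g (sh i x)"
        by (rule coch_cong[OF g]) (use 4 in \<open>auto simp: sh_def merge_at_def\<close>)
      have "merge_at mul j (ins g n i x) = ins g n i (merge_at mul (j + n - 1) x)"
        unfolding ins_def e using 4 n by (intro ext) (auto simp: merge_at_def)
      then show ?thesis using 4 by (simp add: X_def)
    qed
  qed
  have inner: "L (Suc i) + (\<Sum>l<n. (-1) ^ (l + 1) * X i (i + l)) + (-1) ^ (n + 1) * R i = 0"
    if i: "i < m" for i
  proof -
    \<comment> \<open>Displays \<open>slot i y\<close> as an update of a fixed sequence at position
      i, the form in which linearity of f is available; the \<open>undefined\<close> entry is always
      overwritten.\<close>
    have fs: "f (slot i y) = f ((slot i undefined)(i := y))" for y
      by (rule arg_cong[where f = f]) (auto simp: slot_def fun_eq_iff)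
    note lf = coch_lin[OF f i, of "slot i undefined"]
    have "f (slot i (\<lambda>p. mul (sh i x 0) (g (sh 1 (sh i x))) p
        + (\<Sum>l<n. (-1) ^ (l + 1) * g (merge_at mul l (sh i x)) p)
        + (-1) ^ (n + 1) * mul (g (sh i x)) (sh i x n) p)) r
      = f (slot i (mul (sh i x 0) (g (sh 1 (sh i x))))) r
        + (\<Sum>l<n. (-1) ^ (l + 1) * f (slot i (g (merge_at mul l (sh i x)))) r)
        + (-1) ^ (n + 1) * f (slot i (mul (g (sh i x)) (sh i x n))) r"
      unfolding fs lin_add[OF lf, where b = "\<lambda>p. (-1) ^ (n + 1) * mul (g (sh i x)) (sh i x n) p"]
        lin_add[OF lf, where b = "\<lambda>p. \<Sum>l<n. (-1) ^ (l + 1) * g (merge_at mul l (sh i x)) p"]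
        lin_sum[OF lf] lin_scale[OF lf] ..
    moreover have "f (slot i (\<lambda>p. mul (sh i x 0) (g (sh 1 (sh i x))) p
        + (\<Sum>l<n. (-1) ^ (l + 1) * g (merge_at mul l (sh i x)) p)
        + (-1) ^ (n + 1) * mul (g (sh i x)) (sh i x n) p)) r = 0"
      unfolding dg[unfolded dif_def] fs by (rule lin_zero[OF lf])
    moreover have "slot i (g (merge_at mul l (sh i x))) = ins g n i (merge_at mul (i + l) x)" if "l < n" for l
    proof -
      have e: "sh i (merge_at mul (i + l) x) = merge_at mul l (sh i x)"
        by (auto simp: sh_def merge_at_def fun_eq_iff add.commute)
      show ?thesis unfolding ins_def e slot_def
        using that n by (intro ext) (auto simp: merge_at_def)
    qed
    moreover have "sh i x 0 = x i" "sh i x n = x (i + n)" "sh 1 (sh i x) = sh (Suc i) x"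
      by (auto simp: sh_def add.commute)
    ultimately show ?thesis by (simp add: L_def R_def X_def del: One_nat_def)
  qed
  \<comment> \<open>There are m + 1 positions since \<open>dif m f\<close> takes m + 1 arguments.
    The extreme ones produce the cup products: i = 0 through the first term of the differential, i =
    m through the last.\<close>
  have "0 = (\<Sum>i\<le>m. c i * dif m f (ins g n i x) r)" by (simp add: df)
  also have "\<dots> = (\<Sum>i\<le>m. c i * mul (ins g n i x 0) (f (sh 1 (ins g n i x))) r)
    + (\<Sum>i\<le>m. c i * (\<Sum>j<m. (-1) ^ (j + 1) *
      (if j + 1 < i then X (i - 1) j else if j + 1 = i then L i else if j = i then R i else X i (j + n - 1))))
    + (\<Sum>i\<le>m. c i * ((-1) ^ (m + 1) * mul (f (ins g n i x)) (ins g n i x m) r))"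
    unfolding sum.distrib[symmetric] distrib_left[symmetric] dif_def
    by (intro sum.cong arg_cong2[where f = "(*)"] arg_cong2[where f = "(+)"] refl) (use mid in auto)
  also have "(\<Sum>i\<le>m. c i * mul (ins g n i x 0) (f (sh 1 (ins g n i x))) r)
    = c 0 * cup n g f x r + mul (x 0) (brace f m g n (sh 1 x)) r"
  proof -
    have "ins g n (Suc i) x 0 = x 0" for i by (simp add: ins_def)
    moreover have "sh 1 (ins g n (Suc i) x) = ins g n i (sh 1 x)" for i
    proof -
      have e: "sh i (sh 1 x) = sh (Suc i) x" by (auto simp: sh_def fun_eq_iff)
      show ?thesis unfolding ins_def e using n by (intro ext) (auto simp: sh_def)
    qed
    moreover have "ins g n 0 x 0 = g x" "sh 1 (ins g n 0 x) = sh n x"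
      using n by (auto simp: ins_def sh_def fun_eq_iff add.commute)
    ultimately have "(\<Sum>i\<le>m. c i * mul (ins g n i x 0) (f (sh 1 (ins g n i x))) r)
      = c 0 * cup n g f x r + (\<Sum>i<m. d i * mul (x 0) (f (ins g n i (sh 1 x))) r)"
      by (subst sum.atMost_shift) (simp add: cup_def cd del: One_nat_def)
    then show ?thesis by (simp add: brace_def[abs_def] lin_sum[OF mul_right] d_def)
  qed
  also have "(\<Sum>i\<le>m. c i * ((-1) ^ (m + 1) * mul (f (ins g n i x)) (ins g n i x m) r))
    = (-1) ^ (m + n) * mul (brace f m g n x) (x (m + n - 1)) r + c m * (-1) ^ (m + 1) * cup m f g x r"
  proof -
    have "f (ins g n m x) = f x" by (rule coch_cong[OF f]) (simp add: ins_def)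
    moreover have "ins g n m x m = g (sh m x)" by (simp add: ins_def)
    moreover have "ins g n i x m = x (m + n - 1)" if "i < m" for i using that by (simp add: ins_def)
    ultimately have "(\<Sum>i\<le>m. c i * ((-1) ^ (m + 1) * mul (f (ins g n i x)) (ins g n i x m) r))
      = (\<Sum>i<m. c i * ((-1) ^ (m + 1) * mul (f (ins g n i x)) (x (m + n - 1)) r))
        + c m * (-1) ^ (m + 1) * cup m f g x r"
      unfolding lessThan_Suc_atMost[symmetric] by (simp add: cup_def)
    also have "(\<Sum>i<m. c i * ((-1) ^ (m + 1) * mul (f (ins g n i x)) (x (m + n - 1)) r))
      = (\<Sum>i<m. (-1) ^ (m + n) * (d i * mul (f (ins g n i x)) (x (m + n - 1)) r))"
      unfolding c_def d_def mult.assoc[symmetric] power_add[symmetric]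
      by (intro sum.cong arg_cong2[where f = "(*)"] minus_one_power_cong refl) auto
    finally show ?thesis
      by (simp add: brace_def[abs_def] lin_sum[OF mul_left] d_def sum_distrib_left)
  qed
  also have "(\<Sum>i\<le>m. c i * (\<Sum>j<m. (-1) ^ (j + 1) *
      (if j + 1 < i then X (i - 1) j else if j + 1 = i then L i else if j = i then R i else X i (j + n - 1))))
    = (\<Sum>j<m + n - 1. (-1) ^ (j + 1) * brace f m g n (merge_at mul j x) r)"
  proof -
    have "(\<Sum>j<m + n - 1. (-1) ^ (j + 1) * brace f m g n (merge_at mul j x) r)
      = (\<Sum>i<m. d i * (\<Sum>j<m + n - 1. (-1) ^ (j + 1) * X i j))"
      unfolding brace_def sum_distrib_left d_def X_def
      by (subst sum.swap) (simp add: mult.left_commute)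
    also have "\<dots> = (\<Sum>i<m. d i * ((\<Sum>j<i. (-1) ^ (j + 1) * X i j)
          + (\<Sum>j\<in>{i + n..<m + n - 1}. (-1) ^ (j + 1) * X i j))
        + (-1) ^ (i * (n + 1) + i + 1) * L (Suc i) + (-1) ^ ((i + 1) * (n + 1) + i + 1) * R i)"
    proof (rule sum.cong[OF refl])
      fix i assume "i \<in> {..<m}" then have i: "i < m" by simp
      \<comment> \<open>Merges at j from i to i + n - 1 involve only arguments of the inserted g;
        \<open>inner\<close> converts this middle block into the neighbouring products L and
        R.\<close>
      have "(\<Sum>j<m + n - 1. (-1) ^ (j + 1) * X i j) = (\<Sum>j<i. (-1) ^ (j + 1) * X i j)
         + (\<Sum>j\<in>{i..<i + n}. (-1) ^ (j + 1) * X i j) + (\<Sum>j\<in>{i + n..<m + n - 1}. (-1) ^ (j + 1) * X i j)"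
        using i n sum.atLeastLessThan_concat[of 0 i "i + n" "\<lambda>j. (-1) ^ (j + 1) * X i j"]
          sum.atLeastLessThan_concat[of 0 "i + n" "m + n - 1" "\<lambda>j. (-1) ^ (j + 1) * X i j"]
        by (simp only: lessThan_atLeast0)
      moreover have "(\<Sum>j\<in>{i..<i + n}. (-1) ^ (j + 1) * X i j)
         = (-1) ^ i * (\<Sum>l<n. (-1) ^ (l + 1) * X i (i + l))"
        unfolding sum_distrib_left mult.assoc[symmetric] power_add[symmetric]
        by (rule sum.reindex_bij_witness[where i = "\<lambda>l. i + l" and j = "\<lambda>j. j - i"]) auto
      moreover have "(\<Sum>l<n. (-1) ^ (l + 1) * X i (i + l)) = - L (Suc i) - (-1) ^ (n + 1) * R i"
        using inner[OF i] by (simp add: algebra_simps eq_neg_iff_add_eq_0)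
      moreover have "d i * (-1) ^ i * (- L (Suc i) - (-1) ^ (n + 1) * R i)
         = (-1) ^ (i * (n + 1) + i + 1) * L (Suc i) + (-1) ^ ((i + 1) * (n + 1) + i + 1) * R i"
      proof -
        have "(-1) ^ ((i + 1) * (n + 1) + i + 1) = ((-1) ^ (i * (n + 1) + i + 1 + (n + 1)) :: 'k)"
          by (rule minus_one_power_cong) auto
        then show ?thesis by (simp add: d_def power_add algebra_simps)
      qed
      ultimately show "d i * (\<Sum>j<m + n - 1. (-1) ^ (j + 1) * X i j)
        = d i * ((\<Sum>j<i. (-1) ^ (j + 1) * X i j) + (\<Sum>j\<in>{i + n..<m + n - 1}. (-1) ^ (j + 1) * X i j))
        + (-1) ^ (i * (n + 1) + i + 1) * L (Suc i) + (-1) ^ ((i + 1) * (n + 1) + i + 1) * R i"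
        by (simp only: distrib_left mult.assoc add.assoc add.commute add.left_commute)
    qed
    finally show ?thesis unfolding c_def d_def sum_insertion_merge sum.distrib by simp
  qed
  finally have "c 0 * cup n g f x r + c m * (-1) ^ (m + 1) * cup m f g x r
      + dif (m + n - 1) (brace f m g n) x r = 0"
    using n by (simp add: dif_def algebra_simps)
  moreover have "c 0 = - ((-1) ^ n)" by (simp add: c_def)
  moreover have "c m * (-1) ^ (m + 1) = (-1) ^ n * (-1) ^ (m * n)"
    unfolding c_def power_add[symmetric] by (rule minus_one_power_cong) auto
  ultimately have "- ((-1) ^ n) * cup n g f x r + (-1) ^ n * (-1) ^ (m * n) * cup m f g x r
      + dif (m + n - 1) (brace f m g n) x r = 0" by (simp only:)
  then show ?thesis by (simp add: algebra_simps eq_diff_eq add_eq_0_iff)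
qed

end

section \<open>Coboundaries and the reduction to sums of cocycles\<close>

context based_algebra
begin

definition cocycle :: "nat \<Rightarrow> ((nat \<Rightarrow> 'p \<Rightarrow> 'k) \<Rightarrow> 'p \<Rightarrow> 'k) \<Rightarrow> bool" where
  "cocycle n f \<longleftrightarrow> coch B n f \<and> (\<forall>x r. dif n f x r = 0)"

text \<open>The index n is the degree of the bounding cochain, so f has degree n + 1.\<close>

definition exact :: "nat \<Rightarrow> ((nat \<Rightarrow> 'p \<Rightarrow> 'k) \<Rightarrow> 'p \<Rightarrow> 'k) \<Rightarrow> bool" where
  "exact n f \<longleftrightarrow> (\<exists>h. coch B n h \<and> (\<forall>x r. dif n h x r = f x r))"

lemma exactI: "coch B n h \<Longrightarrow> (\<And>x r. dif n h x r = f x r) \<Longrightarrow> exact n f"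
  unfolding exact_def by blast

lemma dif_sums:
  "dif n (\<lambda>x r. \<Sum>i\<in>I. c i * f i x r) x r = (\<Sum>i\<in>I. c i * dif n (f i) x r)"
proof -
  have "(\<Sum>i<n. (-1) ^ (i + 1) * (\<Sum>j\<in>I. c j * f j (merge_at mul i x) r))
     = (\<Sum>j\<in>I. c j * (\<Sum>i<n. (-1) ^ (i + 1) * f j (merge_at mul i x) r))"
    unfolding sum_distrib_left by (subst sum.swap) (simp add: mult.left_commute)
  then show ?thesis
    unfolding dif_def lin_sum[OF mul_left] lin_sum[OF mul_right]
    by (simp add: sum.distrib sum_subtractf distrib_left right_diff_distrib sum_distrib_left mult.left_commute sum_negf)
qed

lemma exact_sums:
  assumes "\<And>i. i \<in> I \<Longrightarrow> exact n (f i)"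
  shows "exact n (\<lambda>x r. \<Sum>i\<in>I. c i * f i x r)"
proof -
  obtain h where h: "\<And>i. i \<in> I \<Longrightarrow> coch B n (h i)" "\<And>i x r. i \<in> I \<Longrightarrow> dif n (h i) x r = f i x r"
    using assms unfolding exact_def by metis
  show ?thesis
    by (rule exactI[of n "\<lambda>x r. \<Sum>i\<in>I. c i * h i x r"])
      (auto simp: dif_sums h intro!: coch_sums coch_scaled sum.cong)
qed

lemma exact_plus: "exact n f \<Longrightarrow> exact n g \<Longrightarrow> exact n (\<lambda>x r. f x r + g x r)"
  using exact_sums[of "UNIV :: bool set" n "\<lambda>b. if b then f else g" "\<lambda>_. 1"] by (simp add: UNIV_bool add.commute)

lemma exact_scaled: "exact n f \<Longrightarrow> exact n (\<lambda>x r. c * f x r)"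
  using exact_sums[of "{()}" n "\<lambda>_. f" "\<lambda>_. c"] by simp

text \<open>If g \<smile> f vanishes identically, \<open>dif_brace\<close> leaves only f \<smile> g
  on its right-hand side, up to a sign, which is its own inverse.\<close>

lemma exact_cup_of_zero:
  assumes f: "cocycle m f" and g: "cocycle n g" and "m \<ge> 1" "n \<ge> 1"
    and z: "(\<forall>x r. cup m f g x r = 0) \<or> (\<forall>x r. cup n g f x r = 0)"
  shows "exact (m + n - 1) (cup m f g)"
proof -
  have *: "dif (m + n - 1) (brace f m g n) x r
      = (-1) ^ n * (cup n g f x r - (-1) ^ (m * n) * cup m f g x r)" for x r
    using assms unfolding cocycle_def by (intro dif_brace) auto
  have **: "coch B (m + n - 1) (brace f m g n)"
    using assms unfolding cocycle_def by (intro coch_brace) auto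
  from z show ?thesis
  proof
    assume "\<forall>x r. cup m f g x r = 0"
    then show ?thesis using exact_sums[of "{}" "m + n - 1" "\<lambda>_. f"] by (simp add: exact_def)
  next
    assume z: "\<forall>x r. cup n g f x r = 0"
    have "exact (m + n - 1) (dif (m + n - 1) (brace f m g n))" using ** exactI by blast
    then have "exact (m + n - 1) (\<lambda>x r. - ((-1) ^ n * (-1) ^ (m * n)) * dif (m + n - 1) (brace f m g n) x r)"
      by (rule exact_scaled)
    moreover have "- ((-1) ^ n * (-1) ^ (m * n)) * dif (m + n - 1) (brace f m g n) x r = cup m f g x r" for x r
      unfolding * using z by (simp add: minus_one_power_iff)
    ultimately show ?thesis by simp
  qed
qed

lemma exact_cup_dif_left:
  assumes h: "coch B m h" and g: "cocycle n g"
  shows "exact (m + n) (cup (Suc m) (dif m h) g)"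
proof (rule exactI[OF coch_cup[OF h]])
  show "coch B n g" using g by (simp add: cocycle_def)
  then have "dif (m + n) (cup m h g) x r = cup (Suc m) (dif m h) g x r + (-1) ^ m * cup m h (dif n g) x r" for x r
    by (rule dif_cup[OF h])
  moreover have "dif n g x = (\<lambda>r. 0)" for x using g by (auto simp: cocycle_def)
  ultimately show "dif (m + n) (cup m h g) x r = cup (Suc m) (dif m h) g x r" for x r
    by (simp add: cup_def lin_zero[OF mul_right])
qed

lemma exact_cup_dif_right:
  assumes h: "coch B n h" and f: "cocycle m f"
  shows "exact (m + n) (cup m f (dif n h))"
proof -
  have "coch B m f" using f by (simp add: cocycle_def)
  note * = coch_cup[OF this h] dif_cup[OF this h]
  moreover have "dif m f x = (\<lambda>r. 0)" for x using f by (auto simp: cocycle_def)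
  ultimately have "dif (m + n) (cup m f h) x r = (-1) ^ m * cup m f (dif n h) x r" for x r
    by (simp add: cup_def[of "Suc m"] lin_zero[OF mul_left])
  then have "exact (m + n) (\<lambda>x r. (-1) ^ m * cup m f (dif n h) x r)" by (intro exactI[OF *(1)])
  then have "exact (m + n) (\<lambda>x r. (-1) ^ m * ((-1) ^ m * cup m f (dif n h) x r))" by (rule exact_scaled)
  moreover have "(-1) ^ m * ((-1) ^ m * y) = (y :: 'k)" for y by (simp add: minus_one_power_iff)
  ultimately show ?thesis by simp
qed

text \<open>The factors are replaced one after the other, because a coboundary times a cocycle is
  known to be exact: f is decomposed against the cocycle g, and then g against each cocycle
  \<open>F a\<close>.\<close>

lemma exact_cup_of_decompositions:
  assumes f: "cocycle m f" and g: "cocycle n g" and m: "m \<ge> 1" and n: "n \<ge> 1"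
    and hf: "coch B (m - 1) hf" and F: "\<And>a. a \<in> I \<Longrightarrow> cocycle m (F a)"
    and fe: "\<And>x r. f x r = dif (m - 1) hf x r + (\<Sum>a\<in>I. F a x r)"
    and hg: "coch B (n - 1) hg" and G: "\<And>a. a \<in> I \<Longrightarrow> cocycle n (G a)"
    and ge: "\<And>x r. g x r = dif (n - 1) hg x r + (\<Sum>a\<in>I. G a x r)"
    and z: "\<And>a b. a \<in> I \<Longrightarrow> b \<in> I \<Longrightarrow>
      (\<forall>x r. cup m (F a) (G b) x r = 0) \<or> (\<forall>x r. cup n (G b) (F a) x r = 0)"
  shows "exact (m + n - 1) (cup m f g)"
proof -
  have right: "exact (m + n - 1) (cup m (F a) g)" if a: "a \<in> I" for a
  proof -
    have "g y = (\<lambda>r. dif (n - 1) hg y r + (\<Sum>b\<in>I. 1 * G b y r))" for y using ge by auto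
    then have "cup m (F a) g x r = cup m (F a) (dif (n - 1) hg) x r + (\<Sum>b\<in>I. 1 * cup m (F a) (G b) x r)" for x r
      unfolding cup_def by (simp only:)
        (subst lin_add[OF mul_right], simp only: lin_sum[OF mul_right])
    moreover have "exact (m + n - 1) (cup m (F a) (dif (n - 1) hg))"
      using exact_cup_dif_right[OF hg F[OF a]] n by simp
    moreover have "exact (m + n - 1) (\<lambda>x r. \<Sum>b\<in>I. 1 * cup m (F a) (G b) x r)"
      by (rule exact_sums) (rule exact_cup_of_zero[OF F[OF a] G m n z[OF a]])
    ultimately show ?thesis using exact_plus by presburger
  qed
  have "f y = (\<lambda>r. dif (m - 1) hf y r + (\<Sum>b\<in>I. 1 * F b y r))" for y using fe by auto
  then have "cup m f g x r = cup m (dif (m - 1) hf) g x r + (\<Sum>b\<in>I. 1 * cup m (F b) g x r)" for x r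
    unfolding cup_def by (simp only:)
      (subst lin_add[OF mul_left], simp only: lin_sum[OF mul_left])
  moreover have "exact (m + n - 1) (cup m (dif (m - 1) hf) g)"
    using exact_cup_dif_left[OF hf g] m by simp
  moreover have "exact (m + n - 1) (\<lambda>x r. \<Sum>b\<in>I. 1 * cup m (F b) g x r)"
    by (rule exact_sums) (rule right)
  ultimately show ?thesis using exact_plus by presburger
qed

end

section \<open>Triangular monomial algebras\<close>

text \<open>Total on purpose; composability is always carried as the separate condition
  \<open>pend p = fst q\<close>.\<close>

definition cmp :: "('v,'e) qpath \<Rightarrow> ('v,'e) qpath \<Rightarrow> ('v,'e) qpath" where
  "cmp p q = (fst p, snd p @ snd q)"

lemma fst_cmp [simp]: "fst (cmp p q) = fst p" and snd_cmp [simp]: "snd (cmp p q) = snd p @ snd q"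
  by (simp_all add: cmp_def)

lemma path_end_Nil [simp]: "path_end t (v, []) = v"
  and path_end_Cons [simp]: "path_end t (v, a # xs) = path_end t (t a, xs)"
  by (auto simp: path_end_def)

lemma path_end_append: "path_end t (v, xs @ ys) = path_end t (path_end t (v, xs), ys)"
  by (induction xs arbitrary: v) auto

lemma path_end_cmp: "path_end t p = fst q \<Longrightarrow> path_end t (cmp p q) = path_end t q"
  by (cases p; cases q) (simp add: cmp_def path_end_append)

locale triangular_monomial =
  fixes V :: "'v set" and E :: "'e set" and s t :: "'e \<Rightarrow> 'v" and R :: "('v,'e) qpath set"
  assumes quiver: "is_quiver V E s t" and triangular: "triangular V E s t"
    and relations: "monomial_relations V E s t R" and finite_B: "finite (nz_paths V E s t R)"
begin

abbreviation "path \<equiv> is_path V E s t"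
abbreviation "pend \<equiv> path_end t"
abbreviation "B \<equiv> nz_paths V E s t R"

lemma path_Nil [simp]: "path (v, []) \<longleftrightarrow> v \<in> V"
  by (simp add: is_path_def)

lemma path_Cons [simp]: "path (v, a # xs) \<longleftrightarrow> a \<in> E \<and> v = s a \<and> path (t a, xs)"
proof -
  have "a \<in> E \<Longrightarrow> s a \<in> V \<and> t a \<in> V" using quiver by (auto simp: is_quiver_def)
  moreover have "(\<forall>i. Suc i < length (a # xs) \<longrightarrow> t ((a # xs) ! i) = s ((a # xs) ! Suc i)) \<longleftrightarrow>
      (xs \<noteq> [] \<longrightarrow> s (hd xs) = t a) \<and> (\<forall>i. Suc i < length xs \<longrightarrow> t (xs ! i) = s (xs ! Suc i))"
    by (auto simp: nth_Cons hd_conv_nth split: nat.splits)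
  ultimately show ?thesis unfolding is_path_def by auto
qed

lemma path_append: "path (v, xs @ ys) \<longleftrightarrow> path (v, xs) \<and> path (pend (v, xs), ys)"
proof (induction xs arbitrary: v)
  case Nil
  show ?case by (auto simp: is_path_def)
qed auto

lemma pend_in: "path p \<Longrightarrow> pend p \<in> V"
proof -
  have "path (v, xs) \<Longrightarrow> pend (v, xs) \<in> V" for v xs by (induction xs arbitrary: v) auto
  then show "path p \<Longrightarrow> pend p \<in> V" by (cases p) auto
qed

lemma path_cmp: "pend p = fst q \<Longrightarrow> path (cmp p q) \<longleftrightarrow> path p \<and> path q"
  by (cases p; cases q) (simp add: cmp_def path_append)

lemma B_path: "p \<in> B \<Longrightarrow> path p"
  by (simp add: nz_paths_def)

lemma B_pend: "p \<in> B \<Longrightarrow> pend p \<in> V" and B_fst: "p \<in> B \<Longrightarrow> fst p \<in> V"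
  using B_path pend_in by (auto simp: is_path_def)

text \<open>A relation occurring inside a factor occurs inside the whole path.\<close>

lemma B_cmpD:
  assumes "pend p = fst q" "cmp p q \<in> B" shows "p \<in> B" "q \<in> B"
proof -
  have "path p" "path q" using path_cmp[OF assms(1)] B_path[OF assms(2)] by auto
  moreover have "snd (cmp p q) \<noteq> xs @ snd r @ ys" if "r \<in> R" for r xs ys
    using assms(2) that by (auto simp: nz_paths_def)
  then have "snd p \<noteq> xs @ snd r @ ys" "snd q \<noteq> xs @ snd r @ ys" if "r \<in> R" for r xs ys
    using that by (metis snd_cmp append.assoc)+
  ultimately show "p \<in> B" "q \<in> B" by (auto simp: nz_paths_def)
qed

lemma trivial_in_B: "v \<in> V \<Longrightarrow> (v, []) \<in> B"
  using relations by (force simp: nz_paths_def monomial_relations_def)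

lemma cycle_trivial: "path (v, xs) \<Longrightarrow> pend (v, xs) = v \<Longrightarrow> xs = []"
  using triangular by (auto simp: triangular_def)

definition before :: "'e \<Rightarrow> 'e \<Rightarrow> bool" where
  "before a b \<longleftrightarrow> (\<exists>v us vs ws. path (v, us @ a # vs @ b # ws))"

text \<open>Joining a segment from a to b with a segment from b to a yields an oriented cycle at
  \<open>s a\<close>.\<close>

lemma before_asym: "before a b \<Longrightarrow> \<not> before b a"
proof
  assume "before a b" "before b a"
  then obtain vs vs' where "a \<in> E" "path (t a, vs)" "pend (t a, vs) = s b"
    "b \<in> E" "path (t b, vs')" "pend (t b, vs') = s a"
    unfolding before_def by (auto simp: path_append)
  then have "path (s a, a # vs @ b # vs')" "pend (s a, a # vs @ b # vs') = s a"
    by (auto simp: path_append path_end_append)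
  from cycle_trivial[OF this] show False by simp
qed

lemma path_split_unique: "path (v, us @ a # vs) \<Longrightarrow> a \<notin> set us \<and> a \<notin> set vs"
proof -
  assume p: "path (v, us @ a # vs)"
  have "\<not> before a a" using before_asym by blast
  then show ?thesis using p by (force simp: before_def dest!: split_list)
qed

abbreviation "mul \<equiv> alg_mult t B"

lemma mul_eq: "(mul x y r :: 'k::field) = (if r \<in> B then
    (\<Sum>p\<in>B. \<Sum>q\<in>B. if pend p = fst q \<and> cmp p q = r then x p * y q else 0) else 0)"
proof (cases "r \<in> B")
  case True
  have "mul x y r = (\<Sum>pq\<in>{pq \<in> B \<times> B. pend (fst pq) = fst (snd pq) \<and> cmp (fst pq) (snd pq) = r}.
      x (fst pq) * y (snd pq))"
    using True by (simp add: alg_mult_def cmp_def)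
  also have "\<dots> = (\<Sum>pq\<in>B \<times> B. if pend (fst pq) = fst (snd pq) \<and> cmp (fst pq) (snd pq) = r
      then x (fst pq) * y (snd pq) else 0)"
    by (rule sum.inter_filter) (simp add: finite_B)
  finally show ?thesis using True by (simp add: sum.cartesian_product case_prod_beta)
qed (simp add: alg_mult_def)

lemma sum_bas: "finite A \<Longrightarrow> p \<in> A \<Longrightarrow> (\<Sum>q\<in>A. bas p q * h q) = (h p :: 'k::field)"
  using sum.delta[of A p h] by (simp add: bas_def if_distrib[of "\<lambda>z. z * _"] cong: if_cong)

lemma mul_bas_left: 
  assumes "p \<in> B"
  shows "(mul (bas p) y r :: 'k::field) =
    (if r \<in> B then \<Sum>q\<in>B. if pend p = fst q \<and> cmp p q = r then y q else 0 else 0)"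
proof (cases "r \<in> B")
  case True
  have "mul (bas p) y r = (\<Sum>p'\<in>B. bas p p' * (\<Sum>q\<in>B. if pend p' = fst q \<and> cmp p' q = r then y q else 0))"
    unfolding mul_eq if_P[OF True] sum_distrib_left
    by (intro sum.cong refl) simp
  then show ?thesis using True sum_bas[OF finite_B assms] by simp
qed (simp add: mul_eq)

lemma mul_bas_right: 
  assumes "q \<in> B"
  shows "(mul x (bas q) r :: 'k::field) =
    (if r \<in> B then \<Sum>p\<in>B. if pend p = fst q \<and> cmp p q = r then x p else 0 else 0)"
proof (cases "r \<in> B")
  case True
  have "mul x (bas q) r = (\<Sum>p\<in>B. \<Sum>q'\<in>B. bas q q' * (if pend p = fst q' \<and> cmp p q' = r then x p else 0))"
    unfolding mul_eq if_P[OF True] by (intro sum.cong refl) simp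
  then show ?thesis using True by (simp add: sum_bas[OF finite_B assms])
qed (simp add: mul_eq)

lemma lin_mul_left: "lin B (\<lambda>a. mul a y :: _ \<Rightarrow> 'k::field)"
proof (rule linI)
  fix a r show "mul a y r = (\<Sum>p\<in>B. a p * mul (bas p) y r)"
    by (cases "r \<in> B") (auto simp: mul_bas_left mul_eq[of a] sum_distrib_left intro!: sum.cong)
qed

lemma lin_mul_right: "lin B (mul x :: _ \<Rightarrow> _ \<Rightarrow> 'k::field)"
proof (rule linI)
  fix a r show "mul x a r = (\<Sum>q\<in>B. a q * mul x (bas q) r)"
  proof (cases "r \<in> B")
    case True
    then show ?thesis
      by (subst mul_eq, subst sum.swap) (auto simp: mul_bas_right sum_distrib_left intro!: sum.cong)
  qed (simp add: mul_eq)
qed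

lemma cmp_left_cancel: "pend p = fst q \<Longrightarrow> pend p = fst q' \<Longrightarrow> cmp p q = cmp p q' \<longleftrightarrow> q = q'"
  by (cases q; cases q') (auto simp: cmp_def)

lemma cmp_right_cancel: "cmp p q = cmp p' q \<longleftrightarrow> p = p'"
  by (cases p; cases p') (auto simp: cmp_def)

text \<open>A composite and one of its factors determine the other factor, so a single term of the
  defining sum survives.\<close>

lemma mul_bas_cmp:
  assumes "cmp p q \<in> B" "pend p = fst q"
  shows "mul (bas p) y (cmp p q) = (y q :: 'k::field)" "mul x (bas q) (cmp p q) = (x p :: 'k)"
proof -
  note pq = B_cmpD[OF assms(2,1)]
  have "pend p = fst q' \<and> cmp p q' = cmp p q \<longleftrightarrow> q' = q" for q'
    using cmp_left_cancel[OF _ assms(2)] assms(2) by metis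
  then show "mul (bas p) y (cmp p q) = y q" using assms(1) pq finite_B by (simp add: mul_bas_left)
  have "pend p' = fst q \<and> cmp p' q = cmp p q \<longleftrightarrow> p' = p" for p'
    using cmp_right_cancel assms(2) by metis
  then show "mul x (bas q) (cmp p q) = x p" using assms(1) pq finite_B by (simp add: mul_bas_right)
qed

lemma mul_bas_left_0:
  assumes "p \<in> B" "\<And>q. q \<in> B \<Longrightarrow> pend p = fst q \<Longrightarrow> cmp p q \<noteq> r"
  shows "mul (bas p) y r = (0 :: 'k::field)"
proof -
  have "(if pend p = fst q \<and> cmp p q = r then y q else 0) = 0" if "q \<in> B" for q
    using assms(2)[OF that] by auto
  then show ?thesis by (simp add: mul_bas_left assms(1))
qed

lemma mul_bas_right_0:
  assumes "q \<in> B" "\<And>p. p \<in> B \<Longrightarrow> pend p = fst q \<Longrightarrow> cmp p q \<noteq> r"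
  shows "mul x (bas q) r = (0 :: 'k::field)"
proof -
  have "(if pend p = fst q \<and> cmp p q = r then x p else 0) = 0" if "p \<in> B" for p
    using assms(2)[OF that] by auto
  then show ?thesis by (simp add: mul_bas_right assms(1))
qed

lemma mul_bas_bas:
  assumes "p \<in> B" "q \<in> B"
  shows "mul (bas p) (bas q) = (if pend p = fst q \<and> cmp p q \<in> B then bas (cmp p q) else (\<lambda>_. 0 :: 'k::field))"
proof
  fix r
  show "mul (bas p) (bas q) r = (if pend p = fst q \<and> cmp p q \<in> B then bas (cmp p q) else (\<lambda>_. 0 :: 'k)) r"
  proof (cases "\<exists>q'\<in>B. pend p = fst q' \<and> cmp p q' = r \<and> r \<in> B")
    case True
    then obtain q' where q': "pend p = fst q'" "r = cmp p q'" "cmp p q' \<in> B" by blast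
    then have "mul (bas p) (bas q) r = (bas q q' :: 'k)" by (simp add: mul_bas_cmp)
    also have "\<dots> = (if pend p = fst q \<and> cmp p q \<in> B then bas (cmp p q) else (\<lambda>_. 0)) r"
      unfolding bas_def q'(2) using q'(1,3) cmp_left_cancel[OF q'(1), of q] by auto
    finally show ?thesis .
  next
    case False
    have "mul (bas p) (bas q) r = (0 :: 'k)"
    proof (cases "r \<in> B")
      case True
      then show ?thesis using False by (intro mul_bas_left_0[OF assms(1)]) blast
    qed (simp add: mul_eq)
    moreover have "pend p = fst q \<Longrightarrow> cmp p q \<in> B \<Longrightarrow> r \<noteq> cmp p q" using False assms(2) by blast
    ultimately show ?thesis by (simp add: bas_def)
  qed
qed

lemma cmp_assoc: "cmp (cmp p q) u = cmp p (cmp q u)"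
  by (simp add: cmp_def)

text \<open>The point to check is an intermediate product that lies in I: then so does the full
  composite, and both bracketings are 0.\<close>

lemma mul_assoc_bas:
  assumes "p \<in> B" "q \<in> B" "u \<in> B"
  shows "mul (mul (bas p) (bas q)) (bas u) = (mul (bas p) (mul (bas q) (bas u)) :: _ \<Rightarrow> 'k::field)"
proof -
  have z: "mul (\<lambda>_. 0) y = (\<lambda>_. 0 :: 'k)" "mul y (\<lambda>_. 0) = (\<lambda>_. 0 :: 'k)" for y
    by (simp_all add: mul_eq fun_eq_iff cong: if_cong)
  consider "pend p \<noteq> fst q" | "pend q \<noteq> fst u" | "pend p = fst q" "pend q = fst u" by blast
  then show ?thesis
  proof cases
    case 1
    then show ?thesis using assms by (simp add: mul_bas_bas z)
  next
    case 2
    then show ?thesis using assms by (simp add: mul_bas_bas z path_end_cmp)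
  next
    case 3
    then have "cmp (cmp p q) u \<in> B \<Longrightarrow> cmp p q \<in> B" "cmp p (cmp q u) \<in> B \<Longrightarrow> cmp q u \<in> B"
      using B_cmpD(1)[of "cmp p q" u] B_cmpD(2)[of p "cmp q u"] by (simp_all add: path_end_cmp)
    then show ?thesis using assms 3 by (auto simp: mul_bas_bas z path_end_cmp cmp_assoc)
  qed
qed

lemma mul_assoc: "mul (mul x y) z = (mul x (mul y z) :: _ \<Rightarrow> 'k::field)"
proof
  fix r
  have 1: "mul (mul (bas p) (bas q)) z r = (mul (bas p) (mul (bas q) z) r :: 'k)" if "p \<in> B" "q \<in> B" for p q
    by (rule lin_eqI[OF lin_mul_right lin_comp[OF lin_mul_right lin_mul_right]])
      (simp add: mul_assoc_bas that)
  have 2: "mul (mul (bas p) y) z r = (mul (bas p) (mul y z) r :: 'k)" if "p \<in> B" for p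
    by (rule lin_eqI[OF lin_comp[OF lin_mul_left lin_mul_right] lin_comp[OF lin_mul_right lin_mul_left]])
      (simp add: 1 that)
  show "mul (mul x y) z r = mul x (mul y z) r"
    by (rule lin_eqI[OF lin_comp[OF lin_mul_left lin_mul_left] lin_mul_left]) (simp add: 2)
qed

sublocale based_algebra B "mul :: _ \<Rightarrow> _ \<Rightarrow> _ \<Rightarrow> 'k::field"
  by unfold_locales (auto simp: lin_mul_left lin_mul_right mul_assoc mul_eq)

end

section \<open>Cochains on tuples of paths, and restrictions that commute with the
  differential\<close>

context triangular_monomial
begin

abbreviation bs :: "(nat \<Rightarrow> ('v,'e) qpath) \<Rightarrow> nat \<Rightarrow> ('v,'e) qpath \<Rightarrow> 'k::field" where
  "bs P \<equiv> \<lambda>j. bas (P j)"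

lemma sh_bas: "sh k (bs P) = bs (sh k P)"
  by (simp add: sh_def)

text \<open>The product of two basis paths is again a basis path or 0, and multilinearity makes f
  vanish in the second case.\<close>

lemma coch_merge_bas:
  assumes f: "coch B n f" and i: "i < n" and P: "\<And>j. P j \<in> B"
  shows "f (merge_at mul i (bs P)) r = (if pend (P i) = fst (P (Suc i)) \<and> cmp (P i) (P (Suc i)) \<in> B
    then f (bs (merge_at cmp i P)) r else 0)"
proof (cases "pend (P i) = fst (P (Suc i)) \<and> cmp (P i) (P (Suc i)) \<in> B")
  case True
  then have "merge_at mul i (bs P) = (bs (merge_at cmp i P) :: nat \<Rightarrow> _ \<Rightarrow> 'a)"
    by (intro ext) (simp add: merge_at_def mul_bas_bas P)
  then show ?thesis using True by simp
next
  case False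
  then have "merge_at mul i (bs P) i = (\<lambda>_. 0 :: 'a)"
    by (auto simp: merge_at_def mul_bas_bas P)
  then show ?thesis unfolding if_not_P[OF False] by (rule coch_zero_arg[OF f i])
qed

lemma merge_in_B:
  "(\<And>j. P j \<in> B) \<Longrightarrow> cmp (P i) (P (Suc i)) \<in> B \<Longrightarrow> merge_at cmp i P j \<in> B"
  by (simp add: merge_at_def)

lemma mul_trivial_left: "r \<in> B \<Longrightarrow> v \<in> V \<Longrightarrow> mul (bas (v, [])) y r = (if fst r = v then y r else (0 :: 'k::field))"
proof -
  assume r: "r \<in> B" "v \<in> V"
  show ?thesis
  proof (cases "fst r = v")
    case True
    then have "cmp (v, []) r = r" by (cases r) (simp add: cmp_def)
    then show ?thesis using mul_bas_cmp(1)[of "(v, [])" r y] r True by simp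
  next
    case False
    then show ?thesis using r by (auto intro!: mul_bas_left_0 trivial_in_B)
  qed
qed

lemma mul_trivial_right: "r \<in> B \<Longrightarrow> mul y (bas (pend r, [])) r = (y r :: 'k::field)"
proof -
  assume r: "r \<in> B"
  have "cmp r (pend r, []) = r" by (cases r) (simp add: cmp_def)
  then show ?thesis using mul_bas_cmp(2)[of r "(pend r, [])" y] r by simp
qed

lemma coch_eq_on_bas:
  assumes "coch B n f" "coch B n g"
    and "\<And>P r. (\<And>j. P j \<in> B) \<Longrightarrow> r \<in> B \<Longrightarrow> f (bs P) r = g (bs P) r"
  shows "f x r = (g x r :: 'k::field)"
proof (cases "B = {}")
  case True
  then show ?thesis using coch_out[OF assms(1)] coch_out[OF assms(2)] by simp
qed (rule coch_eqI[OF assms(1,2) _ assms(3)])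

definition chain :: "nat \<Rightarrow> (nat \<Rightarrow> ('v,'e) qpath) \<Rightarrow> bool" where
  "chain n P \<longleftrightarrow> (\<forall>j. Suc j < n \<longrightarrow> pend (P j) = fst (P (Suc j)))"

definition word :: "nat \<Rightarrow> (nat \<Rightarrow> ('v,'e) qpath) \<Rightarrow> 'e list" where
  "word n P = concat (map (\<lambda>j. snd (P j)) [0..<n])"

definition parallel :: "nat \<Rightarrow> (nat \<Rightarrow> ('v,'e) qpath) \<Rightarrow> ('v,'e) qpath \<Rightarrow> bool" where
  "parallel n P r \<longleftrightarrow> chain n P \<and> fst r = fst (P 0) \<and> pend r = pend (P (n - 1))"

lemma word_0 [simp]: "word 0 P = []" and word_Suc: "word (Suc n) P = word n P @ snd (P n)"
  by (simp_all add: word_def)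

lemma word_shift: "word (Suc n) P = snd (P 0) @ word n (sh 1 P)"
  unfolding word_def by (simp only: upt_conv_Cons[OF zero_less_Suc] map_Suc_upt[symmetric])
    (simp add: sh_def o_def)

lemma word_cong: "(\<And>j. j < n \<Longrightarrow> P j = Q j) \<Longrightarrow> word n P = word n Q"
  unfolding word_def by (intro arg_cong[where f = concat] map_cong) auto

lemma word_merge: "i < n \<Longrightarrow> word n (merge_at cmp i P) = word (Suc n) P"
proof (induction n)
  case (Suc n)
  show ?case
  proof (cases "i = n")
    case True
    have "word n (merge_at cmp i P) = word n P" by (rule word_cong) (simp add: merge_at_def True)
    then show ?thesis by (simp add: word_Suc merge_at_def True)
  next
    case False
    then have "i < n" using Suc.prems by simp
    with Suc.IH show ?thesis by (simp add: word_Suc merge_at_def)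
  qed
qed simp

lemma chain_cong: "(\<And>j. j < n \<Longrightarrow> P j = Q j) \<Longrightarrow> chain n P = chain n Q"
  by (auto simp: chain_def)

lemma chain_Suc: "n \<ge> 1 \<Longrightarrow> chain (Suc n) P \<longleftrightarrow> chain n P \<and> pend (P (n - 1)) = fst (P n)"
  unfolding chain_def by (auto simp: less_Suc_eq)

lemma chain_shift: "n \<ge> 1 \<Longrightarrow> chain (Suc n) P \<longleftrightarrow> chain n (sh 1 P) \<and> pend (P 0) = fst (P 1)"
  unfolding chain_def sh_def
  apply auto
  subgoal for j by (cases j) auto
  done

text \<open>The lower bound l serves both users: l = 0 gives \<open>chain\<close>, and l = i gives
  the condition in \<open>tail_chain i\<close>.\<close>

lemma links_merge:
  assumes "pend (P i) = fst (P (Suc i))" "i < n" "l \<le> i"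
  shows "(\<forall>j. l \<le> j \<and> Suc j < n \<longrightarrow> pend (merge_at cmp i P j) = fst (merge_at cmp i P (Suc j)))
    \<longleftrightarrow> (\<forall>j. l \<le> j \<and> Suc j < Suc n \<longrightarrow> pend (P j) = fst (P (Suc j)))" (is "?L \<longleftrightarrow> ?R")
proof
  assume L: ?L
  show ?R
  proof (intro allI impI)
    fix j assume j: "l \<le> j \<and> Suc j < Suc n"
    consider "Suc j = i" | "Suc j < i" | "j = i" | "j = Suc i" | "j > Suc i" by linarith
    then show "pend (P j) = fst (P (Suc j))"
    proof cases
      case 1 then show ?thesis using L[rule_format, of j] assms j by (simp add: merge_at_def)
    next
      case 2 then show ?thesis using L[rule_format, of j] assms j by (simp add: merge_at_def)
    next
      case 3 then show ?thesis using assms by simp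
    next
      case 4 then show ?thesis using L[rule_format, of i] assms j by (simp add: merge_at_def path_end_cmp)
    next
      case 5
      then obtain j' where "j = Suc j'" by (cases j) auto
      then show ?thesis using L[rule_format, of j'] assms j 5 by (simp add: merge_at_def)
    qed
  qed
next
  assume R: ?R
  then show ?L using assms by (auto simp: merge_at_def path_end_cmp)
qed

lemma chain_merge:
  assumes "pend (P i) = fst (P (Suc i))" "i < n"
  shows "chain n (merge_at cmp i P) \<longleftrightarrow> chain (Suc n) P"
  using links_merge[OF assms, of 0] by (simp add: chain_def)

lemma pend_word: "chain n P \<Longrightarrow> n \<ge> 1 \<Longrightarrow> pend (fst (P 0), word n P) = pend (P (n - 1))"
proof (induction n)
  case (Suc n)
  show ?case
  proof (cases "n = 0")
    case False
    then show ?thesis using Suc chain_Suc[of n P]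
      by (simp add: word_Suc path_end_append Suc_le_eq)
  qed (simp add: word_Suc)
qed simp

lemma path_word: "chain n P \<Longrightarrow> n \<ge> 1 \<Longrightarrow> (\<And>j. P j \<in> B) \<Longrightarrow> path (fst (P 0), word n P)"
proof (induction n)
  case (Suc n)
  have b: "path (fst (P n), snd (P n))" using B_path Suc.prems(3) by simp
  show ?case
  proof (cases "n = 0")
    case False
    then show ?thesis using Suc chain_Suc[of n P] pend_word[of n P] b
      by (simp add: word_Suc path_append Suc_le_eq)
  qed (use b in \<open>simp add: word_Suc\<close>)
qed simp

text \<open>The first three clauses match the three kinds of terms in \<open>dif\<close>: X has the
  same truth value on a tuple with its value and on each face that can contribute there. Hence
  restricting a cochain to X commutes with the differential. The last clause lets X be used in a
  multilinear extension.\<close>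

definition compat :: "(nat \<Rightarrow> (nat \<Rightarrow> ('v,'e) qpath) \<Rightarrow> ('v,'e) qpath \<Rightarrow> bool) \<Rightarrow> bool" where
  "compat X \<longleftrightarrow> (\<forall>n P. n \<ge> 1 \<and> (\<forall>j. P j \<in> B) \<longrightarrow>
      (\<forall>r. pend (P 0) = fst r \<and> cmp (P 0) r \<in> B \<longrightarrow> X (Suc n) P (cmp (P 0) r) = X n (sh 1 P) r) \<and>
      (\<forall>i<n. \<forall>r\<in>B. pend (P i) = fst (P (Suc i)) \<longrightarrow> X (Suc n) P r = X n (merge_at cmp i P) r) \<and>
      (\<forall>r. pend r = fst (P n) \<and> cmp r (P n) \<in> B \<longrightarrow> X (Suc n) P (cmp r (P n)) = X n P r)) \<and>
    (\<forall>n P Q r. n \<ge> 1 \<and> (\<forall>j<n. P j = Q j) \<longrightarrow> X n P r = X n Q r)"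

definition restr :: "nat \<Rightarrow> (nat \<Rightarrow> (nat \<Rightarrow> ('v,'e) qpath) \<Rightarrow> ('v,'e) qpath \<Rightarrow> bool) \<Rightarrow>
    ((nat \<Rightarrow> ('v,'e) qpath \<Rightarrow> 'k) \<Rightarrow> ('v,'e) qpath \<Rightarrow> 'k::field) \<Rightarrow>
    (nat \<Rightarrow> ('v,'e) qpath \<Rightarrow> 'k) \<Rightarrow> ('v,'e) qpath \<Rightarrow> 'k" where
  "restr n X f = mlext B n (\<lambda>P r. if X n P r then f (bs P) r else 0)"

lemma coch_restr: "coch B n (restr n X f)"
  unfolding restr_def by (rule coch_mlext[OF finite_B])

lemma restr_bas:
  assumes "compat X" "coch B n f" "n \<ge> 1" "\<And>j. P j \<in> B"
  shows "restr n X f (bs P) r = (if X n P r then f (bs P) r else 0)"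
proof (cases "r \<in> B")
  case True
  show ?thesis unfolding restr_def
  proof (rule mlext_bas[OF finite_B assms(4) True])
    fix P Q :: "nat \<Rightarrow> ('v,'e) qpath" and r
    assume eq: "\<And>j. j < n \<Longrightarrow> P j = Q j"
    have "\<forall>n P Q r. n \<ge> 1 \<and> (\<forall>j<n. P j = Q j) \<longrightarrow> X n P r = X n Q r"
      using assms(1) unfolding compat_def by (rule conjunct2)
    from this[rule_format, of n P Q r] have "X n P r = X n Q r" using assms(3) eq by simp
    moreover have "f (bs P) = f (bs Q)" by (rule coch_cong[OF assms(2)]) (simp add: eq)
    ultimately show "(if X n P r then f (bs P) r else 0) = (if X n Q r then f (bs Q) r else 0)" by simp
  qed
qed (simp add: restr_def mlext_def coch_out[OF assms(2)])

text \<open>At r the product reads off its second factor at the only possible cofactor of p in r.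
  The scalar c allows one lemma to give both agreement (c = 1) and vanishing (c = 0).\<close>

lemma mul_bas_left_cong:
  assumes "p \<in> B" "\<And>q. pend p = fst q \<Longrightarrow> cmp p q = r \<Longrightarrow> r \<in> B \<Longrightarrow> y q = c * z q"
  shows "mul (bas p) y r = (c * mul (bas p) z r :: 'k::field)"
proof (cases "\<exists>q. pend p = fst q \<and> cmp p q = r \<and> r \<in> B")
  case True
  then obtain q where q: "pend p = fst q" "cmp p q = r" "r \<in> B" by blast
  have "mul (bas p) w r = (w q :: 'k)" for w
    using mul_bas_cmp(1)[of p q w] q by simp
  then show ?thesis using assms(2)[OF q] by simp
next
  case False
  have "mul (bas p) w r = (0 :: 'k)" for w
  proof (cases "r \<in> B")
    case True
    with False show ?thesis by (intro mul_bas_left_0[OF assms(1)]) blast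
  qed (simp add: mul_eq)
  then show ?thesis by simp
qed

lemma mul_bas_right_cong:
  assumes "q \<in> B" "\<And>p. pend p = fst q \<Longrightarrow> cmp p q = r \<Longrightarrow> r \<in> B \<Longrightarrow> y p = c * z p"
  shows "mul y (bas q) r = (c * mul z (bas q) r :: 'k::field)"
proof (cases "\<exists>p. pend p = fst q \<and> cmp p q = r \<and> r \<in> B")
  case True
  then obtain p where p: "pend p = fst q" "cmp p q = r" "r \<in> B" by blast
  have "mul w (bas q) r = (w p :: 'k)" for w
    using mul_bas_cmp(2)[of p q w] p by simp
  then show ?thesis using assms(2)[OF p] by simp
next
  case False
  have "mul w (bas q) r = (0 :: 'k)" for w
  proof (cases "r \<in> B")
    case True
    with False show ?thesis by (intro mul_bas_right_0[OF assms(1)]) blast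
  qed (simp add: mul_eq)
  then show ?thesis by simp
qed

lemma dif_restr:
  assumes X: "compat X" and f: "coch B n f" and n: "n \<ge> 1" and P: "\<And>j. P j \<in> B" and r: "r \<in> B"
  shows "dif n (restr n X f) (bs P) r = (if X (Suc n) P r then dif n f (bs P) r else 0)"
proof -
  \<comment> \<open>The truth value of X as a scalar, so that it can be factored out of all terms of
    the differential at once.\<close>
  define c where "c = (if X (Suc n) P r then 1 else 0 :: 'a)"
  note g = coch_restr[of n X f]
  note gb = restr_bas[OF X f n]
  have 1: "mul (bas (P 0)) (restr n X f (sh 1 (bs P))) r = c * mul (bas (P 0)) (f (sh 1 (bs P))) r"
  proof (rule mul_bas_left_cong[OF P])
    fix q assume "pend (P 0) = fst q" "cmp (P 0) q = r" "r \<in> B"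
    then have "X (Suc n) P r = X n (sh 1 P) q" using X n P unfolding compat_def by blast
    moreover have "sh 1 P j \<in> B" for j using P by (simp add: sh_def)
    ultimately show "restr n X f (sh 1 (bs P)) q = c * f (sh 1 (bs P)) q"
      unfolding sh_bas by (simp add: gb c_def)
  qed
  have 2: "restr n X f (merge_at mul i (bs P)) r = c * f (merge_at mul i (bs P)) r" if i: "i < n" for i
  proof (cases "pend (P i) = fst (P (Suc i)) \<and> cmp (P i) (P (Suc i)) \<in> B")
    case True
    then have "X (Suc n) P r = X n (merge_at cmp i P) r" using X n P i r unfolding compat_def by blast
    then show ?thesis unfolding coch_merge_bas[OF g i P] coch_merge_bas[OF f i P]
      using True gb[OF merge_in_B[of P, OF P]] by (simp add: c_def)
  next
    case False
    show ?thesis unfolding coch_merge_bas[OF g i P] coch_merge_bas[OF f i P] if_not_P[OF False] by simp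
  qed
  have 3: "mul (restr n X f (bs P)) (bas (P n)) r = c * mul (f (bs P)) (bas (P n)) r"
  proof (rule mul_bas_right_cong[OF P])
    fix q assume "pend q = fst (P n)" "cmp q (P n) = r" "r \<in> B"
    then have "X (Suc n) P r = X n P q" using X n P unfolding compat_def by blast
    then show "restr n X f (bs P) q = c * f (bs P) q" by (simp add: gb P c_def)
  qed
  have "dif n (restr n X f) (bs P) r = c * dif n f (bs P) r"
    unfolding dif_def 1 3 by (simp add: 2 sum_distrib_left algebra_simps)
  then show ?thesis by (simp add: c_def)
qed

lemma cocycle_restr:
  assumes "compat X" "cocycle n f" "n \<ge> 1"
  shows "cocycle n (restr n X f)"
proof -
  have f: "coch B n f" and df: "dif n f x r = 0" for x r
    using assms(2) unfolding cocycle_def by blast+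
  have z: "coch B (Suc n) (\<lambda>x r. 0 :: 'a)" using coch_scaled[OF coch_dif[OF f], of 0] by simp
  have "dif n (restr n X f) x r = 0" for x r
    by (rule coch_eq_on_bas[OF coch_dif[OF coch_restr] z]) (simp add: dif_restr[OF assms(1) f assms(3)] df)
  then show ?thesis by (simp add: cocycle_def coch_restr)
qed

text \<open>The recorded arrow comes from the first list, which will be the word of the arguments.
  The result \<open>None\<close> means that one list is a prefix of the other.\<close>

fun first_diff :: "'e list \<Rightarrow> 'e list \<Rightarrow> 'e option" where
  "first_diff (a # xs) (b # ys) = (if a = b then first_diff xs ys else Some a)"
| "first_diff _ _ = None"

lemma first_diff_same [simp]: "first_diff xs xs = None"
  by (induction xs) auto

lemma first_diff_append_left [simp]: "first_diff (xs @ ys) (xs @ zs) = first_diff ys zs"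
  by (induction xs) auto

lemma first_diff_SomeD: "first_diff xs ys = Some a \<Longrightarrow> a \<in> set xs"
  by (induction xs ys rule: first_diff.induct) (auto split: if_splits)

lemma first_diff_append_Some: "first_diff xs ys = Some a \<Longrightarrow> first_diff (xs @ us) (ys @ vs) = Some a"
  by (induction xs ys rule: first_diff.induct) (auto split: if_splits)

text \<open>One path is a prefix of the other and they end at the same vertex, so the remaining
  arrows form a closed path, which is trivial by triangularity.\<close>

lemma first_diff_None:
  "first_diff xs ys = None \<Longrightarrow> path (v, xs) \<Longrightarrow> path (v, ys) \<Longrightarrow> pend (v, xs) = pend (v, ys) \<Longrightarrow> xs = ys"
proof (induction xs ys arbitrary: v rule: first_diff.induct)
  case (1 a xs b ys)
  then show ?case by (auto split: if_splits)
next
  case ("2_1" ys)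
  then show ?case using cycle_trivial[of v ys] by auto
next
  case ("2_2" xs)
  then show ?case using cycle_trivial[of v xs] by auto
qed

text \<open>In a triangular quiver a path is never a proper prefix of a parallel one, so the first arrow
  in which a path differs from a parallel path is unchanged when both are extended on either side.
  This splits the cochain complex.\<close>

definition diff_at :: "'e option \<Rightarrow> nat \<Rightarrow> (nat \<Rightarrow> ('v,'e) qpath) \<Rightarrow> ('v,'e) qpath \<Rightarrow> bool" where
  "diff_at c n P r \<longleftrightarrow> parallel n P r \<and> first_diff (word n P) (snd r) = c"

lemma compatI:
  assumes "\<And>n P r. n \<ge> 1 \<Longrightarrow> (\<And>j. P j \<in> B) \<Longrightarrow> pend (P 0) = fst r \<Longrightarrow> cmp (P 0) r \<in> B \<Longrightarrow>
      X (Suc n) P (cmp (P 0) r) = X n (sh 1 P) r"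
    and "\<And>n P r i. n \<ge> 1 \<Longrightarrow> (\<And>j. P j \<in> B) \<Longrightarrow> i < n \<Longrightarrow> r \<in> B \<Longrightarrow> pend (P i) = fst (P (Suc i)) \<Longrightarrow>
      X (Suc n) P r = X n (merge_at cmp i P) r"
    and "\<And>n P r. n \<ge> 1 \<Longrightarrow> (\<And>j. P j \<in> B) \<Longrightarrow> pend r = fst (P n) \<Longrightarrow> cmp r (P n) \<in> B \<Longrightarrow>
      X (Suc n) P (cmp r (P n)) = X n P r"
    and "\<And>n P Q r. n \<ge> 1 \<Longrightarrow> (\<And>j. j < n \<Longrightarrow> P j = Q j) \<Longrightarrow> X n P r = X n Q r"
  shows "compat X"
  unfolding compat_def using assms by blast

lemma parallel_left:
  assumes "n \<ge> 1" "pend (P 0) = fst r"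
  shows "parallel (Suc n) P (cmp (P 0) r) = parallel n (sh 1 P) r"
proof -
  have "pend (sh 1 P (n - 1)) = pend (P n)" using assms(1) by (simp add: sh_def)
  moreover have "fst (sh 1 P 0) = fst (P 1)" by (simp add: sh_def)
  ultimately show ?thesis unfolding parallel_def
    using assms by (simp only: chain_shift path_end_cmp fst_cmp diff_Suc_1) metis
qed

lemma parallel_right:
  assumes "n \<ge> 1" "pend r = fst (P n)"
  shows "parallel (Suc n) P (cmp r (P n)) = parallel n P r"
  unfolding parallel_def
  using assms by (simp only: chain_Suc path_end_cmp fst_cmp diff_Suc_1) metis

lemma parallel_merge:
  assumes "pend (P i) = fst (P (Suc i))" "i < n"
  shows "parallel (Suc n) P r = parallel n (merge_at cmp i P) r"
proof -
  have "pend (merge_at cmp i P (n - 1)) = pend (P n)"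
    using assms by (cases n) (auto simp: merge_at_def path_end_cmp)
  moreover have "fst (merge_at cmp i P 0) = fst (P 0)" by (simp add: merge_at_def)
  ultimately show ?thesis using chain_merge[OF assms] by (simp add: parallel_def)
qed

lemma parallel_cong:
  assumes "n \<ge> 1" "\<And>j. j < n \<Longrightarrow> P j = Q j"
  shows "parallel n P r = parallel n Q r"
proof -
  have "chain n P = chain n Q" by (rule chain_cong) (rule assms(2))
  moreover have "P 0 = Q 0" "P (n - 1) = Q (n - 1)" using assms by auto
  ultimately show ?thesis by (simp add: parallel_def)
qed

lemma parallel_path:
  assumes "parallel n P r" "n \<ge> 1" "\<And>j. P j \<in> B"
  shows "path (fst r, word n P)" "pend (fst r, word n P) = pend r"
  using assms pend_word[of n P] path_word[of n P] by (simp_all add: parallel_def)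

text \<open>A difference already found is not affected by later arrows. If none was found,
  parallelism forces the lists to be equal; for a proper prefix, appending could have created a
  difference.\<close>

lemma first_diff_append_right:
  assumes "parallel n P r" "n \<ge> 1" "\<And>j. P j \<in> B" "r \<in> B"
  shows "first_diff (word n P @ us) (snd r @ us) = first_diff (word n P) (snd r)"
proof (cases "first_diff (word n P) (snd r)")
  case None
  have "path (fst r, snd r)" "pend (fst r, snd r) = pend r" using B_path[OF assms(4)] by simp_all
  with parallel_path[OF assms(1-3)] None have "word n P = snd r" by (metis first_diff_None)
  then show ?thesis by simp
qed (simp add: first_diff_append_Some)

lemma diff_at_compat: "compat (diff_at c)"
proof (rule compatI)
  fix n :: nat and P :: "nat \<Rightarrow> ('v,'e) qpath" and r assume "n \<ge> 1" "\<And>j. P j \<in> B" "pend (P 0) = fst r" "cmp (P 0) r \<in> B"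
  then show "diff_at c (Suc n) P (cmp (P 0) r) = diff_at c n (sh 1 P) r"
    by (simp add: diff_at_def parallel_left word_shift del: One_nat_def)
next
  fix n i :: nat and P :: "nat \<Rightarrow> ('v,'e) qpath" and r assume "i < n" "pend (P i) = fst (P (Suc i))"
  then show "diff_at c (Suc n) P r = diff_at c n (merge_at cmp i P) r"
    using parallel_merge[of P i n r] by (simp add: diff_at_def word_merge)
next
  fix n :: nat and P :: "nat \<Rightarrow> ('v,'e) qpath" and r assume *: "n \<ge> 1" "\<And>j. P j \<in> B" "pend r = fst (P n)" "cmp r (P n) \<in> B"
  then have "parallel n P r \<Longrightarrow>
      first_diff (word n P @ snd (P n)) (snd r @ snd (P n)) = first_diff (word n P) (snd r)"
    using B_cmpD(1) by (intro first_diff_append_right) auto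
  then show "diff_at c (Suc n) P (cmp r (P n)) = diff_at c n P r"
    using * by (auto simp: diff_at_def parallel_right word_Suc)
next
  fix n :: nat and P Q :: "nat \<Rightarrow> ('v,'e) qpath" and r assume "n \<ge> 1" "\<And>j. j < n \<Longrightarrow> P j = Q j"
  then show "diff_at c n P r = diff_at c n Q r"
    using parallel_cong[of n P Q r] word_cong[of n P Q] by (simp add: diff_at_def)
qed

end

section \<open>The prism homotopy onto composable tuples\<close>

context triangular_monomial
begin

text \<open>The prism homotopy: inserting a trivial path at position i, with everything to its right
  required to be composable, interpolates between a cochain and its restriction to composable
  tuples.\<close>

definition insert_at :: "nat \<Rightarrow> 'v \<Rightarrow> (nat \<Rightarrow> ('v,'e) qpath) \<Rightarrow> nat \<Rightarrow> ('v,'e) qpath" where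
  "insert_at i v P = (\<lambda>j. if j < i then P j else if j = i then (v, []) else P (j - 1))"

text \<open>The end of the value r is treated as a further vertex to the right of the last argument.
  For i = n nothing is required, so insertion after the last argument is always allowed.\<close>

definition tail_chain :: "nat \<Rightarrow> nat \<Rightarrow> (nat \<Rightarrow> ('v,'e) qpath) \<Rightarrow> ('v,'e) qpath \<Rightarrow> bool" where
  "tail_chain i n P r \<longleftrightarrow> i < n \<longrightarrow>
     (\<forall>j. i \<le> j \<and> Suc j < n \<longrightarrow> pend (P j) = fst (P (Suc j))) \<and> pend (P (n - 1)) = pend r"

text \<open>The vertex is dictated by what follows the inserted trivial path; nothing is asked of
  the argument preceding it.\<close>

definition insert_vertex :: "nat \<Rightarrow> nat \<Rightarrow> (nat \<Rightarrow> ('v,'e) qpath) \<Rightarrow> ('v,'e) qpath \<Rightarrow> 'v" where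
  "insert_vertex i n P r = (if i < n then fst (P i) else pend r)"

definition prism_term :: "((nat \<Rightarrow> ('v,'e) qpath \<Rightarrow> 'k) \<Rightarrow> ('v,'e) qpath \<Rightarrow> 'k::field) \<Rightarrow> nat \<Rightarrow> nat \<Rightarrow>
    (nat \<Rightarrow> ('v,'e) qpath) \<Rightarrow> ('v,'e) qpath \<Rightarrow> 'k" where
  "prism_term f i n P r =
     (if tail_chain i n P r then f (bs (insert_at i (insert_vertex i n P r) P)) r else 0)"

definition prism :: "((nat \<Rightarrow> ('v,'e) qpath \<Rightarrow> 'k) \<Rightarrow> ('v,'e) qpath \<Rightarrow> 'k::field) \<Rightarrow> nat \<Rightarrow>
    (nat \<Rightarrow> ('v,'e) qpath \<Rightarrow> 'k) \<Rightarrow> ('v,'e) qpath \<Rightarrow> 'k" where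
  "prism f n = mlext B n (\<lambda>P r. \<Sum>i\<le>n. (-1) ^ i * prism_term f i n P r)"

lemma coch_prism: "coch B n (prism f n)"
  unfolding prism_def by (rule coch_mlext[OF finite_B])

lemma prism_bas:
  assumes f: "coch B (Suc n) f" and P: "\<And>j. P j \<in> B" and r: "r \<in> B"
  shows "prism f n (bs P) r = (\<Sum>i\<le>n. (-1) ^ i * prism_term f i n P r)"
  unfolding prism_def
proof (rule mlext_bas[OF finite_B P r])
  fix P Q :: "nat \<Rightarrow> ('v,'e) qpath" and r
  assume eq: "\<And>j. j < n \<Longrightarrow> P j = Q j"
  have "prism_term f i n P r = prism_term f i n Q r" if "i \<le> n" for i
  proof -
    have 1: "insert_vertex i n P r = insert_vertex i n Q r" by (simp add: insert_vertex_def eq)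
    have 2: "tail_chain i n P r = tail_chain i n Q r" by (auto simp: tail_chain_def eq)
    have "f (bs (insert_at i v P)) = f (bs (insert_at i v Q))" for v
      by (rule coch_cong[OF f]) (use that in \<open>auto simp: insert_at_def eq\<close>)
    then show ?thesis unfolding prism_term_def 1 2 by simp
  qed
  then show "(\<Sum>i\<le>n. (-1) ^ i * prism_term f i n P r) = (\<Sum>i\<le>n. (-1) ^ i * prism_term f i n Q r)"
    by simp
qed

lemma insert_at_in_B: "(\<And>j. P j \<in> B) \<Longrightarrow> v \<in> V \<Longrightarrow> insert_at i v P j \<in> B"
  by (simp add: insert_at_def trivial_in_B)

lemma insert_vertex_in: "(\<And>j. P j \<in> B) \<Longrightarrow> r \<in> B \<Longrightarrow> insert_vertex i n P r \<in> V"
  by (simp add: insert_vertex_def B_fst B_pend)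

lemma tail_chain_0: "n \<ge> 1 \<Longrightarrow> tail_chain 0 n P r \<longleftrightarrow> chain n P \<and> pend (P (n - 1)) = pend r"
  by (simp add: tail_chain_def chain_def Suc_le_eq)

lemma tail_chain_top [simp]: "tail_chain n n P r"
  by (simp add: tail_chain_def)

lemma tail_chain_left:
  assumes "n \<ge> i" "pend r = pend r'"
  shows "tail_chain (Suc i) (Suc n) P r = tail_chain i n (sh 1 P) r'"
proof (cases "i < n")
  case True
  have "(\<forall>j. Suc i \<le> j \<and> Suc j < Suc n \<longrightarrow> pend (P j) = fst (P (Suc j)))
     \<longleftrightarrow> (\<forall>j. i \<le> j \<and> Suc j < n \<longrightarrow> pend (P (Suc j)) = fst (P (Suc (Suc j))))"
    by (metis Suc_le_D Suc_le_mono Suc_less_eq)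
  then show ?thesis using True assms by (simp add: tail_chain_def sh_def)
qed (use assms in \<open>simp add: tail_chain_def\<close>)

lemma insert_vertex_left:
  "pend r = pend r' \<Longrightarrow> insert_vertex (Suc i) (Suc n) P r = insert_vertex i n (sh 1 P) r'"
  by (simp add: insert_vertex_def sh_def)

lemma sh_insert_at: "sh 1 (insert_at (Suc i) v P) = insert_at i v (sh 1 P)"
  by (auto simp: sh_def insert_at_def fun_eq_iff)

lemma tail_chain_right:
  assumes "i \<le> n" "pend r = pend (P n)" "pend r' = fst (P n)"
  shows "tail_chain i (Suc n) P r = tail_chain i n P r'"
proof (cases "i < n")
  case True
  have "(\<forall>j. i \<le> j \<and> Suc j < Suc n \<longrightarrow> pend (P j) = fst (P (Suc j)))
     \<longleftrightarrow> (\<forall>j. i \<le> j \<and> Suc j < n \<longrightarrow> pend (P j) = fst (P (Suc j))) \<and> pend (P (n - 1)) = fst (P n)"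
    using True by (auto simp: less_Suc_eq)
  then show ?thesis using True assms by (auto simp: tail_chain_def)
qed (use assms in \<open>auto simp: tail_chain_def\<close>)

lemma insert_vertex_right:
  "i \<le> n \<Longrightarrow> pend r' = fst (P n) \<Longrightarrow> insert_vertex i (Suc n) P r = insert_vertex i n P r'"
  by (auto simp: insert_vertex_def)

lemma tail_chain_merge_low:
  assumes "Suc j < i" "i \<le> Suc n"
  shows "tail_chain i (Suc n) P r = tail_chain (i - 1) n (merge_at cmp j P) r"
proof (cases "i < Suc n")
  case True
  obtain i' where i': "i = Suc i'" using assms by (cases i) auto
  have "(\<forall>l. Suc i' \<le> l \<and> Suc l < Suc n \<longrightarrow> pend (P l) = fst (P (Suc l)))
     \<longleftrightarrow> (\<forall>l. i' \<le> l \<and> Suc l < n \<longrightarrow> pend (P (Suc l)) = fst (P (Suc (Suc l))))"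
    by (metis Suc_le_D Suc_le_mono Suc_less_eq)
  then show ?thesis using True assms i' by (auto simp: tail_chain_def merge_at_def)
qed (use assms in \<open>simp add: tail_chain_def\<close>)

lemma tail_chain_merge_high:
  assumes "i \<le> j" "j < n" "pend (P j) = fst (P (Suc j))"
  shows "tail_chain i (Suc n) P r = tail_chain i n (merge_at cmp j P) r"
proof -
  have "pend (merge_at cmp j P (n - 1)) = pend (P n)"
    using assms by (cases n) (auto simp: merge_at_def path_end_cmp)
  then show ?thesis using links_merge[of P j n i] assms by (simp add: tail_chain_def)
qed

text \<open>The additional condition says exactly that \<open>P i\<close> composes with the trivial
  path inserted just after it. Thus merging that path to the left at position i + 1 and to the right
  at position i happen under the same condition.\<close>

lemma tail_chain_step:
  assumes "i < n"
  shows "tail_chain i n P r \<longleftrightarrow> tail_chain (Suc i) n P r \<and> pend (P i) = insert_vertex (Suc i) n P r"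
proof (cases "Suc i < n")
  case True
  have "(\<forall>j. i \<le> j \<and> Suc j < n \<longrightarrow> pend (P j) = fst (P (Suc j)))
     \<longleftrightarrow> (\<forall>j. Suc i \<le> j \<and> Suc j < n \<longrightarrow> pend (P j) = fst (P (Suc j))) \<and> pend (P i) = fst (P (Suc i))"
    using True by (auto simp: le_less[of i] Suc_le_eq)
  then show ?thesis using True by (auto simp: tail_chain_def insert_vertex_def)
next
  case False
  then have "n = Suc i" using assms by simp
  then show ?thesis by (auto simp: tail_chain_def insert_vertex_def)
qed

text \<open>A trivial path is inserted into P at each position i <= k + 1, and the vanishing
  differential of f on the resulting tuples is summed with signs (-1)^(i+1), subject to
  \<open>tail_chain\<close>. Terms in which the trivial path is absorbed by a neighbour cancel in
  pairs, the others assemble to the differential of the prism, and two end terms are left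
  over.\<close>

lemma dif_prism:
  fixes f :: "(nat \<Rightarrow> ('v,'e) qpath \<Rightarrow> 'k) \<Rightarrow> ('v,'e) qpath \<Rightarrow> 'k::field"
  assumes f: "coch B (Suc k) f" and df: "\<And>x r. dif (Suc k) f x r = 0"
    and P: "\<And>j. P j \<in> B" and r: "r \<in> B"
  shows "dif k (prism f k) (bs P) r = (if parallel (Suc k) P r then f (bs P) r else 0) - f (bs P) r"
proof -
  define h where "h = prism f k"
  note h_bas = prism_bas[OF f, folded h_def]
  have ch: "coch B k h" unfolding h_def by (rule coch_prism)
  define v where "v i = insert_vertex i (Suc k) P r" for i
  define Q where "Q i = insert_at i (v i) P" for i
  define \<tau> where "\<tau> i = tail_chain i (Suc k) P r" for i
  have v: "v i \<in> V" for i unfolding v_def by (rule insert_vertex_in[OF P r])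
  have Q: "Q i j \<in> B" for i j unfolding Q_def by (rule insert_at_in_B[OF P v])
  have shP: "sh 1 P j \<in> B" for j using P by (simp add: sh_def)
  define A where "A i = (if \<tau> i then mul (bas (Q i 0)) (f (sh 1 (bs (Q i)))) r else 0)" for i
  define C where "C i j = (if \<tau> i then f (merge_at mul j (bs (Q i))) r else 0)" for i j
  define Z where "Z i = (if \<tau> i then mul (f (bs (Q i))) (bas (Q i (Suc k))) r else 0)" for i
  have eq0: "A i + (\<Sum>j<Suc k. (-1) ^ (j + 1) * C i j) + (-1) ^ (Suc k + 1) * Z i = 0" for i
    using df[of "bs (Q i)" r] by (simp add: A_def C_def Z_def dif_def)
  define X where "X i j = (if pend (P j) = fst (P (Suc j)) \<and> cmp (P j) (P (Suc j)) \<in> B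
    then prism_term f i k (merge_at cmp j P) r else 0)" for i j
  define L where "L i = (if \<tau> (i - 1) then f (bs P) r else 0)" for i
  define R where "R i = (if \<tau> i then f (bs P) r else 0)" for i

  \<comment> \<open>First end term: a trivial path in front, with everything behind it composable up
    to the end of r; multiplying by it also compares the starting vertices.\<close>
  have A0: "A 0 = (if parallel (Suc k) P r then f (bs P) r else 0)"
  proof -
    have "Q 0 0 = (fst (P 0), [])" by (simp add: Q_def insert_at_def v_def insert_vertex_def)
    moreover have "sh 1 (Q 0) = P" by (simp add: Q_def insert_at_def sh_def)
    ultimately have "mul (bas (Q 0 0)) (f (sh 1 (bs (Q 0)))) r = (if fst r = fst (P 0) then f (bs P) r else 0)"
      by (simp add: mul_trivial_left[OF r B_fst[OF P]] sh_bas del: One_nat_def)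
    then show ?thesis unfolding A_def \<tau>_def parallel_def by (auto simp: tail_chain_0)
  qed
  have AA: "mul (bas (P 0)) (h (sh 1 (bs P))) r = (\<Sum>i\<le>k. (-1) ^ i * A (Suc i))"
  proof (cases "\<exists>q\<in>B. pend (P 0) = fst q \<and> cmp (P 0) q = r")
    case True
    then obtain q where q: "q \<in> B" "pend (P 0) = fst q" "r = cmp (P 0) q" by blast
    have m: "mul (bas (P 0)) y r = (y q :: 'k)" for y
      using mul_bas_cmp(1)[of "P 0" q y] q r by simp
    have pr: "pend r = pend q" using q path_end_cmp by metis
    have "A (Suc i) = prism_term f i k (sh 1 P) q" if "i \<le> k" for i
    proof -
      have "Q (Suc i) 0 = P 0" by (simp add: Q_def insert_at_def)
      moreover have "sh 1 (Q (Suc i)) = insert_at i (insert_vertex i k (sh 1 P) q) (sh 1 P)"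
        unfolding Q_def sh_insert_at v_def insert_vertex_left[OF pr] ..
      ultimately show ?thesis unfolding A_def prism_term_def \<tau>_def tail_chain_left[OF that pr]
        by (simp add: m sh_bas del: One_nat_def)
    qed
    then show ?thesis unfolding m sh_bas h_bas[OF shP q(1)] by simp
  next
    case False
    then have m: "mul (bas (P 0)) y r = (0 :: 'k)" for y
      by (intro mul_bas_left_0[OF P]) blast
    have "A (Suc i) = 0" for i by (simp add: A_def m Q_def insert_at_def)
    then show ?thesis by (simp add: m)
  qed
  \<comment> \<open>Second end term: a trivial path behind the last argument, where no condition is
    imposed, so f itself comes out.\<close>
  have Zm: "Z (Suc k) = f (bs P) r"
  proof -
    have "Q (Suc k) (Suc k) = (pend r, [])" by (simp add: Q_def insert_at_def v_def insert_vertex_def)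
    moreover have "f (bs (Q (Suc k))) = f (bs P)"
      by (rule coch_cong[OF f]) (simp add: Q_def insert_at_def)
    ultimately show ?thesis by (simp add: Z_def \<tau>_def mul_trivial_right[OF r])
  qed
  have ZZ: "mul (h (bs P)) (bas (P k)) r = (\<Sum>i\<le>k. (-1) ^ i * Z i)"
  proof (cases "\<exists>q\<in>B. pend q = fst (P k) \<and> cmp q (P k) = r")
    case True
    then obtain q where q: "q \<in> B" "pend q = fst (P k)" "r = cmp q (P k)" by blast
    have m: "mul y (bas (P k)) r = (y q :: 'k)" for y
      using mul_bas_cmp(2)[of q "P k" y] q r by simp
    have pr: "pend r = pend (P k)" using q path_end_cmp by metis
    have "Z i = prism_term f i k P q" if "i \<le> k" for i
    proof -
      have "Q i (Suc k) = P k" using that by (simp add: Q_def insert_at_def)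
      then show ?thesis unfolding Z_def prism_term_def \<tau>_def tail_chain_right[where P = P and n = k, OF that pr q(2)]
        by (simp add: m Q_def v_def insert_vertex_right[where P = P and n = k, OF that q(2)])
    qed
    then show ?thesis unfolding m h_bas[OF P q(1)] by simp
  next
    case False
    then have m: "mul y (bas (P k)) r = (0 :: 'k)" for y
      by (intro mul_bas_right_0[OF P]) blast
    have "Z i = 0" if "i \<le> k" for i using that by (simp add: Z_def m Q_def insert_at_def)
    then show ?thesis by (simp add: m)
  qed
  \<comment> \<open>The instance n = 0 of the pattern in \<open>sum_insertion_merge\<close>: the
    inserted path consumes no argument. The last alternative occurs only for j > i, so j - 1 is
    genuine.\<close>
  have CC: "C i j = (if j + 1 < i then X (i - 1) j else if j + 1 = i then L i else if j = i then R i
      else X i (j + 0 - 1))" if ij: "i \<le> Suc k" "j < Suc k" for i j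
  proof -
    note merge = coch_merge_bas[OF f ij(2) Q]
    consider "j + 1 < i" | "j + 1 = i" | "j = i" | "i < j" by linarith
    then show ?thesis
    proof cases
      case 1
      have a: "Q i j = P j" "Q i (Suc j) = P (Suc j)" using 1 by (simp_all add: Q_def insert_at_def)
      have "insert_vertex (i - 1) k (merge_at cmp j P) r = v i"
        using 1 ij by (auto simp: insert_vertex_def v_def merge_at_def)
      moreover have "merge_at cmp j (Q i) = insert_at (i - 1) (v i) (merge_at cmp j P)"
        unfolding Q_def using 1 by (intro ext) (auto simp: insert_at_def merge_at_def)
      ultimately show ?thesis
        using 1 tail_chain_merge_low[of j i k P r] ij
        by (auto simp: C_def merge a X_def prism_term_def \<tau>_def)
    next
      case 2
      have a: "Q (Suc j) j = P j" "Q (Suc j) (Suc j) = (v (Suc j), [])" by (auto simp: Q_def insert_at_def)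
      have c: "cmp (P j) (v (Suc j), []) = P j" by (cases "P j") (simp add: cmp_def)
      have "f (bs (merge_at cmp j (Q i))) = f (bs P)"
        by (rule coch_cong[OF f]) (use 2 c in \<open>auto simp: Q_def insert_at_def merge_at_def\<close>)
      moreover have "\<tau> j \<longleftrightarrow> \<tau> i \<and> pend (P j) = v i"
        using tail_chain_step[of j "Suc k" P r] 2 ij by (auto simp: \<tau>_def v_def)
      ultimately show ?thesis using 2 P by (auto simp: C_def merge a c L_def)
    next
      case 3
      have v': "v i = fst (P i)" using 3 ij by (simp add: v_def insert_vertex_def)
      have a: "Q i i = (fst (P i), [])" "Q i (Suc i) = P i" using v' by (auto simp: Q_def insert_at_def)
      have c: "cmp (fst (P i), []) (P i) = P i" by (cases "P i") (simp add: cmp_def)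
      have "f (bs (merge_at cmp j (Q i))) = f (bs P)"
        by (rule coch_cong[OF f]) (use 3 c v' in \<open>auto simp: Q_def insert_at_def merge_at_def\<close>)
      then show ?thesis using 3 P coch_merge_bas[where P = "Q i" and r = r, OF f ij(2) Q] by (auto simp: C_def a c R_def)
    next
      case 4
      obtain j' where j': "j = Suc j'" using 4 by (cases j) auto
      have a: "Q i j = P j'" "Q i (Suc j) = P (Suc j')" using 4 j' by (auto simp: Q_def insert_at_def)
      have "insert_vertex i k (merge_at cmp j' P) r = v i"
        using 4 ij j' by (cases "i = j'") (auto simp: insert_vertex_def v_def merge_at_def)
      moreover have "merge_at cmp j (Q i) = insert_at i (v i) (merge_at cmp j' P)"
        unfolding Q_def using 4 j' by (intro ext) (auto simp: insert_at_def merge_at_def)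
      ultimately show ?thesis
        using 4 tail_chain_merge_high[of i j' k P r] ij j' a
          coch_merge_bas[where P = "Q i" and r = r, OF f ij(2) Q]
        by (auto simp: C_def X_def prism_term_def \<tau>_def)
    qed
  qed
  have XX: "h (merge_at mul j (bs P)) r = (\<Sum>i<Suc k. (-1) ^ i * X i j)" if j: "j < k" for j
  proof (cases "pend (P j) = fst (P (Suc j)) \<and> cmp (P j) (P (Suc j)) \<in> B")
    case True
    have "h (merge_at mul j (bs P)) r = h (bs (merge_at cmp j P)) r"
      unfolding coch_merge_bas[OF ch j P] if_P[OF True] ..
    moreover have "merge_at cmp j P l \<in> B" for l using merge_in_B[of P j l] P True by blast
    then have "h (bs (merge_at cmp j P)) r = (\<Sum>i\<le>k. (-1) ^ i * prism_term f i k (merge_at cmp j P) r)"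
      by (rule h_bas[OF _ r])
    ultimately show ?thesis using True
      by (simp add: X_def lessThan_Suc_atMost)
  next
    case False
    have "h (merge_at mul j (bs P)) r = 0"
      unfolding coch_merge_bas[OF ch j P] if_not_P[OF False] ..
    moreover have "X i j = 0" for i unfolding X_def if_not_P[OF False] ..
    ultimately show ?thesis by simp
  qed
  let ?c = "\<lambda>i. (-1) ^ ((i + 1) * (0 + 1)) :: 'k"
  have "0 = (\<Sum>i\<le>Suc k. ?c i * (A i + (\<Sum>j<Suc k. (-1) ^ (j + 1) * C i j) + (-1) ^ (Suc k + 1) * Z i))"
    unfolding eq0 by simp
  also have "\<dots> = (\<Sum>i\<le>Suc k. ?c i * A i) + (\<Sum>i\<le>Suc k. ?c i * (\<Sum>j<Suc k. (-1) ^ (j + 1) * C i j))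
      + (\<Sum>i\<le>Suc k. ?c i * ((-1) ^ (Suc k + 1) * Z i))"
    by (simp only: sum.distrib distrib_left)
  also have "(\<Sum>i\<le>Suc k. ?c i * A i) = mul (bas (P 0)) (h (sh 1 (bs P))) r - A 0"
    unfolding AA by (subst sum.atMost_Suc_shift) simp
  also have "(\<Sum>i\<le>Suc k. ?c i * ((-1) ^ (Suc k + 1) * Z i))
      = (-1) ^ (k + 1) * mul (h (bs P)) (bas (P k)) r + f (bs P) r"
  proof -
    have "?c i * ((-1) ^ (Suc k + 1) * z) = (-1) ^ (k + 1) * ((-1) ^ i * z)" for i z
      unfolding mult.assoc[symmetric] power_add[symmetric]
      by (intro arg_cong2[where f = "(*)"] minus_one_power_cong refl) auto
    moreover have "(-1) ^ (k + 1) * ((-1) ^ Suc k * z) = (z :: 'k)" for z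
      by (simp add: minus_one_power_iff)
    ultimately show ?thesis by (simp only: ZZ sum.atMost_Suc Zm sum_distrib_left)
  qed
  also have "(\<Sum>i\<le>Suc k. ?c i * (\<Sum>j<Suc k. (-1) ^ (j + 1) * C i j))
      = (\<Sum>j<k. (-1) ^ (j + 1) * h (merge_at mul j (bs P)) r)"
  proof -
    have "(\<Sum>i\<le>Suc k. ?c i * (\<Sum>j<Suc k. (-1) ^ (j + 1) * C i j))
      = (\<Sum>i\<le>Suc k. ?c i * (\<Sum>j<Suc k. (-1) ^ (j + 1) *
         (if j + 1 < i then X (i - 1) j else if j + 1 = i then L i else if j = i then R i
           else X i (j + 0 - 1))))"
      by (intro sum.cong arg_cong2[where f = "(*)"] refl) (simp only: CC atMost_iff lessThan_iff)
    also have "\<dots> = (\<Sum>i<Suc k. (-1) ^ (i * (0 + 1)) * ((\<Sum>j<i. (-1) ^ (j + 1) * X i j)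
           + (\<Sum>j\<in>{i + 0..<Suc k + 0 - 1}. (-1) ^ (j + 1) * X i j)))
      + ((\<Sum>i<Suc k. (-1) ^ (i * (0 + 1) + i + 1) * L (Suc i))
      + (\<Sum>i<Suc k. (-1) ^ ((i + 1) * (0 + 1) + i + 1) * R i))"
      unfolding sum_insertion_merge add.assoc ..
    \<comment> \<open>\<open>L (Suc i)\<close> and \<open>R i\<close> are the same value of f under
      the same condition; the two sign exponents have opposite parity.\<close>
    also have "(\<Sum>i<Suc k. (-1) ^ (i * (0 + 1) + i + 1) * L (Suc i))
      + (\<Sum>i<Suc k. (-1) ^ ((i + 1) * (0 + 1) + i + 1) * R i) = 0"
      unfolding sum.distrib[symmetric] by (rule sum.neutral) (simp add: L_def R_def minus_one_power_iff)
    also have "(\<Sum>i<Suc k. (-1) ^ (i * (0 + 1)) * ((\<Sum>j<i. (-1) ^ (j + 1) * X i j)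
           + (\<Sum>j\<in>{i + 0..<Suc k + 0 - 1}. (-1) ^ (j + 1) * X i j)))
      = (\<Sum>i<Suc k. (-1) ^ i * (\<Sum>j<k. (-1) ^ (j + 1) * X i j))"
    proof (rule sum.cong[OF refl])
      fix i assume "i \<in> {..<Suc k}"
      then show "(-1) ^ (i * (0 + 1)) * ((\<Sum>j<i. (-1) ^ (j + 1) * X i j)
           + (\<Sum>j\<in>{i + 0..<Suc k + 0 - 1}. (-1) ^ (j + 1) * X i j)) = (-1) ^ i * (\<Sum>j<k. (-1) ^ (j + 1) * X i j)"
        using sum.atLeastLessThan_concat[of 0 i k "\<lambda>j. (-1) ^ (j + 1) * X i j"]
        by (simp add: lessThan_atLeast0)
    qed
    also have "\<dots> = (\<Sum>j<k. (-1) ^ (j + 1) * (\<Sum>i<Suc k. (-1) ^ i * X i j))"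
      unfolding sum_distrib_left by (subst sum.swap) (simp add: mult.left_commute)
    finally show ?thesis by (simp add: XX)
  qed
  finally show ?thesis unfolding A0 h_def[symmetric] by (simp add: dif_def algebra_simps)
qed

end

section \<open>The diagonal part: values in the multiples of the product path\<close>

context triangular_monomial
begin

text \<open>An empty tuple does not fix a starting vertex, so for n = 0 every trivial path
  qualifies. Degree 0 occurs when a cocycle of degree 1 is corrected by a coboundary.\<close>

definition diag :: "nat \<Rightarrow> (nat \<Rightarrow> ('v,'e) qpath) \<Rightarrow> ('v,'e) qpath \<Rightarrow> bool" where
  "diag n P r \<longleftrightarrow> chain n P \<and> snd r = word n P \<and> (n > 0 \<longrightarrow> fst r = fst (P 0))"

lemma diag_cong: "(\<And>j. j < n \<Longrightarrow> P j = Q j) \<Longrightarrow> diag n P r = diag n Q r"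
  using chain_cong[of n P Q] word_cong[of n P Q] by (auto simp: diag_def)

lemma diag_eq: "diag n P r \<Longrightarrow> n \<ge> 1 \<Longrightarrow> r = (fst (P 0), word n P)"
  by (cases r) (simp add: diag_def)

lemma diff_at_None:
  assumes "n \<ge> 1" "\<And>j. P j \<in> B" "r \<in> B"
  shows "diff_at None n P r \<longleftrightarrow> diag n P r"
proof
  assume "diff_at None n P r"
  then have p: "parallel n P r" "first_diff (word n P) (snd r) = None" by (auto simp: diff_at_def)
  have "path (fst r, snd r)" "pend (fst r, snd r) = pend r" using B_path[OF assms(3)] by simp_all
  with parallel_path[OF p(1) assms(1,2)] p(2) have "word n P = snd r" by (metis first_diff_None)
  then show "diag n P r" using p(1) by (simp add: diag_def parallel_def)
next
  assume d: "diag n P r"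
  then have "pend r = pend (P (n - 1))"
    using diag_eq[OF d assms(1)] pend_word[of n P] assms(1) by (simp add: diag_def)
  then show "diff_at None n P r" using d assms(1) by (simp add: diag_def diff_at_def parallel_def)
qed

lemma word_split: "word (i + n) P = word i P @ word n (sh i P)"
  by (induction n) (simp_all add: word_Suc sh_def add.commute)

lemma B_factor: "(v, us @ xs @ ws) \<in> B \<Longrightarrow> (pend (v, us), xs) \<in> B"
proof -
  assume a: "(v, us @ xs @ ws) \<in> B"
  have "(pend (v, us), xs @ ws) \<in> B"
    using B_cmpD(2)[of "(v, us)" "(pend (v, us), xs @ ws)"] a by (simp add: cmp_def)
  then show ?thesis
    using B_cmpD(1)[of "(pend (v, us), xs)" "(pend (pend (v, us), xs), ws)"] by (simp add: cmp_def)
qed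

lemma pend_word_link:
  assumes "chain (Suc n) P" shows "pend (fst (P 0), word n P) = fst (P n)"
  using assms pend_word[of n P] chain_Suc[of n P] by (cases n) auto

text \<open>Every entry is a subpath of r, and subpaths of paths outside I are outside I. Applied to
  a merged tuple, this shows that the merged path is a basis element.\<close>

lemma diag_factor:
  assumes "diag n P r" "r \<in> B" "i < n"
  shows "P i \<in> B"
proof -
  have "word n P = word (Suc i + (n - Suc i)) P" using assms(3) by simp
  then have "word n P = word i P @ snd (P i) @ word (n - Suc i) (sh (Suc i) P)"
    by (simp only: word_split word_Suc append_assoc)
  then have "(pend (fst (P 0), word i P), snd (P i)) \<in> B"
    using assms diag_eq[OF assms(1)] B_factor by fastforce
  moreover have "chain (Suc i) P" using assms by (auto simp: diag_def chain_def)
  ultimately show ?thesis by (simp add: pend_word_link)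
qed

lemma diag_left:
  assumes "pend (P 0) = fst q" shows "diag (Suc n) P (cmp (P 0) q) \<longleftrightarrow> diag n (sh 1 P) q"
  using assms chain_shift[of n P] by (cases n) (auto simp: diag_def word_shift sh_def chain_def)

lemma diag_merge:
  assumes "pend (P i) = fst (P (Suc i))" "i < n"
  shows "diag (Suc n) P r \<longleftrightarrow> diag n (merge_at cmp i P) r"
  using assms chain_merge[OF assms] word_merge[of i n P] by (auto simp: diag_def merge_at_def)

lemma diag_right:
  assumes "pend q = fst (P n)" shows "diag (Suc n) P (cmp q (P n)) \<longleftrightarrow> diag n P q"
proof (cases n)
  case 0
  then show ?thesis using assms by (cases q) (auto simp: diag_def word_Suc chain_def)
next
  case (Suc n')
  have "pend q = pend (P n')" if "diag n P q"
    using that diag_eq[OF that] pend_word[of n P] Suc by (simp add: diag_def)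
  then show ?thesis using assms chain_Suc[of n P] Suc by (auto simp: diag_def word_Suc)
qed

text \<open>The differential becomes an alternating sum over deleted cut points:
  \<open>sh 1 Q\<close> deletes the first, a merge an inner one, and Q, read only up to n, the last.
  \<Theta> receives the end vertex separately because it cannot be read off an empty tuple; once the
  last path is dropped, that vertex is \<open>fst (Q n)\<close>.\<close>

lemma dif_diag:
  fixes \<Theta> :: "(nat \<Rightarrow> ('v,'e) qpath) \<Rightarrow> 'v \<Rightarrow> 'k::field"
  assumes g: "coch B n g"
    and gb: "\<And>P r. (\<And>j. P j \<in> B) \<Longrightarrow> r \<in> B \<Longrightarrow> g (bs P) r = (if diag n P r then \<Theta> P (pend r) else 0)"
    and Q: "\<And>j. Q j \<in> B" and r: "r \<in> B"
  shows "dif n g (bs Q) r = (if diag (Suc n) Q r then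
      \<Theta> (sh 1 Q) (pend r) + (\<Sum>i<n. (-1) ^ (i + 1) * \<Theta> (merge_at cmp i Q) (pend r))
        + (-1) ^ (n + 1) * \<Theta> Q (fst (Q n)) else 0)"
proof -
  have shQ: "sh 1 Q j \<in> B" for j using Q by (simp add: sh_def)
  show ?thesis
  proof (cases "diag (Suc n) Q r")
    case True
    then have ch: "chain (Suc n) Q" by (simp add: diag_def)
    have 1: "mul (bas (Q 0)) (g (sh 1 (bs Q))) r = \<Theta> (sh 1 Q) (pend r)"
    proof -
      define q where "q = (pend (Q 0), word n (sh 1 Q))"
      have e: "r = cmp (Q 0) q" using diag_eq[OF True] by (simp add: q_def cmp_def word_shift)
      have l: "pend (Q 0) = fst q" by (simp add: q_def)
      note qB = B_cmpD(2)[OF l] r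
      have "mul (bas (Q 0)) (g (sh 1 (bs Q))) r = g (bs (sh 1 Q)) q"
        unfolding e sh_bas using mul_bas_cmp(1)[of "Q 0" q] l r e by simp
      also have "\<dots> = \<Theta> (sh 1 Q) (pend q)"
        using gb[OF shQ, of q] qB e diag_left[of Q q n] True l by (simp del: One_nat_def)
      also have "pend q = pend r" unfolding e using path_end_cmp[OF l] by simp
      finally show ?thesis .
    qed
    have 2: "g (merge_at mul i (bs Q)) r = \<Theta> (merge_at cmp i Q) (pend r)" if i: "i < n" for i
    proof -
      have l: "pend (Q i) = fst (Q (Suc i))" using ch i by (simp add: chain_def)
      have d: "diag n (merge_at cmp i Q) r" using diag_merge[OF l i] True by simp
      have c: "cmp (Q i) (Q (Suc i)) \<in> B"
        using diag_factor[OF d r i] by (simp add: merge_at_def)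
      then have "merge_at cmp i Q j \<in> B" for j using merge_in_B[of Q i j] Q by blast
      then show ?thesis using coch_merge_bas[OF g i Q] l c gb[of "merge_at cmp i Q" r] r d by simp
    qed
    have 3: "mul (g (bs Q)) (bas (Q n)) r = \<Theta> Q (fst (Q n))"
    proof -
      define q where "q = (fst (Q 0), word n Q)"
      have e: "r = cmp q (Q n)" using diag_eq[OF True] by (simp add: q_def cmp_def word_Suc)
      have l: "pend q = fst (Q n)" unfolding q_def by (rule pend_word_link[OF ch])
      have "mul (g (bs Q)) (bas (Q n)) r = g (bs Q) q"
        unfolding e using mul_bas_cmp(2)[of q "Q n"] l r e by simp
      also have "\<dots> = \<Theta> Q (pend q)"
        using gb[OF Q, of q] B_cmpD(1)[OF l] r e diag_right[of q Q n] True l by simp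
      finally show ?thesis unfolding l .
    qed
    show ?thesis unfolding dif_def 1 3 using True 2 by simp
  next
    case False
    have 1: "mul (bas (Q 0)) (g (sh 1 (bs Q))) r = 0 * mul (bas (Q 0)) (\<lambda>_. 0) r"
    proof (rule mul_bas_left_cong[OF Q])
      fix q assume q: "pend (Q 0) = fst q" "cmp (Q 0) q = r"
      then have "\<not> diag n (sh 1 Q) q" "q \<in> B" using False diag_left[of Q q n] B_cmpD(2) r by auto
      then show "g (sh 1 (bs Q)) q = 0 * 0" unfolding sh_bas using gb[OF shQ, of q] by simp
    qed
    have 2: "g (merge_at mul i (bs Q)) r = 0" if i: "i < n" for i
    proof (cases "pend (Q i) = fst (Q (Suc i)) \<and> cmp (Q i) (Q (Suc i)) \<in> B")
      case True
      then have "merge_at cmp i Q j \<in> B" for j using merge_in_B[of Q i j] Q by blast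
      moreover have "\<not> diag n (merge_at cmp i Q) r" using True False diag_merge[OF _ i] by blast
      ultimately have "g (bs (merge_at cmp i Q)) r = 0" using gb[of "merge_at cmp i Q" r] r by simp
      then show ?thesis unfolding coch_merge_bas[OF g i Q] if_P[OF True] .
    next
      case False
      show ?thesis unfolding coch_merge_bas[OF g i Q] if_not_P[OF False] ..
    qed
    have 3: "mul (g (bs Q)) (bas (Q n)) r = 0 * mul (\<lambda>_. 0) (bas (Q n)) r"
    proof (rule mul_bas_right_cong[OF Q])
      fix q assume q: "pend q = fst (Q n)" "cmp q (Q n) = r"
      then have "\<not> diag n Q q" "q \<in> B" using False diag_right[of q Q n] B_cmpD(1) r by auto
      then show "g (bs Q) q = 0 * 0" using gb[OF Q, of q] by simp
    qed
    show ?thesis unfolding dif_def 1 3 using False 2 by simp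
  qed
qed

text \<open>In a distinct list each entry marks exactly one step between consecutive prefixes. The
  sum runs over a fixed set A so that the pieces are indexed independently of the path.\<close>

lemma sum_takeWhile_telescope:
  fixes \<Phi> :: "'x list \<Rightarrow> 'k::field"
  assumes "distinct xs" "set xs \<subseteq> A" "finite A"
  shows "(\<Sum>a\<in>A. if a \<in> set xs then \<Phi> (takeWhile (\<lambda>b. b \<noteq> a) xs @ [a]) - \<Phi> (takeWhile (\<lambda>b. b \<noteq> a) xs) else 0)
    = \<Phi> xs - \<Phi> []"
  using assms(1,2)
proof (induction xs rule: rev_induct)
  case (snoc c xs)
  let ?t = "\<lambda>xs a. if a \<in> set xs then \<Phi> (takeWhile (\<lambda>b. b \<noteq> a) xs @ [a]) - \<Phi> (takeWhile (\<lambda>b. b \<noteq> a) xs) else 0"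
  have c: "c \<in> A" "c \<notin> set xs" using snoc.prems by auto
  then have tw: "takeWhile (\<lambda>b. b \<noteq> c) xs = xs" by (auto simp: takeWhile_eq_all_conv)
  have "?t (xs @ [c]) a = ?t xs a + (if a = c then \<Phi> (xs @ [c]) - \<Phi> xs else 0)" for a
    using c tw by (auto simp: takeWhile_append)
  then have "(\<Sum>a\<in>A. ?t (xs @ [c]) a) = (\<Sum>a\<in>A. ?t xs a) + (\<Phi> (xs @ [c]) - \<Phi> xs)"
    using c assms(3) by (simp add: sum.distrib)
  then show ?case using snoc by simp
qed simp

definition diag_value :: "((nat \<Rightarrow> ('v,'e) qpath \<Rightarrow> 'k) \<Rightarrow> ('v,'e) qpath \<Rightarrow> 'k::field) \<Rightarrow> nat \<Rightarrow>
    (nat \<Rightarrow> ('v,'e) qpath) \<Rightarrow> 'k" where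
  "diag_value f n P = f (bs P) (fst (P 0), word n P)"

lemma diag_value_cong:
  assumes "coch B (Suc k) f" "\<And>j. j < Suc k \<Longrightarrow> P j = Q j"
  shows "diag_value f (Suc k) P = diag_value f (Suc k) Q"
proof -
  have "f (bs P) = f (bs Q)" by (rule coch_cong[OF assms(1)]) (simp add: assms(2))
  moreover have "word (Suc k) P = word (Suc k) Q" by (rule word_cong) (rule assms(2))
  ultimately show ?thesis using assms(2)[of 0] by (simp add: diag_value_def)
qed

text \<open>The restriction of f to \<open>diff_at None\<close> is still a cocycle, and
  \<open>dif_diag\<close> evaluates its differential. The merge at k is listed apart because it is
  the only merge that changes the last path.\<close>

lemma diag_cocycle:
  fixes f :: "(nat \<Rightarrow> ('v,'e) qpath \<Rightarrow> 'k) \<Rightarrow> ('v,'e) qpath \<Rightarrow> 'k::field"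
  assumes f: "cocycle (Suc k) f" and Q: "\<And>j. Q j \<in> B" and r: "r \<in> B" and d: "diag (Suc (Suc k)) Q r"
  shows "diag_value f (Suc k) (sh 1 Q) + (\<Sum>i<k. (-1) ^ (i + 1) * diag_value f (Suc k) (merge_at cmp i Q))
    + (-1) ^ Suc k * diag_value f (Suc k) (merge_at cmp k Q) + (-1) ^ k * diag_value f (Suc k) Q = 0"
proof -
  have cf: "coch B (Suc k) f" using f by (simp add: cocycle_def)
  define g where "g = restr (Suc k) (diff_at None) f"
  have "g (bs P) r = (if diag (Suc k) P r then diag_value f (Suc k) P else 0)"
    if "\<And>j. P j \<in> B" "r \<in> B" for P r
    using restr_bas[where P = P and r = r, OF diff_at_compat[of None] cf _ that(1)] diff_at_None[where n = "Suc k" and P = P, OF _ that] diag_eq[of "Suc k" P r]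
    by (auto simp: g_def diag_value_def)
  from dif_diag[where n = "Suc k" and g = g and \<Theta> = "\<lambda>P _. diag_value f (Suc k) P" and Q = Q, OF _ this Q r]
  have "dif (Suc k) g (bs Q) r = diag_value f (Suc k) (sh 1 Q)
     + (\<Sum>i<Suc k. (-1) ^ (i + 1) * diag_value f (Suc k) (merge_at cmp i Q))
     + (-1) ^ (Suc k + 1) * diag_value f (Suc k) Q"
    using d by (simp add: g_def coch_restr)
  moreover have "cocycle (Suc k) g" unfolding g_def by (rule cocycle_restr[OF diff_at_compat f]) simp
  then have "dif (Suc k) g (bs Q) r = 0" unfolding cocycle_def by blast
  ultimately show ?thesis by (simp add: add_diff_eq)
qed

text \<open>The increment of \<open>diag_value\<close> as the last cut point crosses a, all other
  cut points being fixed. An arrow occurs at most once on a path, so \<open>takeWhile\<close> finds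
  the prefix ending just before it.\<close>

definition arrow_part :: "((nat \<Rightarrow> ('v,'e) qpath \<Rightarrow> 'k) \<Rightarrow> ('v,'e) qpath \<Rightarrow> 'k::field) \<Rightarrow> nat \<Rightarrow> 'e \<Rightarrow>
    (nat \<Rightarrow> ('v,'e) qpath) \<Rightarrow> 'k" where
  "arrow_part f k a P = (if a \<in> set (snd (P k)) then
     diag_value f (Suc k) (P(k := (fst (P k), takeWhile (\<lambda>b. b \<noteq> a) (snd (P k)) @ [a])))
     - diag_value f (Suc k) (P(k := (fst (P k), takeWhile (\<lambda>b. b \<noteq> a) (snd (P k))))) else 0)"

text \<open>If a is on the last path, the identity is the difference of two instances of
  \<open>diag_cocycle\<close>, with the last path cut just after and just before a. Otherwise only
  the merge at k and the tuple without its last path can contribute, and they do so equally with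
  opposite signs.\<close>

lemma arrow_part_cocycle:
  fixes f :: "(nat \<Rightarrow> ('v,'e) qpath \<Rightarrow> 'k) \<Rightarrow> ('v,'e) qpath \<Rightarrow> 'k::field"
  assumes f: "cocycle (Suc k) f" and Q: "\<And>j. Q j \<in> B" and r: "r \<in> B" and d: "diag (Suc (Suc k)) Q r"
  shows "arrow_part f k a (sh 1 Q) + (\<Sum>i<k. (-1) ^ (i + 1) * arrow_part f k a (merge_at cmp i Q))
    + (-1) ^ Suc k * arrow_part f k a (merge_at cmp k Q) + (-1) ^ k * arrow_part f k a Q = 0"
proof -
  let ?m = "Suc k"
  let ?\<phi> = "diag_value f ?m"
  let ?tw = "takeWhile (\<lambda>b. b \<noteq> a)"
  have cf: "coch B ?m f" using f by (simp add: cocycle_def)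
  have sk: "sh 1 Q k = Q ?m" by (simp add: sh_def)
  have mi: "merge_at cmp i Q k = Q ?m" if "i < k" for i using that by (simp add: merge_at_def)
  have mk: "merge_at cmp k Q k = cmp (Q k) (Q ?m)" by (simp add: merge_at_def)
  have rw: "r = (fst (Q 0), word k Q @ snd (Q k) @ snd (Q ?m))"
    using diag_eq[OF d] by (simp add: word_Suc)
  show ?thesis
  proof (cases "a \<in> set (snd (Q ?m))")
    case True
    have nk: "a \<notin> set (snd (Q k))"
    proof
      assume "a \<in> set (snd (Q k))"
      then obtain us vs where "snd (Q k) = us @ a # vs" by (meson split_list)
      then have "path (fst (Q 0), (word k Q @ us) @ a # vs @ snd (Q ?m))" using B_path[OF r] rw by simp
      from path_split_unique[OF this] True show False by simp
    qed
    \<comment> \<open>This is \<open>diag_cocycle\<close> with the last path shortened to a prefix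
      xs, which stays outside I. The last term does not depend on xs, so it disappears from the
      difference of two prefixes.\<close>
    have main: "?\<phi> ((sh 1 Q)(k := (fst (Q ?m), xs)))
       + (\<Sum>i<k. (-1) ^ (i + 1) * ?\<phi> ((merge_at cmp i Q)(k := (fst (Q ?m), xs))))
       + (-1) ^ Suc k * ?\<phi> ((merge_at cmp k Q)(k := (fst (Q k), snd (Q k) @ xs))) + (-1) ^ k * ?\<phi> Q = 0"
      if xs: "snd (Q ?m) = xs @ ys" for xs ys
    proof -
      define Q' where "Q' = Q(?m := (fst (Q ?m), xs))"
      have "(fst (Q ?m), [] @ xs @ ys) \<in> B" using Q[of ?m] xs by (cases "Q ?m") auto
      then have "(fst (Q ?m), xs) \<in> B" using B_factor by fastforce
      then have Q': "Q' j \<in> B" for j using Q by (simp add: Q'_def)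
      have "r = (fst (Q 0), [] @ (word ?m Q @ xs) @ ys)" unfolding rw xs by (simp add: word_Suc)
      then have r': "(fst (Q 0), word ?m Q @ xs) \<in> B" using r B_factor[of "fst (Q 0)" "[]"] by simp
      have "word ?m Q' = word ?m Q" by (rule word_cong) (simp add: Q'_def)
      moreover have "chain (Suc ?m) Q'" using d by (auto simp: diag_def chain_def Q'_def)
      ultimately have "diag (Suc ?m) Q' (fst (Q 0), word ?m Q @ xs)"
        by (simp add: diag_def word_Suc[of ?m]) (simp add: Q'_def)
      note diag_cocycle[OF f Q' r' this]
      moreover have "sh 1 Q' = (sh 1 Q)(k := (fst (Q ?m), xs))"
        by (auto simp: sh_def Q'_def fun_eq_iff)
      moreover have "merge_at cmp i Q' = (merge_at cmp i Q)(k := (fst (Q ?m), xs))" if "i < k" for i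
        using that by (intro ext) (auto simp: merge_at_def Q'_def)
      moreover have "merge_at cmp k Q' = (merge_at cmp k Q)(k := (fst (Q k), snd (Q k) @ xs))"
        by (intro ext) (auto simp: merge_at_def Q'_def cmp_def)
      moreover have "?\<phi> Q' = ?\<phi> Q" by (rule diag_value_cong[OF cf]) (simp add: Q'_def)
      ultimately show ?thesis by simp
    qed
    obtain ys where ys: "snd (Q ?m) = (?tw (snd (Q ?m)) @ [a]) @ ys"
    proof -
      obtain us vs where "snd (Q ?m) = us @ a # vs" "a \<notin> set us" using split_list_first[OF True] by blast
      then have "?tw (snd (Q ?m)) = us" by (auto simp: takeWhile_append takeWhile_eq_all_conv)
      then show thesis using that[of vs] \<open>snd (Q ?m) = us @ a # vs\<close> by simp
    qed
    have ys': "snd (Q ?m) = ?tw (snd (Q ?m)) @ (a # ys)" using ys by simp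
    have "?tw (snd (Q k) @ zs) = snd (Q k) @ ?tw zs" for zs
      using nk by (auto simp: takeWhile_append)
    note tw = this
    let ?x = "?tw (snd (Q ?m)) @ [a]" and ?y = "?tw (snd (Q ?m))"
    let ?L = "\<lambda>xs. ?\<phi> ((sh 1 Q)(k := (fst (Q ?m), xs)))"
    let ?M = "\<lambda>i xs. ?\<phi> ((merge_at cmp i Q)(k := (fst (Q ?m), xs)))"
    let ?N = "\<lambda>xs. ?\<phi> ((merge_at cmp k Q)(k := (fst (Q k), snd (Q k) @ xs)))"
    have "arrow_part f k a (sh 1 Q) = ?L ?x - ?L ?y"
      unfolding arrow_part_def sk using True by simp
    moreover have "(\<Sum>i<k. (-1) ^ (i + 1) * arrow_part f k a (merge_at cmp i Q))
        = (\<Sum>i<k. (-1) ^ (i + 1) * ?M i ?x) - (\<Sum>i<k. (-1) ^ (i + 1) * ?M i ?y)"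
      unfolding sum_subtractf[symmetric] right_diff_distrib[symmetric]
      using True by (intro sum.cong refl arg_cong2[where f = "(*)"]) (simp add: arrow_part_def mi)
    moreover have "arrow_part f k a (merge_at cmp k Q) = ?N ?x - ?N ?y"
      unfolding arrow_part_def mk using True by (simp add: tw)
    moreover have "arrow_part f k a Q = 0" using nk by (simp add: arrow_part_def)
    ultimately have "arrow_part f k a (sh 1 Q) + (\<Sum>i<k. (-1) ^ (i + 1) * arrow_part f k a (merge_at cmp i Q))
        + (-1) ^ Suc k * arrow_part f k a (merge_at cmp k Q) + (-1) ^ k * arrow_part f k a Q
      = (?L ?x + (\<Sum>i<k. (-1) ^ (i + 1) * ?M i ?x) + (-1) ^ Suc k * ?N ?x + (-1) ^ k * ?\<phi> Q)
      - (?L ?y + (\<Sum>i<k. (-1) ^ (i + 1) * ?M i ?y) + (-1) ^ Suc k * ?N ?y + (-1) ^ k * ?\<phi> Q)"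
      by (simp only: right_diff_distrib) simp
    then show ?thesis unfolding main[OF ys] main[OF ys'] by simp
  next
    case False
    have "arrow_part f k a (sh 1 Q) = 0" unfolding arrow_part_def sk using False by simp
    moreover have "arrow_part f k a (merge_at cmp i Q) = 0" if "i < k" for i
      unfolding arrow_part_def mi[OF that] using False by simp
    \<comment> \<open>When a is on \<open>Q k\<close>, both prefixes of the merged path end inside
      \<open>Q k\<close>.\<close>
    moreover have "arrow_part f k a (merge_at cmp k Q) = arrow_part f k a Q"
    proof (cases "a \<in> set (snd (Q k))")
      case True
      have "?tw (snd (Q k) @ snd (Q ?m)) = ?tw (snd (Q k))" using True by (auto simp: takeWhile_append)
      moreover have "?\<phi> ((merge_at cmp k Q)(k := y)) = ?\<phi> (Q(k := y))" for y
        by (rule diag_value_cong[OF cf]) (auto simp: merge_at_def)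
      ultimately show ?thesis using True unfolding arrow_part_def mk by simp
    qed (use False in \<open>simp add: arrow_part_def mk\<close>)
    ultimately show ?thesis by simp
  qed
qed

definition arrow_cocycle :: "((nat \<Rightarrow> ('v,'e) qpath \<Rightarrow> 'k) \<Rightarrow> ('v,'e) qpath \<Rightarrow> 'k::field) \<Rightarrow> nat \<Rightarrow> 'e \<Rightarrow>
    (nat \<Rightarrow> ('v,'e) qpath \<Rightarrow> 'k) \<Rightarrow> ('v,'e) qpath \<Rightarrow> 'k" where
  "arrow_cocycle f k a = mlext B (Suc k) (\<lambda>P r. if diag (Suc k) P r then arrow_part f k a P else 0)"

lemma arrow_cocycle_bas:
  assumes f: "coch B (Suc k) f" and P: "\<And>j. P j \<in> B" and r: "r \<in> B"
  shows "arrow_cocycle f k a (bs P) r = (if diag (Suc k) P r then arrow_part f k a P else 0)"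
  unfolding arrow_cocycle_def
proof (rule mlext_bas[OF finite_B P r])
  fix P Q :: "nat \<Rightarrow> ('v,'e) qpath" and r
  assume eq: "\<And>j. j < Suc k \<Longrightarrow> P j = Q j"
  have "diag_value f (Suc k) (P(k := y)) = diag_value f (Suc k) (Q(k := y))" for y
    by (rule diag_value_cong[OF f]) (simp add: eq)
  then have "arrow_part f k a P = arrow_part f k a Q" using eq[of k] by (simp add: arrow_part_def)
  moreover have "diag (Suc k) P r = diag (Suc k) Q r" by (rule diag_cong) (rule eq)
  ultimately show "(if diag (Suc k) P r then arrow_part f k a P else 0)
    = (if diag (Suc k) Q r then arrow_part f k a Q else 0)" by simp
qed

lemma cocycle_arrow_cocycle:
  fixes f :: "(nat \<Rightarrow> ('v,'e) qpath \<Rightarrow> 'k) \<Rightarrow> ('v,'e) qpath \<Rightarrow> 'k::field"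
  assumes f: "cocycle (Suc k) f"
  shows "cocycle (Suc k) (arrow_cocycle f k a)"
proof -
  have cf: "coch B (Suc k) f" using f by (simp add: cocycle_def)
  have g: "coch B (Suc k) (arrow_cocycle f k a)" unfolding arrow_cocycle_def by (rule coch_mlext[OF finite_B])
  have z: "coch B (Suc (Suc k)) (\<lambda>x r. 0 :: 'k)" using coch_scaled[OF coch_dif[OF g], of 0] by simp
  have "dif (Suc k) (arrow_cocycle f k a) x r = 0" for x r
  proof (rule coch_eq_on_bas[OF coch_dif[OF g] z])
    fix P :: "nat \<Rightarrow> ('v,'e) qpath" and r assume P: "\<And>j. P j \<in> B" and r: "r \<in> B"
    show "dif (Suc k) (arrow_cocycle f k a) (bs P) r = 0"
      using dif_diag[where n = "Suc k" and \<Theta> = "\<lambda>P _. arrow_part f k a P" and Q = P, OF g arrow_cocycle_bas[OF cf] P r]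
        arrow_part_cocycle[where a = a and Q = P, OF f P r]
      by (simp add: add_diff_eq)
  qed
  then show ?thesis using g by (simp add: cocycle_def)
qed

text \<open>Corrects for the telescoping sum over the last path starting at the value of the cocycle on a
  trivial last path, which need not be 0.\<close>

definition last_trivial :: "((nat \<Rightarrow> ('v,'e) qpath \<Rightarrow> 'k) \<Rightarrow> ('v,'e) qpath \<Rightarrow> 'k::field) \<Rightarrow> nat \<Rightarrow>
    (nat \<Rightarrow> ('v,'e) qpath \<Rightarrow> 'k) \<Rightarrow> ('v,'e) qpath \<Rightarrow> 'k" where
  "last_trivial f k = mlext B k (\<lambda>P r. if diag k P r then diag_value f (Suc k) (P(k := (pend r, []))) else 0)"

text \<open>Append a trivial path to P and apply \<open>diag_cocycle\<close>: absorbing this path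
  into \<open>P k\<close> and deleting it give the same value with opposite signs. The rest of the
  identity says that all terms of the differential except the last add up to 0.\<close>

lemma dif_last_trivial:
  fixes f :: "(nat \<Rightarrow> ('v,'e) qpath \<Rightarrow> 'k) \<Rightarrow> ('v,'e) qpath \<Rightarrow> 'k::field"
  assumes f: "cocycle (Suc k) f" and P: "\<And>j. P j \<in> B" and r: "r \<in> B"
  shows "dif k (last_trivial f k) (bs P) r = (if diag (Suc k) P r
    then (-1) ^ Suc k * diag_value f (Suc k) (P(k := (fst (P k), []))) else 0)"
proof -
  let ?\<phi> = "diag_value f (Suc k)"
  have cf: "coch B (Suc k) f" using f by (simp add: cocycle_def)
  have g: "coch B k (last_trivial f k)" unfolding last_trivial_def by (rule coch_mlext[OF finite_B])
  have gb: "last_trivial f k (bs P) r = (if diag k P r then ?\<phi> (P(k := (pend r, []))) else 0)"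
    if P: "\<And>j. P j \<in> B" and r: "r \<in> B" for P r
    unfolding last_trivial_def
  proof (rule mlext_bas[OF finite_B P r])
    fix P Q :: "nat \<Rightarrow> ('v,'e) qpath" and r
    assume eq: "\<And>j. j < k \<Longrightarrow> P j = Q j"
    have "?\<phi> (P(k := y)) = ?\<phi> (Q(k := y))" for y
      by (rule diag_value_cong[OF cf]) (simp add: eq)
    moreover have "diag k P r = diag k Q r" by (rule diag_cong) (rule eq)
    ultimately show "(if diag k P r then ?\<phi> (P(k := (pend r, []))) else 0)
      = (if diag k Q r then ?\<phi> (Q(k := (pend r, []))) else 0)" by simp
  qed
  show ?thesis
  proof (cases "diag (Suc k) P r")
    case True
    define Q where "Q = P(Suc k := (pend r, []))"
    have Q: "Q j \<in> B" for j using P r by (simp add: Q_def trivial_in_B B_pend)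
    have w: "word (Suc k) Q = word (Suc k) P" by (rule word_cong) (simp add: Q_def)
    have "pend r = pend (P k)"
      using diag_eq[OF True] pend_word[of "Suc k" P] True by (simp add: diag_def)
    then have d: "diag (Suc (Suc k)) Q r"
      using True w unfolding diag_def word_Suc[of "Suc k"]
      by (auto simp: chain_Suc[of "Suc k"] Q_def cong: chain_cong)
    have "?\<phi> (sh 1 Q) = ?\<phi> ((sh 1 P)(k := (pend r, [])))"
      by (rule diag_value_cong[OF cf]) (auto simp: Q_def sh_def)
    moreover have "?\<phi> (merge_at cmp i Q) = ?\<phi> ((merge_at cmp i P)(k := (pend r, [])))" if "i < k" for i
      by (rule diag_value_cong[OF cf]) (use that in \<open>auto simp: Q_def merge_at_def\<close>)
    moreover have "?\<phi> (merge_at cmp k Q) = ?\<phi> Q"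
      by (rule diag_value_cong[OF cf]) (auto simp: Q_def merge_at_def cmp_def less_Suc_eq)
    ultimately have "?\<phi> ((sh 1 P)(k := (pend r, [])))
       + (\<Sum>i<k. (-1) ^ (i + 1) * ?\<phi> ((merge_at cmp i P)(k := (pend r, [])))) = 0"
      using diag_cocycle[OF f Q r d] by simp
    then show ?thesis
      using dif_diag[where n = k and \<Theta> = "\<lambda>P v. ?\<phi> (P(k := (v, [])))" and Q = P, OF g gb P r] True by simp
  next
    case False
    then show ?thesis
      using dif_diag[where n = k and \<Theta> = "\<lambda>P v. ?\<phi> (P(k := (v, [])))" and Q = P, OF g gb P r] by simp
  qed
qed

end

section \<open>Decomposition into pieces through one arrow, and vanishing of products\<close>

context triangular_monomial
begin

text \<open>Parallelism is included because products are governed by the values, whereas the arrow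
  sits on the arguments; equal endpoints carry composability from the one to the other.\<close>

definition through_arrow :: "'e \<Rightarrow> nat \<Rightarrow> ((nat \<Rightarrow> ('v,'e) qpath \<Rightarrow> 'k::field) \<Rightarrow> ('v,'e) qpath \<Rightarrow> 'k) \<Rightarrow> bool" where
  "through_arrow a n f \<longleftrightarrow> (\<forall>P r. (\<forall>j. P j \<in> B) \<longrightarrow> f (bs P) r \<noteq> 0 \<longrightarrow> parallel n P r \<and> a \<in> set (word n P))"

lemma finite_E: "finite E"
  using quiver by (simp add: is_quiver_def)

lemma diag_parallel: "diag n P r \<Longrightarrow> n \<ge> 1 \<Longrightarrow> parallel n P r"
  using diag_eq[of n P r] pend_word[of n P] by (simp add: diag_def parallel_def)

lemma path_arrows: "path (v, xs) \<Longrightarrow> set xs \<subseteq> E"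
  by (simp add: is_path_def)

lemma path_distinct: "path (v, xs) \<Longrightarrow> distinct xs"
proof -
  assume p: "path (v, xs)"
  show ?thesis
  proof (rule ccontr)
    assume "\<not> distinct xs"
    then obtain us a vs ws where "xs = us @ [a] @ vs @ [a] @ ws" using not_distinct_decomp by blast
    then show False using path_split_unique[of v us a "vs @ [a] @ ws"] p by simp
  qed
qed

text \<open>Each basis tuple with its value falls into one of three classes: not parallel, supplied
  by the prism; parallel but not diagonal, supplied by the unique first differing arrow; diagonal,
  supplied by the telescoping sum together with its initial value from
  \<open>last_trivial\<close>.\<close>

lemma through_arrow_decomposition:
  fixes f :: "(nat \<Rightarrow> ('v,'e) qpath \<Rightarrow> 'k) \<Rightarrow> ('v,'e) qpath \<Rightarrow> 'k::field"
  assumes f: "cocycle (Suc k) f"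
  shows "\<exists>h F. coch B k h \<and> (\<forall>a. cocycle (Suc k) (F a) \<and> through_arrow a (Suc k) (F a)) \<and>
    (\<forall>x r. f x r = dif k h x r + (\<Sum>a\<in>E. F a x r))"
proof -
  have cf: "coch B (Suc k) f" and df: "dif (Suc k) f x r = 0" for x r
    using f unfolding cocycle_def by blast+
  \<comment> \<open>The prism has differential restriction minus f, whence the sign -1; the sign
    (-1)^(k+1) cancels the one in \<open>dif_last_trivial\<close>.\<close>
  define h where "h x r = - 1 * prism f k x r + (-1) ^ Suc k * last_trivial f k x r" for x r
  define F where "F a x r = restr (Suc k) (diff_at (Some a)) f x r + arrow_cocycle f k a x r" for a x r
  have ch: "coch B k h" unfolding h_def[abs_def]
    by (intro coch_plus coch_scaled coch_prism) (simp add: last_trivial_def coch_mlext[OF finite_B])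
  have dh: "dif k h x r = - dif k (prism f k) x r + (-1) ^ Suc k * dif k (last_trivial f k) x r" for x r
    using dif_sums[where n = k and I = "UNIV :: bool set" and c = "\<lambda>b. if b then - 1 else (-1) ^ Suc k"
        and f = "\<lambda>b. if b then prism f k else last_trivial f k" and x = x and r = r]
    by (simp add: UNIV_bool h_def[abs_def] add.commute)
  have cr: "cocycle (Suc k) (restr (Suc k) (diff_at (Some a)) f)" for a
    by (rule cocycle_restr[OF diff_at_compat f]) simp
  have F: "cocycle (Suc k) (F a)" for a
  proof -
    have "dif (Suc k) (F a) x r = dif (Suc k) (restr (Suc k) (diff_at (Some a)) f) x r
        + dif (Suc k) (arrow_cocycle f k a) x r" for x r
      using dif_sums[where n = "Suc k" and I = "UNIV :: bool set" and c = "\<lambda>_. 1" and x = x and r = r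
        and f = "\<lambda>b. if b then restr (Suc k) (diff_at (Some a)) f else arrow_cocycle f k a"]
      by (simp add: UNIV_bool F_def[abs_def] add.commute)
    then show ?thesis using cr[of a] cocycle_arrow_cocycle[OF f, of a]
      unfolding cocycle_def by (auto simp: F_def[abs_def] intro: coch_plus)
  qed
  have Fb: "F a (bs P) r = (if diff_at (Some a) (Suc k) P r then f (bs P) r else 0)
      + (if diag (Suc k) P r then arrow_part f k a P else 0)"
    if P: "\<And>j. P j \<in> B" and r: "r \<in> B" for a P r
    using restr_bas[where P = P and r = r, OF diff_at_compat[of "Some a"] cf _ P] arrow_cocycle_bas[where P = P and r = r, OF cf P r]
    by (simp add: F_def)
  have through: "through_arrow a (Suc k) (F a)" for a
    unfolding through_arrow_def
  proof (intro allI impI)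
    fix P :: "nat \<Rightarrow> ('v,'e) qpath" and r assume P: "\<forall>j. P j \<in> B" and nz: "F a (bs P) r \<noteq> 0"
    have r: "r \<in> B"
    proof (rule ccontr)
      assume r: "r \<notin> B"
      have "coch B (Suc k) (F a)" using F by (simp add: cocycle_def)
      from coch_out[OF this r] nz show False by blast
    qed
    from nz consider "diff_at (Some a) (Suc k) P r" | "diag (Suc k) P r" "arrow_part f k a P \<noteq> 0"
      using Fb[of P r a] P r by (auto split: if_splits)
    then show "parallel (Suc k) P r \<and> a \<in> set (word (Suc k) P)"
    proof cases
      case 1
      then show ?thesis using first_diff_SomeD by (auto simp: diff_at_def)
    next
      case 2
      then have "a \<in> set (snd (P k))" by (auto simp: arrow_part_def split: if_splits)
      then show ?thesis using diag_parallel[OF 2(1)] by (simp add: word_Suc)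
    qed
  qed
  have sum: "coch B (Suc k) (\<lambda>x r. dif k h x r + (\<Sum>a\<in>E. F a x r))"
    using F unfolding cocycle_def by (intro coch_plus coch_dif ch coch_sums) blast
  have "f x r = dif k h x r + (\<Sum>a\<in>E. F a x r)" for x r
  proof (rule coch_eq_on_bas[OF cf sum])
    fix P :: "nat \<Rightarrow> ('v,'e) qpath" and r assume P: "\<And>j. P j \<in> B" and r: "r \<in> B"
    let ?p = "diag_value f (Suc k) (P(k := (fst (P k), [])))"
    have s1: "(\<Sum>a\<in>E. if diff_at (Some a) (Suc k) P r then f (bs P) r else 0)
      = (if parallel (Suc k) P r \<and> \<not> diag (Suc k) P r then f (bs P) r else 0)"
    proof (cases "parallel (Suc k) P r")
      case True
      show ?thesis
      proof (cases "first_diff (word (Suc k) P) (snd r)")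
        case None
        then have "diag (Suc k) P r" using diff_at_None[where P = P and n = "Suc k", OF _ P r] True by (simp add: diff_at_def)
        then show ?thesis using None by (simp add: diff_at_def)
      next
        case (Some b)
        then have "\<not> diag (Suc k) P r" using diff_at_None[where P = P and n = "Suc k", OF _ P r] by (simp add: diff_at_def)
        moreover have "b \<in> E"
          using first_diff_SomeD[OF Some] path_arrows[OF parallel_path(1)[OF True _ P]] by auto
        ultimately show ?thesis using Some True finite_E by (simp add: diff_at_def)
      qed
    qed (simp add: diff_at_def)
    \<comment> \<open>The prefixes of \<open>P k\<close> lead from the empty one, whose value is
      \<open>?p\<close>, to the whole path, whose value is f on P.\<close>
    have s2: "(\<Sum>a\<in>E. if diag (Suc k) P r then arrow_part f k a P else 0)
      = (if diag (Suc k) P r then f (bs P) r - ?p else 0)"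
    proof (cases "diag (Suc k) P r")
      case True
      let ?\<Phi> = "\<lambda>xs. diag_value f (Suc k) (P(k := (fst (P k), xs)))"
      have pk: "path (fst (P k), snd (P k))" using B_path[OF P[of k]] by simp
      have "(\<Sum>a\<in>E. arrow_part f k a P) = ?\<Phi> (snd (P k)) - ?\<Phi> []"
        using sum_takeWhile_telescope[OF path_distinct[OF pk] path_arrows[OF pk] finite_E, of ?\<Phi>]
        by (simp add: arrow_part_def cong: if_cong)
      also have "?\<Phi> (snd (P k)) = f (bs P) r" using diag_eq[OF True] by (simp add: diag_value_def)
      finally show ?thesis by (simp only: True if_True)
    qed simp
    have "(\<Sum>a\<in>E. F a (bs P) r) = (if parallel (Suc k) P r \<and> \<not> diag (Suc k) P r then f (bs P) r else 0)
        + (if diag (Suc k) P r then f (bs P) r - ?p else 0)"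
      using Fb[of P r] P r s1 s2 by (simp add: sum.distrib)
    moreover have "dif k h (bs P) r = - ((if parallel (Suc k) P r then f (bs P) r else 0) - f (bs P) r)
        + (if diag (Suc k) P r then ?p else 0)"
      unfolding dh dif_prism[where P = P, OF cf df P r] dif_last_trivial[where P = P, OF f P r]
      by (simp add: minus_one_power_iff)
    ultimately show "f (bs P) r = dif k h (bs P) r + (\<Sum>a\<in>E. F a (bs P) r)"
      using diag_parallel[of "Suc k" P r] by auto
  qed
  then show ?thesis using ch F through by blast
qed

lemma cup_through_before:
  fixes f g :: "(nat \<Rightarrow> ('v,'e) qpath \<Rightarrow> 'k) \<Rightarrow> ('v,'e) qpath \<Rightarrow> 'k::field"
  assumes f: "coch B m f" and g: "coch B n g" and m: "m \<ge> 1" and n: "n \<ge> 1"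
    and a: "through_arrow a m f" and b: "through_arrow b n g" and nz: "cup m f g x r \<noteq> 0"
  shows "before a b"
proof (rule ccontr)
  assume nb: "\<not> before a b"
  have z: "coch B (m + n) (\<lambda>x r. 0 :: 'k)" using coch_scaled[OF coch_cup[OF f g], of 0] by simp
  have "cup m f g x r = 0"
  proof (rule coch_eq_on_bas[OF coch_cup[OF f g] z], rule ccontr)
    fix P :: "nat \<Rightarrow> ('v,'e) qpath" and r
    assume P: "\<And>j. P j \<in> B" and r: "r \<in> B" and nz: "cup m f g (bs P) r \<noteq> 0"
    have "\<exists>p\<in>B. \<exists>q\<in>B. pend p = fst q \<and> f (bs P) p \<noteq> 0 \<and> g (bs (sh m P)) q \<noteq> 0"
    proof (rule ccontr)
      assume "\<not> ?thesis"
      then have "(if pend p = fst q \<and> cmp p q = r then f (bs P) p * g (bs (sh m P)) q else 0) = 0"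
        if "p \<in> B" "q \<in> B" for p q using that by auto
      then have "mul (f (bs P)) (g (bs (sh m P))) r = 0" by (simp add: mul_eq)
      then show False using nz by (simp add: cup_def sh_bas)
    qed
    then obtain p q where l: "pend p = fst q" and "f (bs P) p \<noteq> 0" "g (bs (sh m P)) q \<noteq> 0" by blast
    moreover have S: "sh m P j \<in> B" for j using P by (simp add: sh_def)
    ultimately have pa: "parallel m P p" "a \<in> set (word m P)"
      and qb: "parallel n (sh m P) q" "b \<in> set (word n (sh m P))"
      using a b P unfolding through_arrow_def by blast+
    \<comment> \<open>The values p and q compose, and each is parallel to its argument word, so the
      words compose too, although they may differ from p and q.\<close>
    have "path (fst p, word m P @ word n (sh m P))"
      using parallel_path[OF pa(1) m P] parallel_path[OF qb(1) n S] l by (simp add: path_append)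
    moreover obtain us vs us' vs' where "word m P = us @ a # vs" "word n (sh m P) = us' @ b # vs'"
      using pa(2) qb(2) by (meson split_list)
    ultimately have "path (fst p, us @ a # (vs @ us') @ b # vs')" by simp
    then show False using nb unfolding before_def by blast
  qed
  then show False using nz by simp
qed

lemma exact_cup:
  fixes f g :: "(nat \<Rightarrow> ('v,'e) qpath \<Rightarrow> 'k) \<Rightarrow> ('v,'e) qpath \<Rightarrow> 'k::field"
  assumes f: "cocycle m f" and g: "cocycle n g" and m: "m \<ge> 1" and n: "n \<ge> 1"
  shows "exact (m + n - 1) (cup m f g)"
proof -
  have Suc: "m = Suc (m - 1)" "n = Suc (n - 1)" using m n by auto
  obtain hf F where F: "coch B (m - 1) hf" "\<And>a. cocycle m (F a)" "\<And>a. through_arrow a m (F a)"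
    "\<And>x r. f x r = dif (m - 1) hf x r + (\<Sum>a\<in>E. F a x r)"
    using through_arrow_decomposition[of "m - 1" f] f Suc by metis
  obtain hg G where G: "coch B (n - 1) hg" "\<And>a. cocycle n (G a)" "\<And>a. through_arrow a n (G a)"
    "\<And>x r. g x r = dif (n - 1) hg x r + (\<Sum>a\<in>E. G a x r)"
    using through_arrow_decomposition[of "n - 1" g] g Suc by metis
  have "(\<forall>x r. cup m (F a) (G b) x r = 0) \<or> (\<forall>x r. cup n (G b) (F a) x r = 0)" for a b
  proof -
    have "coch B m (F a)" "coch B n (G b)" using F(2) G(2) by (simp_all add: cocycle_def)
    then show ?thesis
      using cup_through_before[of m "F a" n "G b" a b] cup_through_before[of n "G b" m "F a" b a]
        F(3)[of a] G(3)[of b] m n before_asym[of a b] by metis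
  qed
  then show ?thesis using exact_cup_of_decompositions[OF f g m n F(1,2,4) G(1,2,4)] by blast
qed

end

section \<open>Passage between cochains on lists and cochains on sequences\<close>

context triangular_monomial
begin

text \<open>Cochains on lists are constrained only for arguments in the algebra. Projecting the
  arguments first turns them into maps that are linear on all coefficient functions, as
  \<open>lin\<close> demands.\<close>

definition proj :: "(('v,'e) qpath \<Rightarrow> 'k) \<Rightarrow> ('v,'e) qpath \<Rightarrow> 'k::field" where
  "proj x = (\<lambda>p. if p \<in> B then x p else 0)"

definition seq_cochain :: "nat \<Rightarrow> ((('v,'e) qpath \<Rightarrow> 'k::field) list \<Rightarrow> ('v,'e) qpath \<Rightarrow> 'k) \<Rightarrow>
    (nat \<Rightarrow> ('v,'e) qpath \<Rightarrow> 'k) \<Rightarrow> ('v,'e) qpath \<Rightarrow> 'k" where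
  "seq_cochain n f x = f (map (\<lambda>j. proj (x j)) [0..<n])"

lemma in_alg_proj [simp]: "in_alg B (proj x)"
  by (simp add: in_alg_def proj_def)

lemma proj_in_alg: "in_alg B x \<Longrightarrow> proj x = x"
  by (auto simp: in_alg_def proj_def fun_eq_iff)

lemma in_alg_mul: "in_alg B (mul x y)"
  by (simp add: in_alg_def mul_eq)

lemma mul_proj_left: "mul (proj x) y = (mul x y :: _ \<Rightarrow> 'k::field)"
  by (rule lin_cong_on[OF lin_mul_left]) (simp add: proj_def)

lemma mul_proj_right: "mul x (proj y) = (mul x y :: _ \<Rightarrow> 'k::field)"
  by (rule lin_cong_on[OF lin_mul_right]) (simp add: proj_def)

lemma hoch_cochain_update:
  assumes "hoch_cochain B n f" "length as = n" "\<forall>a\<in>set as. in_alg B a" "i < n" "in_alg B x" "in_alg B y"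
  shows "f (as[i := (\<lambda>p. x p + y p)]) = (\<lambda>p. f (as[i := x]) p + f (as[i := y]) p)"
    and "f (as[i := (\<lambda>p. c * x p)]) = (\<lambda>p. c * f (as[i := x]) p)"
  using assms unfolding hoch_cochain_def by blast+

lemma hoch_cochain_update_sum:
  assumes f: "hoch_cochain B n f" and as: "length as = n" "\<forall>a\<in>set as. in_alg B a" and i: "i < n"
    and S: "finite S" "S \<subseteq> B"
  shows "f (as[i := (\<lambda>q. \<Sum>p\<in>S. c p * bas p q)]) r = (\<Sum>p\<in>S. c p * f (as[i := bas p]) r)"
  using S
proof (induction S rule: finite_induct)
  case empty
  \<comment> \<open>The value at a zero argument is obtained from homogeneity with the scalar
    0.\<close>
  have "in_alg B (\<lambda>p. 0 :: 'a)" by (simp add: in_alg_def)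
  from hoch_cochain_update(2)[OF f as i this this, of 0] show ?case by simp
next
  case (insert p S)
  have A: "in_alg B (bas q :: _ \<Rightarrow> 'a)" if "q \<in> B" for q using that by (auto simp: in_alg_def bas_def)
  have 1: "in_alg B (\<lambda>q. c p * bas p q)" using A[of p] insert.prems by (simp add: in_alg_def)
  have 2: "in_alg B (\<lambda>q. \<Sum>p\<in>S. c p * bas p q)"
    using insert.prems by (auto simp: in_alg_def bas_def intro!: sum.neutral)
  have "f (as[i := (\<lambda>q. c p * bas p q + (\<Sum>p\<in>S. c p * bas p q))]) r
     = f (as[i := (\<lambda>q. c p * bas p q)]) r + f (as[i := (\<lambda>q. \<Sum>p\<in>S. c p * bas p q)]) r"
    by (simp add: hoch_cochain_update(1)[OF f as i 1 2])
  moreover have "f (as[i := (\<lambda>q. c p * bas p q)]) = (\<lambda>q. c p * f (as[i := bas p]) q)"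
    using insert.prems by (intro hoch_cochain_update(2)[OF f as i A[of p] A[of p]]) auto
  ultimately show ?case using insert by simp
qed

lemma coch_seq_cochain:
  fixes f :: "(('v,'e) qpath \<Rightarrow> 'k::field) list \<Rightarrow> ('v,'e) qpath \<Rightarrow> 'k"
  assumes f: "hoch_cochain B n f"
  shows "coch B n (seq_cochain n f)"
proof (rule cochI)
  fix x y :: "nat \<Rightarrow> ('v,'e) qpath \<Rightarrow> 'k" assume "\<And>j. j < n \<Longrightarrow> x j = y j"
  then show "seq_cochain n f x = seq_cochain n f y"
    unfolding seq_cochain_def by (intro arg_cong[where f = f] map_cong) auto
next
  fix i and x :: "nat \<Rightarrow> ('v,'e) qpath \<Rightarrow> 'k" assume i: "i < n"
  define as where "as = map (\<lambda>j. proj (x j)) [0..<n]"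
  have upd: "seq_cochain n f (x(i := a)) = f (as[i := proj a])" for a
    unfolding seq_cochain_def as_def
    by (intro arg_cong[where f = f] nth_equalityI) (auto simp: nth_list_update)
  have as: "length as = n" "\<forall>a\<in>set as. in_alg B a" by (auto simp: as_def)
  show "lin B (\<lambda>a. seq_cochain n f (x(i := a)))"
  proof (rule linI)
    fix a :: "('v,'e) qpath \<Rightarrow> 'k" and r
    have "proj a = (\<lambda>q. \<Sum>p\<in>B. a p * bas p q)"
    proof
      fix q
      have "(\<Sum>p\<in>B. a p * bas p q) = (\<Sum>p\<in>B. if q = p then a p else 0)"
        by (rule sum.cong) (auto simp: bas_def)
      then show "proj a q = (\<Sum>p\<in>B. a p * bas p q)" using finite_B by (simp add: proj_def)
    qed
    then have "f (as[i := proj a]) r = (\<Sum>p\<in>B. a p * f (as[i := bas p]) r)"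
      using hoch_cochain_update_sum[OF f as i finite_B order_refl, of a r] by simp
    also have "\<dots> = (\<Sum>p\<in>B. a p * f (as[i := proj (bas p)]) r)"
      by (intro sum.cong refl) (simp add: proj_in_alg in_alg_def bas_def)
    finally show "seq_cochain n f (x(i := a)) r = (\<Sum>p\<in>B. a p * seq_cochain n f (x(i := bas p)) r)"
      unfolding upd .
  qed
next
  fix x :: "nat \<Rightarrow> ('v,'e) qpath \<Rightarrow> 'k" and r :: "('v,'e) qpath" assume r: "r \<notin> B"
  have "in_alg B (seq_cochain n f x)"
    using f unfolding seq_cochain_def hoch_cochain_def by auto
  then show "seq_cochain n f x r = 0" using r unfolding in_alg_def by blast
qed

lemma cocycle_seq_cochain:
  fixes f :: "(('v,'e) qpath \<Rightarrow> 'k::field) list \<Rightarrow> ('v,'e) qpath \<Rightarrow> 'k"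
  assumes f: "hoch_cocycle t B n f"
  shows "cocycle n (seq_cochain n f)"
proof -
  have "dif n (seq_cochain n f) x r = 0" for x r
  proof -
    define as where "as = map (\<lambda>j. proj (x j)) [0..<Suc n]"
    have nth: "as ! j = proj (x j)" if "j \<le> n" for j using that by (simp add: as_def del: upt_Suc)
    have len: "length as = Suc n" by (simp add: as_def)
    have "\<forall>a\<in>set as. in_alg B a" by (auto simp: as_def)
    then have "hoch_d t B n f as r = 0" using f len unfolding hoch_cocycle_def by simp
    moreover have "tl as = map (\<lambda>j. proj (sh 1 x j)) [0..<n]"
      by (rule nth_equalityI) (simp_all add: len nth nth_tl sh_def)
    moreover have "take n as = map (\<lambda>j. proj (x j)) [0..<n]"
      by (rule nth_equalityI) (simp_all add: len nth)
    moreover have "take i as @ [mul (as ! i) (as ! Suc i)] @ drop (i + 2) as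
        = map (\<lambda>j. proj (merge_at mul i x j)) [0..<n]" if "i < n" for i
      by (rule nth_equalityI)
        (use that in \<open>auto simp: len nth nth_append merge_at_def mul_proj_left mul_proj_right
           proj_in_alg[OF in_alg_mul] nth_Cons' Suc_le_eq\<close>)
    ultimately show ?thesis
      unfolding hoch_d_def dif_def seq_cochain_def by (simp add: nth mul_proj_left mul_proj_right)
  qed
  then show ?thesis using coch_seq_cochain f by (auto simp: cocycle_def hoch_cocycle_def)
qed

text \<open>The sequence \<open>(!) as\<close> is unspecified beyond the list, but h sees only its
  first n entries.\<close>

lemma hoch_cochain_of_coch:
  fixes h :: "(nat \<Rightarrow> ('v,'e) qpath \<Rightarrow> 'k::field) \<Rightarrow> ('v,'e) qpath \<Rightarrow> 'k"
  assumes h: "coch B n h"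
  shows "hoch_cochain B n (\<lambda>as. h ((!) as))"
proof -
  have upd: "h ((!) (as[i := x])) = h (((!) as)(i := x))" if "length as = n" for as i x
    by (rule coch_cong[OF h]) (use that in \<open>auto simp: nth_list_update\<close>)
  show ?thesis unfolding hoch_cochain_def
  proof (intro conjI allI impI)
    fix as :: "(('v,'e) qpath \<Rightarrow> 'k) list" and i and x y :: "('v,'e) qpath \<Rightarrow> 'k" and c :: 'k
    assume *: "length as = n \<and> (\<forall>a\<in>set as. in_alg B a) \<and> i < n \<and> in_alg B x \<and> in_alg B y"
    then have l: "lin B (\<lambda>a. h (((!) as)(i := a)))" using coch_lin[OF h] by blast
    show "h ((!) (as[i := \<lambda>p. x p + y p])) = (\<lambda>p. h ((!) (as[i := x])) p + h ((!) (as[i := y])) p)"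
      using * lin_add[OF l] by (intro ext) (simp add: upd)
    show "h ((!) (as[i := \<lambda>p. c * x p])) = (\<lambda>p. c * h ((!) (as[i := x])) p)"
      using * lin_scale[OF l] by (intro ext) (simp add: upd)
  qed (simp add: in_alg_def coch_out[OF h])
qed

lemma hoch_d_of_coch:
  fixes h :: "(nat \<Rightarrow> ('v,'e) qpath \<Rightarrow> 'k::field) \<Rightarrow> ('v,'e) qpath \<Rightarrow> 'k"
  assumes h: "coch B n h" and len: "length as = Suc n"
  shows "hoch_d t B n (\<lambda>as. h ((!) as)) as r = dif n h ((!) as) r"
proof -
  have "h ((!) (tl as)) = h (sh 1 ((!) as))"
    by (rule coch_cong[OF h]) (simp add: len nth_tl sh_def)
  moreover have "h ((!) (take n as)) = h ((!) as)"
    by (rule coch_cong[OF h]) simp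
  moreover have "h ((!) (take i as @ [mul (as ! i) (as ! Suc i)] @ drop (i + 2) as))
      = h (merge_at mul i ((!) as))" if "i < n" for i
    by (rule coch_cong[OF h])
      (use that in \<open>auto simp: len nth_append merge_at_def nth_Cons' Suc_le_eq\<close>)
  ultimately show ?thesis unfolding hoch_d_def dif_def by simp
qed

lemma hoch_cup_seq_cochain:
  assumes "length as = m + n" "\<forall>a\<in>set as. in_alg B a"
  shows "cup m (seq_cochain m f) (seq_cochain n g) ((!) as) = hoch_cup t B m f g as"
proof -
  have p: "proj (as ! j) = as ! j" if "j < m + n" for j
    using assms that by (intro proj_in_alg) simp
  have "map (\<lambda>j. proj (as ! j)) [0..<m] = take m as"
    by (rule nth_equalityI) (simp_all add: assms(1) p)
  moreover have "map (\<lambda>j. proj (sh m ((!) as) j)) [0..<n] = drop m as"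
    by (rule nth_equalityI) (simp_all add: assms(1) p sh_def add.commute)
  ultimately show ?thesis by (simp add: cup_def seq_cochain_def hoch_cup_def)
qed

end

theorem mainTheorem14:
  fixes V :: "'v set" and E :: "'e set" and s t :: "'e \<Rightarrow> 'v"
    and R :: "('v,'e) qpath set"
    and f g :: "(('v,'e) qpath \<Rightarrow> 'k::field) list \<Rightarrow> (('v,'e) qpath \<Rightarrow> 'k)"
    and m n :: nat
  assumes "is_quiver V E s t"
    and "triangular V E s t"
    and "monomial_relations V E s t R"
    and "finite (nz_paths V E s t R)"
    and "m \<ge> 1" and "n \<ge> 1"
    and "hoch_cocycle t (nz_paths V E s t R) m f"
    and "hoch_cocycle t (nz_paths V E s t R) n g"
  shows "hoch_coboundary t (nz_paths V E s t R) (m + n)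
           (hoch_cup t (nz_paths V E s t R) m f g)"
proof -
  interpret triangular_monomial V E s t R
    using assms(1-4) by unfold_locales
  have "exact (m + n - 1) (cup m (seq_cochain m f) (seq_cochain n g))"
    using assms(5-8) by (intro exact_cup cocycle_seq_cochain)
  then obtain h where h: "coch B (m + n - 1) h"
    "\<And>x r. dif (m + n - 1) h x r = cup m (seq_cochain m f) (seq_cochain n g) x r"
    unfolding exact_def by blast
  \<comment> \<open>On arguments in the algebra \<open>proj\<close> is the identity, so the cup
    product on sequences agrees with \<open>hoch_cup\<close>.\<close>
  have "hoch_d t B (m + n - 1) (\<lambda>as. h ((!) as)) as = hoch_cup t B m f g as"
    if "length as = m + n" "\<forall>a\<in>set as. in_alg B a" for as
    using hoch_d_of_coch[OF h(1), of as] hoch_cup_seq_cochain[OF that] that(1) assms(5) h(2)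
    by (intro ext) simp
  then show ?thesis
    unfolding hoch_coboundary_def using hoch_cochain_of_coch[OF h(1)] by blast
qed

end
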